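(* Let $\mathbb{F}$ be a field, $\alpha$ a short root and $\theta\in U_\alpha\setminus\{1\}$, acting on the split building $\Delta_\Phi(\mathbb{F})$. (i) If $\Phi=\mathsf{F}_4$ then $\theta$ is type preserving with $\mathrm{Type}(\theta)=\{1,4\}$ if $\mathrm{char}(\mathbb{F})\neq2$ and $\mathrm{Type}(\theta)=\{4\}$ if $\mathrm{char}(\mathbb{F})=2$. (ii) If $\Phi=\mathsf{G}_2$ then $\mathrm{Type}(\theta)=S=\{1,2\}$ if $\mathrm{char}(\mathbb{F})\neq3$ and $\mathrm{Type}(\theta)=\{1\}$ if $\mathrm{char}(\mathbb{F})=3$.
   Context: Bourbaki labelling ($\alpha_3,\alpha_4$ short in $\mathsf{F}_4$; $\alpha_1$ short in $\mathsf{G}_2$). $U_\alpha=\{x_\alpha(a):a\in\mathbb{F}\}$ root subgroup of the Chevalley group. $\mathrm{Type}(\theta)$ is the union of types of simplices of $\Delta$ mapped by $\theta$ onto opposite simplices (simplices of type $J$ = cosets of $P_{S\setminus J}$; opposite = opposite types and contained in chambers at Weyl distance $w_0$). *)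

theory Defs
  imports Main "Jordan_Normal_Form.Matrix"
begin

datatype ctype = F4 | G2

text \<open>Gram matrix of the simple roots w.r.t. TWICE the Bourbaki-normalised
 invariant form.  F4: alpha1, alpha2 long (norm 4), alpha3, alpha4 short (norm 2).
 G2: alpha1 short (norm 2), alpha2 long (norm 6).  Simple roots are indexed
 0-based internally (index i-1 for the Bourbaki label i).\<close>
fun gram :: "ctype \<Rightarrow> int list list" where
  "gram F4 = [[4,-2,0,0],[-2,4,-2,0],[0,-2,2,-1],[0,0,-1,2]]"
| "gram G2 = [[2,-3],[-3,6]]"

fun long_norm :: "ctype \<Rightarrow> int" where
  "long_norm F4 = 4"
| "long_norm G2 = 6"

definition rank :: "ctype \<Rightarrow> nat" where
  "rank T = length (gram T)"

text \<open>Vectors of the root lattice, in coordinates w.r.t. the simple roots.\<close>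
definition ip :: "ctype \<Rightarrow> int list \<Rightarrow> int list \<Rightarrow> int" where
  "ip T u v = (\<Sum>i<rank T. \<Sum>j<rank T. u ! i * (gram T ! i ! j) * v ! j)"

definition vadd :: "int list \<Rightarrow> int list \<Rightarrow> int list" where
  "vadd u v = map2 (+) u v"

definition vneg :: "int list \<Rightarrow> int list" where
  "vneg u = map uminus u"

definition vsmul :: "int \<Rightarrow> int list \<Rightarrow> int list" where
  "vsmul c u = map (\<lambda>x. c * x) u"

text \<open>The roots: the root-lattice vectors of short or long norm (for F4 and G2
 this is exactly the root system).\<close>
definition Phi :: "ctype \<Rightarrow> int list set" where
  "Phi T = {v. length v = rank T \<and> ip T v v \<in> {2, long_norm T}}"

definition short_root :: "ctype \<Rightarrow> int list \<Rightarrow> bool" where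
  "short_root T a \<longleftrightarrow> a \<in> Phi T \<and> ip T a a = 2"

definition pos_root :: "ctype \<Rightarrow> int list \<Rightarrow> bool" where
  "pos_root T a \<longleftrightarrow> a \<in> Phi T \<and> (\<forall>c\<in>set a. c \<ge> 0)"

text \<open>A fixed enumeration of the roots (all root coefficients lie in [-4,4]).\<close>
definition roots_list :: "ctype \<Rightarrow> int list list" where
  "roots_list T = filter (\<lambda>v. v \<in> Phi T) (product_lists (replicate (rank T) [-4..4]))"

definition sroot :: "ctype \<Rightarrow> nat \<Rightarrow> int list" where
  "sroot T i = (replicate (rank T) 0)[i := 1]"

definition cartan_int :: "ctype \<Rightarrow> int list \<Rightarrow> int list \<Rightarrow> int" where
  "cartan_int T b a = (2 * ip T b a) div ip T a a"

definition coroot_coef :: "ctype \<Rightarrow> int list \<Rightarrow> nat \<Rightarrow> int" where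
  "coroot_coef T a k = (a ! k * ip T (sroot T k) (sroot T k)) div ip T a a"

definition pstr :: "ctype \<Rightarrow> int list \<Rightarrow> int list \<Rightarrow> nat" where
  "pstr T a b = Max {k. k \<le> 4 \<and> (\<forall>j\<in>{1..k}. vadd b (vsmul (- int j) a) \<in> Phi T)}"

text \<open>Basis of the Lie algebra: indices i < rank are the simple coroots h_i,
 index rank + k is e_a for a = roots_list ! k.\<close>
definition bdim :: "ctype \<Rightarrow> nat" where
  "bdim T = rank T + length (roots_list T)"

definition ridx :: "ctype \<Rightarrow> int list \<Rightarrow> nat" where
  "ridx T a = rank T + (THE k. k < length (roots_list T) \<and> roots_list T ! k = a)"

text \<open>Bracket of two basis vectors (coefficient vector), for given structure
 constants N: [h_i,h_j]=0, [h_i,e_b]=<b,a_i^\<or>>e_b, [e_a,e_{-a}]=h_a,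
 [e_a,e_b]=N a b e_{a+b} if a+b is a root, 0 otherwise.\<close>
definition brk :: "ctype \<Rightarrow> (int list \<Rightarrow> int list \<Rightarrow> int) \<Rightarrow> nat \<Rightarrow> nat \<Rightarrow> nat \<Rightarrow> int" where
  "brk T N i j =
    (let l = rank T; rl = roots_list T in
     if i < l \<and> j < l then (\<lambda>_. 0)
     else if i < l then (\<lambda>k. if k = j then cartan_int T (rl ! (j - l)) (sroot T i) else 0)
     else if j < l then (\<lambda>k. if k = i then - cartan_int T (rl ! (i - l)) (sroot T j) else 0)
     else (let a = rl ! (i - l); b = rl ! (j - l) in
       if vadd a b = replicate l 0 then (\<lambda>k. if k < l then coroot_coef T a k else 0)
       else if vadd a b \<in> Phi T then (\<lambda>k. if k = ridx T (vadd a b) then N a b else 0)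
       else (\<lambda>_. 0)))"

definition unitv :: "nat \<Rightarrow> nat \<Rightarrow> int" where
  "unitv j = (\<lambda>k. if k = j then 1 else 0)"

definition lbr :: "ctype \<Rightarrow> (int list \<Rightarrow> int list \<Rightarrow> int) \<Rightarrow> (nat \<Rightarrow> int) \<Rightarrow> (nat \<Rightarrow> int) \<Rightarrow> nat \<Rightarrow> int" where
  "lbr T N u v = (\<lambda>m. \<Sum>i<bdim T. \<Sum>j<bdim T. u i * v j * brk T N i j m)"

definition chev_constants :: "ctype \<Rightarrow> (int list \<Rightarrow> int list \<Rightarrow> int) \<Rightarrow> bool" where
  "chev_constants T N \<longleftrightarrow>
     (\<forall>a\<in>Phi T. \<forall>b\<in>Phi T. vadd a b \<in> Phi T \<longrightarrow> \<bar>N a b\<bar> = int (pstr T a b) + 1) \<and>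
     (\<forall>i<bdim T. \<forall>j<bdim T. brk T N i j = (\<lambda>m. - brk T N j i m)) \<and>
     (\<forall>i<bdim T. \<forall>j<bdim T. \<forall>k<bdim T. \<forall>m.
        lbr T N (unitv i) (brk T N j k) m + lbr T N (unitv j) (brk T N k i) m
        + lbr T N (unitv k) (brk T N i j) m = 0)"

definition adm :: "ctype \<Rightarrow> (int list \<Rightarrow> int list \<Rightarrow> int) \<Rightarrow> int list \<Rightarrow> int mat" where
  "adm T N a = mat (bdim T) (bdim T) (\<lambda>(r, c). brk T N (ridx T a) c r)"

text \<open>Root elements x_a(t) = exp(t ad e_a) = sum_k t^k (ad e_a)^k / k!
 (divided powers computed over the integers, then mapped into the field).\<close>
definition xr :: "ctype \<Rightarrow> (int list \<Rightarrow> int list \<Rightarrow> int) \<Rightarrow> int list \<Rightarrow> 'a::field \<Rightarrow> 'a mat" where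
  "xr T N a t = mat (bdim T) (bdim T)
     (\<lambda>(r, c). \<Sum>k<bdim T. t ^ k * of_int (((adm T N a) ^\<^sub>m k) $$ (r, c) div fact k))"

inductive_set gen_by :: "nat \<Rightarrow> 'a::semiring_1 mat set \<Rightarrow> 'a mat set" for d X where
  one: "1\<^sub>m d \<in> gen_by d X"
| step: "g \<in> gen_by d X \<Longrightarrow> x \<in> X \<Longrightarrow> x * g \<in> gen_by d X"

text \<open>The (adjoint = simply connected) Chevalley group G_Phi(F).  All generating
 sets below are closed under inverses, so the generated monoid is the generated
 subgroup.\<close>
definition chev_group :: "ctype \<Rightarrow> (int list \<Rightarrow> int list \<Rightarrow> int) \<Rightarrow> 'a::field mat set" where
  "chev_group T N = gen_by (bdim T) {xr T N a t | a t. a \<in> Phi T}"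

definition root_subgroup :: "ctype \<Rightarrow> (int list \<Rightarrow> int list \<Rightarrow> int) \<Rightarrow> int list \<Rightarrow> 'a::field mat set" where
  "root_subgroup T N a = {xr T N a t | t. True}"

definition nr :: "ctype \<Rightarrow> (int list \<Rightarrow> int list \<Rightarrow> int) \<Rightarrow> int list \<Rightarrow> 'a::field \<Rightarrow> 'a mat" where
  "nr T N a t = xr T N a t * xr T N (vneg a) (- inverse t) * xr T N a t"

definition hr :: "ctype \<Rightarrow> (int list \<Rightarrow> int list \<Rightarrow> int) \<Rightarrow> int list \<Rightarrow> 'a::field \<Rightarrow> 'a mat" where
  "hr T N a t = nr T N a t * nr T N a (- 1)"

definition borel_gens :: "ctype \<Rightarrow> (int list \<Rightarrow> int list \<Rightarrow> int) \<Rightarrow> 'a::field mat set" where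
  "borel_gens T N = {xr T N a t | a t. pos_root T a}
                    \<union> {hr T N (sroot T i) t | i t. i < rank T \<and> t \<noteq> 0}"

definition S :: "ctype \<Rightarrow> nat set" where
  "S T = {1..rank T}"

definition borel :: "ctype \<Rightarrow> (int list \<Rightarrow> int list \<Rightarrow> int) \<Rightarrow> 'a::field mat set" where
  "borel T N = gen_by (bdim T) (borel_gens T N)"

definition parabolic :: "ctype \<Rightarrow> (int list \<Rightarrow> int list \<Rightarrow> int) \<Rightarrow> nat set \<Rightarrow> 'a::field mat set" where
  "parabolic T N K = gen_by (bdim T)
     (borel_gens T N \<union> {xr T N (vneg (sroot T (i - 1))) t | i t. i \<in> K})"

text \<open>A reduced word for the longest element w0 (a power of a Coxeter element).\<close>
fun w0_word :: "ctype \<Rightarrow> nat list" where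
  "w0_word F4 = concat (replicate 6 [1,2,3,4])"
| "w0_word G2 = concat (replicate 3 [1,2])"

definition w0_rep :: "ctype \<Rightarrow> (int list \<Rightarrow> int list \<Rightarrow> int) \<Rightarrow> 'a::field mat" where
  "w0_rep T N = foldr (\<lambda>i M. nr T N (sroot T (i - 1)) 1 * M) (w0_word T) (1\<^sub>m (bdim T))"

definition refl :: "ctype \<Rightarrow> nat \<Rightarrow> int list \<Rightarrow> int list" where
  "refl T i v = vadd v (vsmul (- cartan_int T v (sroot T (i - 1))) (sroot T (i - 1)))"

definition opp_label :: "ctype \<Rightarrow> nat \<Rightarrow> nat" where
  "opp_label T i = (THE j. j \<in> S T \<and>
      foldr (refl T) (w0_word T) (sroot T (i - 1)) = vneg (sroot T (j - 1)))"

definition coset :: "'a::field mat \<Rightarrow> 'a mat set \<Rightarrow> 'a mat set" where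
  "coset g H = (\<lambda>h. g * h) ` H"

definition chamber :: "ctype \<Rightarrow> (int list \<Rightarrow> int list \<Rightarrow> int) \<Rightarrow> 'a::field mat set \<Rightarrow> bool" where
  "chamber T N C \<longleftrightarrow> (\<exists>g\<in>chev_group T N. C = coset g (borel T N))"

definition simplex_of_type :: "ctype \<Rightarrow> (int list \<Rightarrow> int list \<Rightarrow> int) \<Rightarrow> nat set \<Rightarrow> 'a::field mat set \<Rightarrow> bool" where
  "simplex_of_type T N J \<sigma> \<longleftrightarrow> J \<subseteq> S T \<and>
     (\<exists>g\<in>chev_group T N. \<sigma> = coset g (parabolic T N (S T - J)))"

definition weyl_dist_w0 :: "ctype \<Rightarrow> (int list \<Rightarrow> int list \<Rightarrow> int) \<Rightarrow> 'a::field mat set \<Rightarrow> 'a mat set \<Rightarrow> bool" where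
  "weyl_dist_w0 T N C D \<longleftrightarrow>
     (\<exists>g\<in>chev_group T N. \<exists>h\<in>chev_group T N.
        C = coset g (borel T N) \<and> D = coset h (borel T N) \<and>
        (\<exists>b1\<in>borel T N. \<exists>b2\<in>borel T N. h = g * b1 * w0_rep T N * b2))"

text \<open>A chamber C contains the simplex sigma (a parabolic coset) iff C is a subset of sigma.\<close>
definition opposite :: "ctype \<Rightarrow> (int list \<Rightarrow> int list \<Rightarrow> int) \<Rightarrow> 'a::field mat set \<Rightarrow> 'a mat set \<Rightarrow> bool" where
  "opposite T N \<sigma> \<tau> \<longleftrightarrow>
     (\<exists>J. simplex_of_type T N J \<sigma> \<and> simplex_of_type T N (opp_label T ` J) \<tau> \<and>
       (\<exists>C D. chamber T N C \<and> chamber T N D \<and> C \<subseteq> \<sigma> \<and> D \<subseteq> \<tau> \<and> weyl_dist_w0 T N C D))"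

definition act :: "'a::field mat \<Rightarrow> 'a mat set \<Rightarrow> 'a mat set" where
  "act \<theta> \<sigma> = (\<lambda>x. \<theta> * x) ` \<sigma>"

definition Type :: "ctype \<Rightarrow> (int list \<Rightarrow> int list \<Rightarrow> int) \<Rightarrow> 'a::field mat \<Rightarrow> nat set" where
  "Type T N \<theta> = \<Union> {J. \<exists>\<sigma>. simplex_of_type T N J \<sigma> \<and> opposite T N \<sigma> (act \<theta> \<sigma>)}"

definition type_preserving :: "ctype \<Rightarrow> (int list \<Rightarrow> int list \<Rightarrow> int) \<Rightarrow> 'a::field mat \<Rightarrow> bool" where
  "type_preserving T N \<theta> \<longleftrightarrow>
     (\<forall>J \<sigma>. simplex_of_type T N J \<sigma> \<longrightarrow> simplex_of_type T N J (act \<theta> \<sigma>))"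

end

theory Submission
  imports Defs "HOL-Library.Function_Algebras" "HOL-Computational_Algebra.Formal_Power_Series"
begin

text \<open>
  The simplex \<open>g P\<close> is mapped to an opposite one iff \<open>g\<inverse> \<theta> g \<in> P w\<^sub>0 P\<close>, and all nontrivial short root
  elements are conjugate to \<open>x\<^sub>\<beta>(1)\<close> for any given short root \<open>\<beta>\<close>.

  For the highest short root \<open>\<beta>\<close> we have \<open>x\<^bsub>-\<beta>\<^esub>(1) = x\<^sub>\<beta>(1) n\<^sub>\<beta>(-1) x\<^sub>\<beta>(1)\<close>, where \<open>n\<^sub>\<beta>(-1)\<close> represents
  \<open>w\<^sub>0\<close> up to the Weyl group of \<open>P\<close>; this gives node 4 of F4 and node 1 of G2. For the highest root \<open>h\<close>,
  write \<open>-h = \<gamma>\<^sub>1 + \<gamma>\<^sub>2\<close> with short roots. The commutator of \<open>x\<^bsub>\<gamma>\<^sub>1\<^esub>(1)\<close> and \<open>x\<^bsub>\<gamma>\<^sub>2\<^esub>(1)\<close> is \<open>x\<^bsub>-h\<^esub>(\<plusminus>p)\<close> with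
  \<open>p\<close> the lacing number, so if \<open>p \<noteq> 0\<close> then \<open>\<theta>\<close> is conjugate to \<open>x\<^bsub>-h\<^esub>(1) x\<^bsub>\<gamma>\<^sub>1\<^esub>(1)\<close>, and the same argument
  applies to \<open>h\<close> once \<open>x\<^sub>h(1)\<close> has been moved past \<open>x\<^bsub>\<gamma>\<^sub>1\<^esub>(1)\<close> inside a Heisenberg group.

  Conversely, on the span of the highest weight vectors stabilised by \<open>P\<close> an element of \<open>P w\<^sub>0 P\<close> induces an
  invertible map to the opposite weight spaces. If \<open>a = g\<inverse> e\<^sub>\<alpha>\<close> has no component at a suitable
  lowest weight, then the corresponding row of \<open>g\<inverse> x\<^sub>\<alpha>(t) g\<close> vanishes. For nodes 2 and 3 of F4 such a
  component can be removed by changing \<open>g\<close> within \<open>g P\<close>; if \<open>p = 0\<close> in the field, then \<open>a\<close> lies in the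
  ideal spanned by the short roots and has no long components at all.
\<close>

section \<open>Roots and root strings\<close>

text \<open>The structure constants are known only up to sign and the field may have characteristic
  2 or 3, so no formula may depend on a choice of signs or divide by an integer. Identities that
  need division are therefore proved on the integral form, where k!, and in the Heisenberg formula
  2, can be cancelled, and are then reduced to the field. Signs of Weyl representatives are absorbed
  by the torus: it contains every sign character of the root lattice, because the Cartan matrices
  have odd determinant. A product of reflections acting on the roots as w0 thus represents w0 up to
  the torus, and membership in P w0 P becomes a computation with words. The lacing number enters as
  the absolute value of the structure constant of the two short roots with sum -h. Non-membership is
  read off from entries of the adjoint representation. The obstacle there is that the quadratic and
  cubic terms of g^-1 x_alpha(t) g cannot be obtained from ad(g^-1 e_alpha) by division in small
  characteristic; the remedy is to write the relevant e_w as a bracket with structure constant +-1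
  and to apply the Leibniz rule for divided powers.\<close>

lemma rank_simps [simp]: "rank F4 = 4" "rank G2 = 2"
  by (simp_all add: rank_def)

lemma length_2E:
  assumes "length v = 2" obtains a b where "v = [a, b]"
  using assms by (auto simp: numeral_2_eq_2 length_Suc_conv)

lemma length_4E:
  assumes "length v = 4" obtains a b c d where "v = [a, b, c, d]"
  using assms by (auto simp: numeral_eq_Suc length_Suc_conv)

lemma vadd_simps [simp]: "vadd [] [] = []" "vadd (x # xs) (y # ys) = (x + y) # vadd xs ys"
  by (simp_all add: vadd_def)

lemma vneg_simps [simp]: "vneg [] = []" "vneg (x # xs) = - x # vneg xs"
  by (simp_all add: vneg_def)

lemma vsmul_simps [simp]: "vsmul c [] = []" "vsmul c (x # xs) = c * x # vsmul c xs"
  by (simp_all add: vsmul_def)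

lemma length_vec_ops [simp]:
  "length (vadd u v) = min (length u) (length v)" "length (vneg u) = length u" "length (vsmul c u) = length u"
  by (simp_all add: vadd_def vneg_def vsmul_def)

lemma nth_vec_ops [simp]:
  "i < length u \<Longrightarrow> i < length v \<Longrightarrow> vadd u v ! i = u ! i + v ! i"
  "i < length u \<Longrightarrow> vneg u ! i = - u ! i"
  "i < length u \<Longrightarrow> vsmul c u ! i = c * u ! i"
  by (simp_all add: vadd_def vneg_def vsmul_def)

abbreviation zv :: "ctype \<Rightarrow> int list" where "zv T \<equiv> replicate (rank T) 0"

lemma ip_F4:
  "ip F4 [a,b,c,d] [a',b',c',d'] = 4*a*a' - 2*a*b' - 2*b*a' + 4*b*b' - 2*b*c' - 2*c*b' + 2*c*c'
     - c*d' - d*c' + 2*d*d'"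
  by (simp add: ip_def numeral_eq_Suc lessThan_Suc)

lemma ip_G2: "ip G2 [a,b] [a',b'] = 2*a*a' - 3*a*b' - 3*b*a' + 6*b*b'"
  by (simp add: ip_def numeral_eq_Suc lessThan_Suc)

lemma length_rankE:
  assumes "length v = rank T"
  obtains a b c d where "T = F4" "v = [a, b, c, d]" | a b where "T = G2" "v = [a, b]"
  using assms by (cases T) (auto elim: length_2E length_4E)

lemma ip_sym: "length u = rank T \<Longrightarrow> length v = rank T \<Longrightarrow> ip T u v = ip T v u"
  by (elim length_rankE) (auto simp: ip_F4 ip_G2)

lemma ip_vadd_left:
  "length u = rank T \<Longrightarrow> length v = rank T \<Longrightarrow> ip T (vadd u v) w = ip T u w + ip T v w"
  by (simp add: ip_def algebra_simps sum.distrib)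

lemma ip_vsmul_left: "length u = rank T \<Longrightarrow> ip T (vsmul c u) w = c * ip T u w"
  by (simp add: ip_def algebra_simps sum_distrib_left)

lemma ip_vneg_left: "length u = rank T \<Longrightarrow> ip T (vneg u) w = - ip T u w"
  by (simp add: ip_def algebra_simps sum_negf)

lemma ip_vadd_right:
  "length u = rank T \<Longrightarrow> length v = rank T \<Longrightarrow> ip T w (vadd u v) = ip T w u + ip T w v"
  by (simp add: ip_def algebra_simps sum.distrib)

lemma ip_vsmul_right: "length u = rank T \<Longrightarrow> ip T w (vsmul c u) = c * ip T w u"
  by (simp add: ip_def algebra_simps sum_distrib_left)

lemma ip_vneg_right: "length u = rank T \<Longrightarrow> ip T w (vneg u) = - ip T w u"
  by (simp add: ip_def algebra_simps sum_negf)

lemmas ip_lin = ip_vadd_left ip_vsmul_left ip_vneg_left ip_vadd_right ip_vsmul_right ip_vneg_right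

text \<open>Completing squares, scaled by 6 or 2 to clear denominators; the squares then force the
  coordinates to vanish one after the other, starting from the last.\<close>

lemma ip_pos:
  assumes "length v = rank T" "v \<noteq> zv T"
  shows "ip T v v > 0"
  using assms(1)
proof (cases rule: length_rankE)
  case (1 a b c d)
  have sos: "6 * ip T v v = 6*(2*a-b)^2 + 2*(3*b-2*c)^2 + (2*c-3*d)^2 + 3*d^2"
    using 1 by (simp add: ip_F4 power2_eq_square algebra_simps)
  have nn: "(2*a-b)^2 \<ge> 0" "(3*b-2*c)^2 \<ge> 0" "(2*c-3*d)^2 \<ge> 0" "d^2 \<ge> 0" by auto
  show ?thesis
  proof (rule ccontr)
    assume "\<not> ?thesis"
    with sos nn have "(2*a-b)^2 = 0" "(3*b-2*c)^2 = 0" "(2*c-3*d)^2 = 0" "d^2 = 0" by linarith+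
    then have "d = 0" "c = 0" "b = 0" "a = 0" by auto
    with 1 assms(2) show False by (simp add: numeral_eq_Suc)
  qed
next
  case (2 a b)
  have sos: "2 * ip T v v = (2*a-3*b)^2 + 3*b^2"
    using 2 by (simp add: ip_G2 power2_eq_square algebra_simps)
  have nn: "(2*a-3*b)^2 \<ge> 0" "b^2 \<ge> 0" by auto
  show ?thesis
  proof (rule ccontr)
    assume "\<not> ?thesis"
    with sos nn have "(2*a-3*b)^2 = 0" "b^2 = 0" by linarith+
    then have "b = 0" "a = 0" by auto
    with 2 assms(2) show False by (simp add: numeral_eq_Suc)
  qed
qed

lemma Phi_iff: "v \<in> Phi T \<longleftrightarrow> length v = rank T \<and> (ip T v v = 2 \<or> ip T v v = long_norm T)"
  by (simp add: Phi_def)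

lemma Phi_length: "v \<in> Phi T \<Longrightarrow> length v = rank T"
  by (simp add: Phi_iff)

lemma zv_notin_Phi [simp]: "zv T \<notin> Phi T"
  by (cases T) (simp_all add: Phi_iff numeral_eq_Suc ip_F4[simplified] ip_def)

lemma vneg_Phi [simp]: "v \<in> Phi T \<Longrightarrow> vneg v \<in> Phi T"
  by (auto simp: Phi_iff ip_lin)

lemma vneg_vneg [simp]: "vneg (vneg v) = v"
  by (simp add: vneg_def o_def)

text \<open>The norm equation makes the coefficients of a long root at short simple roots divisible
  by the lacing number, and so is every Gram entry that involves a long simple root.\<close>

lemma long_root_dvd:
  assumes "b \<in> Phi T" "ip T b b = long_norm T" "length v = rank T"
  shows "long_norm T div 2 dvd ip T v b"
proof (cases T)
  case F4
  with assms(1) obtain a1 b1 c1 d1 where b: "b = [a1,b1,c1,d1]" by (metis Phi_length length_4E rank_simps(1))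
  from F4 assms obtain a b' c d where v: "v = [a,b',c,d]" by (metis length_4E rank_simps(1))
  have "4*a1*a1 - 4*a1*b1 + 4*b1*b1 - 4*b1*c1 + 2*c1*c1 - 2*c1*d1 + 2*d1*d1 = 4"
    using assms(2) F4 b by (simp add: ip_F4 algebra_simps)
  then have "c1*c1 - c1*d1 + d1*d1 = 2*(1 - (a1*a1 - a1*b1 + b1*b1 - b1*c1))"
    by (simp add: algebra_simps)
  then have "even (c1*c1 - c1*d1 + d1*d1)" by simp
  \<comment> \<open>The form c^2 - cd + d^2 is anisotropic modulo 2.\<close>
  then have ev: "even c1" "even d1" by (auto; fastforce)+
  show ?thesis using F4 b v ev by (simp add: ip_F4)
next
  case G2
  with assms obtain a1 b1 where b: "b = [a1,b1]" by (metis Phi_length length_2E rank_simps(2))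
  from G2 assms obtain a b' where v: "v = [a,b']" by (metis length_2E rank_simps(2))
  have "2*a1*a1 - 6*a1*b1 + 6*b1*b1 = 6"
    using assms(2) G2 b by (simp add: ip_G2 algebra_simps)
  then have "a1*a1 = 3*(1 + a1*b1 - b1*b1)" by (simp add: algebra_simps)
  then have "3 dvd a1 * a1" by simp
  moreover have "a1 mod 3 = 0 \<or> a1 mod 3 = 1 \<or> a1 mod 3 = 2" by presburger
  moreover have "(a1 mod 3) * (a1 mod 3) mod 3 = 0"
    using \<open>3 dvd a1 * a1\<close> by (metis mod_mult_eq dvd_eq_mod_eq_0)
  ultimately have "a1 mod 3 = 0" by (elim disjE) simp_all
  then have "3 dvd a1" by presburger
  then obtain k where k: "a1 = 3*k" by blast
  have "2*a*a1 - 3*a*b1 - 3*b'*a1 + 6*b'*b1 = 3*(2*a*k - a*b1 - 3*b'*k + 2*b'*b1)"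
    unfolding k by (simp add: algebra_simps)
  then have "3 dvd 2*a*a1 - 3*a*b1 - 3*b'*a1 + 6*b'*b1" by (metis dvd_triv_left)
  then show ?thesis using G2 b v by (simp add: ip_G2)
qed

lemma ip_comb_pos:
  assumes "length u = rank T" "length v = rank T" "vadd (vsmul c u) (vsmul d v) \<noteq> zv T"
  shows "c^2 * ip T u u + 2*c*d * ip T u v + d^2 * ip T v v > 0"
proof -
  have "ip T (vadd (vsmul c u) (vsmul d v)) (vadd (vsmul c u) (vsmul d v)) > 0"
    using assms by (intro ip_pos) auto
  then show ?thesis using assms
    by (simp add: ip_lin power2_eq_square ip_sym[of v T u] algebra_simps)
qed

lemma vadd_zero_iff:
  assumes "length u = rank T" "length v = rank T"
  shows "vadd u v = zv T \<longleftrightarrow> v = vneg u"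
  using assms by (auto simp: list_eq_iff_nth_eq eq_neg_iff_add_eq_0 add.commute)

text \<open>Positivity of the form on g +- b, 2g +- b and 2b +- g bounds the inner product, and
  \<open>long_root_dvd\<close> leaves three values for each pair of norms. None of these vectors is
  zero, since two roots never have a ratio of norms equal to 4.\<close>

lemma ip_root_cases:
  assumes "b \<in> Phi T" "g \<in> Phi T" "g \<noteq> b" "g \<noteq> vneg b"
  shows "(T = F4 \<and> (ip T b b, ip T g g, ip T g b) \<in>
            {(2,2,-1),(2,2,0),(2,2,1),(2,4,-2),(2,4,0),(2,4,2),(4,2,-2),(4,2,0),(4,2,2),(4,4,-2),(4,4,0),(4,4,2)})
       \<or> (T = G2 \<and> (ip T b b, ip T g g, ip T g b) \<in>
            {(2,2,-1),(2,2,0),(2,2,1),(2,6,-3),(2,6,0),(2,6,3),(6,2,-3),(6,2,0),(6,2,3),(6,6,-3),(6,6,0),(6,6,3)})"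
proof -
  have lg: "length b = rank T" "length g = rank T" using assms(1,2) Phi_length by blast+
  have ndiff: "vadd (vsmul c g) (vsmul d b) \<noteq> zv T" if cd: "c \<in> {1,2}" "d \<in> {1,-1}" for c d
  proof
    assume z: "vadd (vsmul c g) (vsmul d b) = zv T"
    then have n: "\<And>i. i < rank T \<Longrightarrow> c * g ! i + d * b ! i = 0"
      using lg by (auto simp: list_eq_iff_nth_eq)
    then have eq: "vsmul c g = vsmul (- d) b" using lg cd
      by (auto simp: list_eq_iff_nth_eq eq_neg_iff_add_eq_0)
    show False
    proof (cases "c = 1")
      case True
      then have "g = vneg b \<or> g = b" using n lg cd
        by (auto simp: list_eq_iff_nth_eq add_eq_0_iff)
      with assms show False by auto
    next
      case False
      then have c: "c = 2" using cd by auto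
      have "ip T (vsmul c g) (vsmul c g) = ip T (vsmul (- d) b) (vsmul (- d) b)" using eq by simp
      then have "4 * ip T g g = ip T b b" using lg c cd by (auto simp: ip_lin)
      then show False using assms(1,2) by (cases T) (auto simp: Phi_iff)
    qed
  qed
  have P: "c^2 * ip T g g + 2*c*d * ip T g b + d^2 * ip T b b > 0" if "c \<in> {1,2}" "d \<in> {1,-1}" for c d
    using ip_comb_pos[OF lg(2,1) ndiff[OF that]] .
  have Q: "d^2 * ip T b b + 2*d*c * ip T g b + c^2 * ip T g g > 0" if "c \<in> {1,-1}" "d \<in> {2}" for c d
  proof -
    have "vadd (vsmul d b) (vsmul c g) \<noteq> zv T"
    proof
      assume z: "vadd (vsmul d b) (vsmul c g) = zv T"
      then have n: "\<And>i. i < rank T \<Longrightarrow> d * b ! i + c * g ! i = 0"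
        using lg by (auto simp: list_eq_iff_nth_eq)
      have "vsmul d b = vsmul (-c) g" using n lg by (auto simp: list_eq_iff_nth_eq eq_neg_iff_add_eq_0)
      then have "ip T (vsmul d b) (vsmul d b) = ip T (vsmul (-c) g) (vsmul (-c) g)" by simp
      then have "4 * ip T b b = ip T g g" using lg that by (auto simp: ip_lin)
      then show False using assms(1,2) by (cases T) (auto simp: Phi_iff)
    qed
    from ip_comb_pos[OF lg this] show ?thesis by (simp add: ip_sym lg)
  qed
  have ineqs: "ip T g g + 2 * ip T g b + ip T b b > 0" "ip T g g - 2 * ip T g b + ip T b b > 0"
    "4 * ip T g g + 4 * ip T g b + ip T b b > 0" "4 * ip T g g - 4 * ip T g b + ip T b b > 0"
    "4 * ip T b b + 4 * ip T g b + ip T g g > 0" "4 * ip T b b - 4 * ip T g b + ip T g g > 0"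
    using P[of 1 1] P[of 1 "-1"] P[of 2 1] P[of 2 "-1"] Q[of 1 2] Q[of "-1" 2] by auto
  have d1: "ip T b b = long_norm T \<Longrightarrow> long_norm T div 2 dvd ip T g b"
    using long_root_dvd assms lg by blast
  have d2: "ip T g g = long_norm T \<Longrightarrow> long_norm T div 2 dvd ip T g b"
    using long_root_dvd[of g T b] assms lg ip_sym[of b T g] by simp
  have i1: "x \<in> {-1,0,1}" if "4 + 2*x > 0" "4 - 2*x > 0" for x :: int using that by auto
  have i2: "x \<in> {-2,0,2}" if "2 dvd x" "-4 < x" "x < 4" for x :: int using that by auto
  have i3: "x \<in> {-3,0,3}" if "3 dvd x" "-6 < x" "x < 6" for x :: int using that by auto
  show ?thesis
  proof (cases T)
    case F4
    have "(ip T b b = 2 \<or> ip T b b = 4)" "(ip T g g = 2 \<or> ip T g g = 4)"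
      using assms(1,2) F4 by (auto simp: Phi_iff)
    then consider "ip T b b = 2" "ip T g g = 2" | "ip T b b = 2" "ip T g g = 4"
      | "ip T b b = 4" "ip T g g = 2" | "ip T b b = 4" "ip T g g = 4" by blast
    then show ?thesis
    proof cases
      case 1
      then have "ip T g b \<in> {-1,0,1}" using ineqs by (intro i1) simp_all
      with 1 F4 show ?thesis by (elim insertE emptyE) simp_all
    next
      case 2
      then have "ip T g b \<in> {-2,0,2}" using ineqs d2 F4 by (intro i2) simp_all
      with 2 F4 show ?thesis by (elim insertE emptyE) simp_all
    next
      case 3
      then have "ip T g b \<in> {-2,0,2}" using ineqs d1 F4 by (intro i2) simp_all
      with 3 F4 show ?thesis by (elim insertE emptyE) simp_all
    next
      case 4
      then have "ip T g b \<in> {-2,0,2}" using ineqs d1 F4 by (intro i2) simp_all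
      with 4 F4 show ?thesis by (elim insertE emptyE) simp_all
    qed
  next
    case G2
    have "(ip T b b = 2 \<or> ip T b b = 6)" "(ip T g g = 2 \<or> ip T g g = 6)"
      using assms(1,2) G2 by (auto simp: Phi_iff)
    then consider "ip T b b = 2" "ip T g g = 2" | "ip T b b = 2" "ip T g g = 6"
      | "ip T b b = 6" "ip T g g = 2" | "ip T b b = 6" "ip T g g = 6" by blast
    then show ?thesis
    proof cases
      case 1
      then have "ip T g b \<in> {-1,0,1}" using ineqs by (intro i1) simp_all
      with 1 G2 show ?thesis by (elim insertE emptyE) simp_all
    next
      case 2
      then have "ip T g b \<in> {-3,0,3}" using ineqs d2 G2 by (intro i3) simp_all
      with 2 G2 show ?thesis by (elim insertE emptyE) simp_all
    next
      case 3
      then have "ip T g b \<in> {-3,0,3}" using ineqs d1 G2 by (intro i3) simp_all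
      with 3 G2 show ?thesis by (elim insertE emptyE) simp_all
    next
      case 4
      then have "ip T g b \<in> {-3,0,3}" using ineqs d1 G2 by (intro i3) simp_all
      with 4 G2 show ?thesis by (elim insertE emptyE) simp_all
    qed
  qed
qed

text \<open>Here \<open>y\<close> and \<open>x\<close> are the norms of \<open>b\<close> and
  \<open>g\<close>, \<open>z\<close> is their inner product, and \<open>g\<close> stands at position
  \<open>i\<close> in a \<open>b\<close>-string with positions 0 to \<open>m\<close>. Because roots
  are recognised by their norm, the string is determined by these numbers. The range -1 to 4
  includes the neighbours of both ends, as \<open>m\<close> is at most 3.\<close>

definition string_at :: "ctype \<Rightarrow> int \<Rightarrow> int \<Rightarrow> int \<Rightarrow> int \<Rightarrow> int \<Rightarrow> bool" where
  "string_at T y x z i m \<longleftrightarrow> 0 \<le> i \<and> i \<le> m \<and> m \<le> (if T = F4 then 2 else 3) \<and> 2 * z = (2 * i - m) * y \<and>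
     (\<forall>k\<in>{-1,0,1,2,3,4}. x + 2*(k-i)*z + (k-i)*(k-i)*y \<in> {2, long_norm T} \<longleftrightarrow> 0 \<le> k \<and> k \<le> m)"

lemma string_exists:
  assumes "b \<in> Phi T" "g \<in> Phi T" "g \<noteq> b" "g \<noteq> vneg b"
  obtains i m :: nat where "i \<le> m" "m \<le> (if T = F4 then 2 else 3)"
    "2 * ip T g b = (2 * int i - int m) * ip T b b"
    "\<And>k. -1 \<le> k \<Longrightarrow> k \<le> 4 \<Longrightarrow> vadd g (vsmul (k - int i) b) \<in> Phi T \<longleftrightarrow> 0 \<le> k \<and> k \<le> int m"
proof -
  have lg: "length b = rank T" "length g = rank T" using assms(1,2) Phi_length by blast+
  define x y z where "x = ip T g g" and "y = ip T b b" and "z = ip T g b"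
  have nrm: "vadd g (vsmul k b) \<in> Phi T \<longleftrightarrow> (x + 2*k*z + k*k*y = 2 \<or> x + 2*k*z + k*k*y = long_norm T)" for k
    using lg by (simp add: Phi_iff ip_lin ip_sym[of b T g] x_def y_def z_def algebra_simps)
  have ex: "\<And>T y x z i m. string_at T y x z i m \<Longrightarrow> \<exists>i m. string_at T y x z i m" by blast
  have "\<exists>i m. string_at T y x z i m"
  proof (cases T)
    case F4
    have "string_at F4 2 2 (-1) 0 1" "string_at F4 2 2 0 1 2" "string_at F4 2 2 1 1 1"
      "string_at F4 2 4 (-2) 0 2" "string_at F4 2 4 0 0 0" "string_at F4 2 4 2 2 2"
      "string_at F4 4 2 (-2) 0 1" "string_at F4 4 2 0 0 0" "string_at F4 4 2 2 1 1"
      "string_at F4 4 4 (-2) 0 1" "string_at F4 4 4 0 0 0" "string_at F4 4 4 2 1 1"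
      by (simp_all add: string_at_def)
    note E = this[THEN ex]
    have "(y, x, z) \<in> {(2,2,-1),(2,2,0),(2,2,1),(2,4,-2),(2,4,0),(2,4,2),(4,2,-2),(4,2,0),(4,2,2),(4,4,-2),(4,4,0),(4,4,2)}"
      using ip_root_cases[OF assms] F4 unfolding x_def y_def z_def by simp
    then show ?thesis unfolding F4 using E by (elim insertE emptyE) (simp_all only: prod.inject)
  next
    case G2
    have "string_at G2 2 2 (-1) 1 3" "string_at G2 2 2 0 0 0" "string_at G2 2 2 1 2 3"
      "string_at G2 2 6 (-3) 0 3" "string_at G2 2 6 0 0 0" "string_at G2 2 6 3 3 3"
      "string_at G2 6 2 (-3) 0 1" "string_at G2 6 2 0 0 0" "string_at G2 6 2 3 1 1"
      "string_at G2 6 6 (-3) 0 1" "string_at G2 6 6 0 0 0" "string_at G2 6 6 3 1 1"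
      by (simp_all add: string_at_def)
    note E = this[THEN ex]
    have "(y, x, z) \<in> {(2,2,-1),(2,2,0),(2,2,1),(2,6,-3),(2,6,0),(2,6,3),(6,2,-3),(6,2,0),(6,2,3),(6,6,-3),(6,6,0),(6,6,3)}"
      using ip_root_cases[OF assms] G2 unfolding x_def y_def z_def by simp
    then show ?thesis unfolding G2 using E by (elim insertE emptyE) (simp_all only: prod.inject)
  qed
  then obtain i' m' where "string_at T y x z i' m'" by blast
  moreover from this have "0 \<le> i'" "0 \<le> m'" by (auto simp: string_at_def)
  ultimately obtain i m :: nat where "string_at T y x z (int i) (int m)"
    by (metis nonneg_int_cases)
  then have im: "i \<le> m" "m \<le> (if T = F4 then 2 else 3)" "2 * z = (2 * int i - int m) * y"
    "\<forall>k\<in>{-1,0,1,2,3,4}. x + 2*(k-int i)*z + (k-int i)*(k-int i)*y \<in> {2, long_norm T} \<longleftrightarrow> 0 \<le> k \<and> k \<le> int m"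
    by (auto simp: string_at_def split: if_splits)
  have "vadd g (vsmul (k - int i) b) \<in> Phi T \<longleftrightarrow> 0 \<le> k \<and> k \<le> int m" if "-1 \<le> k" "k \<le> 4" for k
  proof -
    from that have "k \<in> {-1,0,1,2,3,4}" by auto
    with im(4) show ?thesis unfolding nrm by blast
  qed
  with im show thesis using that by (simp add: z_def y_def)
qed

section \<open>Enumeration of roots and basis indices\<close>
definition root_enum :: "ctype \<Rightarrow> int list list" where
  "root_enum T = (case T of F4 \<Rightarrow>
    [[-2,-3,-4,-2],[-1,-3,-4,-2],[-1,-2,-4,-2],[-1,-2,-3,-2],[-1,-2,-3,-1],[-1,-2,-2,-2],
     [-1,-2,-2,-1],[-1,-2,-2,0],[-1,-1,-2,-2],[-1,-1,-2,-1],[-1,-1,-2,0],[-1,-1,-1,-1],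
     [-1,-1,-1,0],[-1,-1,0,0],[-1,0,0,0],[0,-1,-2,-2],[0,-1,-2,-1],[0,-1,-2,0],[0,-1,-1,-1],
     [0,-1,-1,0],[0,-1,0,0],[0,0,-1,-1],[0,0,-1,0],[0,0,0,-1],[0,0,0,1],[0,0,1,0],[0,0,1,1],
     [0,1,0,0],[0,1,1,0],[0,1,1,1],[0,1,2,0],[0,1,2,1],[0,1,2,2],[1,0,0,0],[1,1,0,0],[1,1,1,0],
     [1,1,1,1],[1,1,2,0],[1,1,2,1],[1,1,2,2],[1,2,2,0],[1,2,2,1],[1,2,2,2],[1,2,3,1],[1,2,3,2],
     [1,2,4,2],[1,3,4,2],[2,3,4,2]]
   | G2 \<Rightarrow>
    [[-3,-2],[-3,-1],[-2,-1],[-1,-1],[-1,0],[0,-1],[0,1],[1,0],[1,1],[2,1],[3,1],[3,2]])"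

lemma abs_le_of_square_le:
  fixes x :: int
  assumes "x * x \<le> k" "k < (c + 1) * (c + 1)" "0 \<le> c"
  shows "- c \<le> x \<and> x \<le> c"
proof (rule ccontr)
  assume "\<not> ?thesis"
  then have "c + 1 \<le> \<bar>x\<bar>" by auto
  then have "(c + 1) * (c + 1) \<le> \<bar>x\<bar> * \<bar>x\<bar>" using assms(3) by (intro mult_mono) auto
  then show False using assms by (simp flip: abs_mult)
qed

lemma root_enum_F4_complete:
  fixes a b c d :: int
  assumes "ip F4 [a,b,c,d] [a,b,c,d] \<in> {2, 4}"
  shows "[a,b,c,d] \<in> set (root_enum F4)"
proof -
  let ?p = "2*c-3*d" and ?q = "3*b-2*c" and ?r = "2*a-b"
  have sos: "6 * ip F4 [a,b,c,d] [a,b,c,d] = 6*(?r*?r) + 2*(?q*?q) + ?p*?p + 3*(d*d)"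
    by (simp add: ip_F4 algebra_simps)
  have nn: "?r*?r \<ge> 0" "?q*?q \<ge> 0" "?p*?p \<ge> 0" "d*d \<ge> 0" by auto
  from assms sos have le: "6*(?r*?r) + 2*(?q*?q) + ?p*?p + 3*(d*d) \<le> 24" by auto
  have "-2 \<le> d \<and> d \<le> 2" by (rule abs_le_of_square_le[of _ 8]) (use le nn in linarith, simp_all)
  then have d: "d \<in> {-2,-1,0,1,2}" by auto
  have pd: "?p*?p + 3*(d*d) \<le> 24" using le nn by linarith
  have qpd: "2*(?q*?q) + ?p*?p + 3*(d*d) \<le> 24" using le nn by linarith
  have "-4 \<le> ?p \<and> ?p \<le> 4" by (rule abs_le_of_square_le[of _ 24]) (use le nn in linarith, simp_all)
  with \<open>-2 \<le> d \<and> d \<le> 2\<close> have cb: "-5 \<le> c \<and> c \<le> 5" by linarith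
  then have c: "c \<in> {-5,-4,-3,-2,-1,0,1,2,3,4,5}" by simp presburger
  have "-3 \<le> ?q \<and> ?q \<le> 3" by (rule abs_le_of_square_le[of _ 12]) (use le nn in linarith, simp_all)
  with cb have bb: "-4 \<le> b \<and> b \<le> 4" by linarith
  then have b: "b \<in> {-4,-3,-2,-1,0,1,2,3,4}" by simp presburger
  have "-2 \<le> ?r \<and> ?r \<le> 2" by (rule abs_le_of_square_le[of _ 4]) (use le nn in linarith, simp_all)
  with bb have "-3 \<le> a \<and> a \<le> 3" by linarith
  then have a: "a \<in> {-3,-2,-1,0,1,2,3}" by simp presburger
  have val: "6*(?r*?r) + 2*(?q*?q) + ?p*?p + 3*(d*d) \<in> {12, 24}" using assms sos by auto
  \<comment> \<open>\<open>P\<close> hides the membership test, so that each admissible vector is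
    settled by one rewrite instead of a search through the list.\<close>
  define P where "P v \<longleftrightarrow> v \<in> set (root_enum F4)" for v
  have "\<forall>v\<in>set (root_enum F4). P v" by (simp add: P_def)
  then have P: "\<forall>v\<in>set (root_enum F4). P v = True" by blast
  note P = P[unfolded root_enum_def ctype.case list.set ball_simps]
  \<comment> \<open>Nested guards: partial sums of squares discard most pairs (d, c), and then most
    b, before the remaining coordinates are expanded.\<close>
  define Q3 where "Q3 d c b a \<longleftrightarrow>
    (6*((2*a-b)*(2*a-b)) + 2*((3*b-2*c)*(3*b-2*c)) + (2*c-3*d)*(2*c-3*d) + 3*(d*d) \<in> {12,24} \<longrightarrow> P [a,b,c,d])" for d c b a :: int
  define Q2 where "Q2 d c b \<longleftrightarrow> (2*((3*b-2*c)*(3*b-2*c)) + (2*c-3*d)*(2*c-3*d) + 3*(d*d) \<le> 24 \<longrightarrow>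
    (\<forall>a\<in>{-3,-2,-1,0,1,2,3}. Q3 d c b a))" for d c b :: int
  define Q1 where "Q1 d c \<longleftrightarrow> ((2*c-3*d)*(2*c-3*d) + 3*(d*d) \<le> 24 \<longrightarrow>
    (\<forall>b\<in>{-4,-3,-2,-1,0,1,2,3,4}. Q2 d c b))" for d c :: int
  have tab: "\<forall>d\<in>{-2,-1,0,1,2::int}. \<forall>c\<in>{-5,-4,-3,-2,-1,0,1,2,3,4,5::int}. Q1 d c"
    apply (simp only: ball_simps simp_thms)
    apply (simp add: Q1_def)
    apply (simp add: Q2_def)
    apply (simp add: Q3_def P)
    done
  note tab = tab[unfolded Q1_def Q2_def Q3_def]
  show ?thesis unfolding P_def[symmetric] by (rule tab[rule_format, OF d c pd b qpd a val])
qed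

lemma root_enum_G2_complete:
  fixes a b :: int
  assumes "ip G2 [a,b] [a,b] \<in> {2, 6}"
  shows "[a,b] \<in> set (root_enum G2)"
proof -
  let ?p = "2*a-3*b"
  have sos: "2 * ip G2 [a,b] [a,b] = ?p*?p + 3*(b*b)"
    by (simp add: ip_G2 algebra_simps)
  have nn: "?p*?p \<ge> 0" "b*b \<ge> 0" by auto
  from assms sos have le: "?p*?p + 3*(b*b) \<le> 12" by auto
  have "-2 \<le> b \<and> b \<le> 2" by (rule abs_le_of_square_le[of _ 4]) (use le nn in linarith, simp_all)
  then have b: "b \<in> {-2,-1,0,1,2}" by auto
  have "-3 \<le> ?p \<and> ?p \<le> 3" by (rule abs_le_of_square_le[of _ 12]) (use le nn in linarith, simp_all)
  with \<open>-2 \<le> b \<and> b \<le> 2\<close> have "-4 \<le> a \<and> a \<le> 4" by linarith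
  then have a: "a \<in> {-4,-3,-2,-1,0,1,2,3,4}" by simp presburger
  have val: "?p*?p + 3*(b*b) \<in> {4, 12}" using assms sos by auto
  have tab: "\<forall>b\<in>{-2,-1,0,1,2::int}. \<forall>a\<in>{-4,-3,-2,-1,0,1,2,3,4::int}.
         (2*a-3*b)*(2*a-3*b) + 3*(b*b) \<in> {4,12} \<longrightarrow> [a,b] \<in> set (root_enum G2)"
    unfolding root_enum_def by simp
  show ?thesis by (rule tab[rule_format, OF b a val])
qed

lemma Phi_eq: "Phi T = set (root_enum T)"
proof (cases T)
  case F4
  have "\<forall>v\<in>set (root_enum F4). length v = 4 \<and> ip F4 v v \<in> {2,4}"
    by (simp add: root_enum_def ip_F4)
  then show ?thesis unfolding F4 Phi_def using root_enum_F4_complete by (auto elim!: length_4E)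
next
  case G2
  have "\<forall>v\<in>set (root_enum G2). length v = 2 \<and> ip G2 v v \<in> {2,6}"
    by (simp add: root_enum_def ip_G2)
  then show ?thesis unfolding G2 Phi_def using root_enum_G2_complete by (auto elim!: length_2E)
qed

lemma Phi_bound: "v \<in> Phi T \<Longrightarrow> set v \<subseteq> {-4..4}"
proof -
  have "\<forall>v\<in>set (root_enum T). set v \<subseteq> {-4..4}"
    by (cases T) (simp_all add: root_enum_def)
  then show "v \<in> Phi T \<Longrightarrow> set v \<subseteq> {-4..4}" by (simp add: Phi_eq)
qed

lemma set_roots_list: "set (roots_list T) = Phi T"
proof -
  have "v \<in> set (product_lists (replicate (rank T) [-4..4]))" if "v \<in> Phi T" for v
    using Phi_bound[OF that] Phi_length[OF that]
    by (simp add: product_lists_set list_all2_conv_all_nth del: set_upto upto_rec_numeral upto_Nil)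
       (metis atLeastAtMost_iff nth_mem set_upto subsetD)
  then show ?thesis by (auto simp: roots_list_def)
qed

lemma distinct_roots_list: "distinct (roots_list T)"
  unfolding roots_list_def by (intro distinct_filter distinct_product_lists) auto

section \<open>Weights of the basis vectors\<close>

definition wt :: "ctype \<Rightarrow> nat \<Rightarrow> int list" where
  "wt T i = (if i < rank T then zv T else roots_list T ! (i - rank T))"

lemma ridx_root:
  assumes "a \<in> Phi T"
  shows "rank T \<le> ridx T a" "ridx T a < bdim T" "wt T (ridx T a) = a"
proof -
  obtain k where k: "k < length (roots_list T)" "roots_list T ! k = a"
    using assms set_roots_list[of T] by (metis in_set_conv_nth)
  then have "(THE k. k < length (roots_list T) \<and> roots_list T ! k = a) = k"
    using distinct_roots_list[of T] by (intro the_equality) (auto simp: nth_eq_iff_index_eq)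
  with k show "rank T \<le> ridx T a" "ridx T a < bdim T" "wt T (ridx T a) = a"
    by (auto simp: ridx_def bdim_def wt_def)
qed

lemma not_ridx_less [simp]: "a \<in> Phi T \<Longrightarrow> \<not> ridx T a < rank T"
  using ridx_root(1)[of a T] by simp

lemma ridx_less [simp]: "a \<in> Phi T \<Longrightarrow> ridx T a < bdim T"
  by (rule ridx_root)

lemma wt_ridx [simp]: "a \<in> Phi T \<Longrightarrow> wt T (ridx T a) = a"
  by (rule ridx_root)

lemma wt_less_rank [simp]: "i < rank T \<Longrightarrow> wt T i = zv T"
  by (simp add: wt_def)

lemma roots_list_ridx [simp]: "a \<in> Phi T \<Longrightarrow> roots_list T ! (ridx T a - rank T) = a"
  using ridx_root[of a T] by (simp add: wt_def)

lemma index_cases: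
  assumes "i < bdim T"
  obtains "i < rank T" | a where "a \<in> Phi T" "i = ridx T a"
proof (cases "i < rank T")
  case False
  define a where "a = roots_list T ! (i - rank T)"
  have k: "i - rank T < length (roots_list T)" using assms False by (auto simp: bdim_def)
  then have a: "a \<in> Phi T" unfolding a_def using set_roots_list nth_mem by blast
  have "ridx T a - rank T < length (roots_list T)" using ridx_root(2)[OF a] ridx_root(1)[OF a] by (auto simp: bdim_def)
  moreover have "roots_list T ! (ridx T a - rank T) = roots_list T ! (i - rank T)"
    using a by (simp add: a_def)
  ultimately have "ridx T a - rank T = i - rank T"
    using k distinct_roots_list[of T] by (simp add: nth_eq_iff_index_eq)
  then have "i = ridx T a" using False ridx_root(1)[OF a] by auto
  with a that show ?thesis by blast
qed (use that in blast)

lemma ridx_inj: "a \<in> Phi T \<Longrightarrow> b \<in> Phi T \<Longrightarrow> ridx T a = ridx T b \<longleftrightarrow> a = b"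
  using wt_ridx by metis

lemma wt_eq_root: "i < bdim T \<Longrightarrow> a \<in> Phi T \<Longrightarrow> wt T i = a \<longleftrightarrow> i = ridx T a"
  by (elim index_cases) (auto simp: ridx_inj)

lemma wt_cases: "i < bdim T \<Longrightarrow> wt T i \<in> insert (zv T) (Phi T)"
  by (elim index_cases) auto

lemma length_wt [simp]: "i < bdim T \<Longrightarrow> length (wt T i) = rank T"
  using wt_cases[of i T] Phi_length by fastforce

text \<open>Allows the sum over \<open>k < bdim T\<close> in the root elements to be cut down to
  \<open>k < 4\<close>, beyond which the divided powers vanish.\<close>

lemma four_less_bdim: "4 < bdim T"
proof -
  have "card (Phi T) = length (roots_list T)"
    using distinct_card[OF distinct_roots_list[of T]] by (simp add: set_roots_list)
  moreover have "card (Phi T) \<ge> 3"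
  proof -
    have "set (take 3 (root_enum T)) \<subseteq> Phi T" unfolding Phi_eq by (rule set_take_subset)
    moreover have "card (set (take 3 (root_enum T))) = 3"
      by (cases T) (simp_all add: root_enum_def)
    moreover have "finite (Phi T)" by (simp add: Phi_eq)
    ultimately show ?thesis by (metis card_mono)
  qed
  moreover have "rank T \<ge> 2" by (cases T) simp_all
  ultimately show ?thesis by (simp add: bdim_def)
qed

section \<open>The bracket over a commutative ring\<close>

definition uv :: "nat \<Rightarrow> nat \<Rightarrow> 'r::comm_ring_1" where
  "uv j = (\<lambda>k. if k = j then 1 else 0)"

definition sc :: "'r::comm_ring_1 \<Rightarrow> (nat \<Rightarrow> 'r) \<Rightarrow> nat \<Rightarrow> 'r" where
  "sc c v = (\<lambda>k. c * v k)"

lemma uv_apply: "uv j k = (if k = j then 1 else 0)"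
  by (simp add: uv_def)

lemma uv_same [simp]: "uv j j = 1"
  by (simp add: uv_def)

lemma sc_apply [simp]: "sc c v k = c * v k"
  by (simp add: sc_def)

lemma sum_uv [simp]: "j < n \<Longrightarrow> (\<Sum>c<n. uv j c * f c) = f j" "j < n \<Longrightarrow> (\<Sum>c<n. f c * uv j c) = f j"
  by (simp_all add: uv_def if_distrib[of "\<lambda>x. x * _"] if_distrib[of "\<lambda>x. _ * x"] cong: if_cong)

text \<open>Matrices act on the first \<open>n\<close> coordinates and fix the others, hence the distinction between
  maps that see only the first \<open>n\<close> coordinates and maps that do so in the first \<open>n\<close> rows.\<close>
definition nlin :: "nat \<Rightarrow> ((nat \<Rightarrow> 'r::comm_ring_1) \<Rightarrow> nat \<Rightarrow> 'r) \<Rightarrow> bool" where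
  "nlin n f \<longleftrightarrow> (\<forall>v r. f v r = (\<Sum>c<n. v c * f (uv c) r))"

definition tlin :: "nat \<Rightarrow> ((nat \<Rightarrow> 'r::comm_ring_1) \<Rightarrow> nat \<Rightarrow> 'r) \<Rightarrow> bool" where
  "tlin n f \<longleftrightarrow> (\<forall>v r. r < n \<longrightarrow> f v r = (\<Sum>c<n. v c * f (uv c) r))"

definition vlin :: "((nat \<Rightarrow> 'r::comm_ring_1) \<Rightarrow> nat \<Rightarrow> 'r) \<Rightarrow> bool" where
  "vlin f \<longleftrightarrow> (\<forall>u v. f (u + v) = f u + f v) \<and> (\<forall>c v. f (sc c v) = sc c (f v))"

lemma nlin_expand: "nlin n f \<Longrightarrow> f v r = (\<Sum>c<n. v c * f (uv c) r)"
  unfolding nlin_def by blast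

lemma tlin_expand: "tlin n f \<Longrightarrow> r < n \<Longrightarrow> f v r = (\<Sum>c<n. v c * f (uv c) r)"
  unfolding tlin_def by blast

lemma nlin_tlin: "nlin n f \<Longrightarrow> tlin n f"
  unfolding nlin_def tlin_def by blast

lemma nlin_vlin:
  assumes "nlin n f" shows "vlin f"
  unfolding vlin_def
proof (intro conjI allI ext)
  fix u v r show "f (u + v) r = (f u + f v) r"
    by (simp add: nlin_expand[OF assms, of "u + v"] nlin_expand[OF assms, of u] nlin_expand[OF assms, of v]
        algebra_simps sum.distrib)
next
  fix c v r show "f (sc c v) r = sc c (f v) r"
    by (simp add: nlin_expand[OF assms, of "sc c v"] nlin_expand[OF assms, of v] sum_distrib_left ac_simps)
qed

lemma vlin_add: "vlin f \<Longrightarrow> f (u + v) = f u + f v"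
  and vlin_sc: "vlin f \<Longrightarrow> f (sc c v) = sc c (f v)"
  unfolding vlin_def by blast+

lemma sc_0 [simp]: "sc 0 v = 0" and sc_1 [simp]: "sc 1 v = v" and sc_zero [simp]: "sc c 0 = 0"
  and sc_sc [simp]: "sc a (sc b v) = sc (a * b) v" and sc_minus1: "sc (- 1) v = - v"
  and sc_add: "sc c (u + v) = sc c u + sc c v" and sc_add_left: "sc (a + b) v = sc a v + sc b v"
  and sc_minus: "sc (- a) v = - sc a v"
  by (auto simp: fun_eq_iff algebra_simps)

lemma vlin_zero: "vlin f \<Longrightarrow> f 0 = 0"
  using vlin_sc[of f 0 0] by simp

lemma vlin_minus: "vlin f \<Longrightarrow> f (- v) = - f v"
  using vlin_sc[of f "- 1" v] by (simp add: sc_minus1)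

lemma vlin_diff: "vlin f \<Longrightarrow> f (u - v) = f u - f v"
  using vlin_add[of f u "- v"] vlin_minus[of f v] by simp

lemma vlin_sum:
  assumes "vlin f" shows "f (\<Sum>i\<in>A. g i) = (\<Sum>i\<in>A. f (g i))"
proof (induction A rule: infinite_finite_induct)
  case (insert x F)
  then show ?case by (simp only: sum.insert vlin_add[OF assms] simp_thms)
qed (simp_all only: sum.infinite sum.empty vlin_zero[OF assms] simp_thms)

lemma sum_fun_apply: "(\<Sum>i\<in>A. g i) r = (\<Sum>i\<in>A. g i r)"
  by (induction A rule: infinite_finite_induct) simp_all

lemma nlin_comp_tlin:
  assumes "nlin n f" "tlin n h" shows "nlin n (\<lambda>v. f (h v))"
  unfolding nlin_def
proof (intro allI)
  fix v r
  have "f (h v) r = (\<Sum>c<n. \<Sum>d<n. v d * h (uv d) c * f (uv c) r)"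
    by (subst nlin_expand[OF assms(1)]) (simp add: tlin_expand[OF assms(2), of _ v] sum_distrib_right)
  also have "\<dots> = (\<Sum>d<n. \<Sum>c<n. v d * h (uv d) c * f (uv c) r)" by (rule sum.swap)
  also have "\<dots> = (\<Sum>d<n. v d * f (h (uv d)) r)"
    by (intro sum.cong refl, subst (2) nlin_expand[OF assms(1)]) (simp add: sum_distrib_left ac_simps)
  finally show "f (h v) r = (\<Sum>d<n. v d * f (h (uv d)) r)" .
qed

lemma nlin_comp: "nlin n f \<Longrightarrow> nlin n h \<Longrightarrow> nlin n (\<lambda>v. f (h v))"
  by (rule nlin_comp_tlin[OF _ nlin_tlin])

lemma nlin_fun_expand: "nlin n f \<Longrightarrow> f v = (\<Sum>c<n. sc (v c) (f (uv c)))"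
  by (auto simp: fun_eq_iff sum_fun_apply nlin_expand[of n f v])

lemma vlin_comp_nlin:
  assumes "vlin h" "nlin n f" shows "nlin n (\<lambda>v. h (f v))"
  unfolding nlin_def
proof (intro allI)
  fix v r
  have "h (f v) = (\<Sum>c<n. sc (v c) (h (f (uv c))))"
    by (subst nlin_fun_expand[OF assms(2)]) (simp add: vlin_sum[OF assms(1)] vlin_sc[OF assms(1)])
  then show "h (f v) r = (\<Sum>c<n. v c * h (f (uv c)) r)" by (simp add: sum_fun_apply)
qed

lemma nlin_add:
  assumes "nlin n f" "nlin n g" shows "nlin n (\<lambda>v. f v + g v)"
proof (unfold nlin_def, intro allI)
  fix v r show "(f v + g v) r = (\<Sum>c<n. v c * (f (uv c) + g (uv c)) r)"
    by (simp add: nlin_expand[OF assms(1), of v] nlin_expand[OF assms(2), of v] distrib_left sum.distrib)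
qed

lemma nlin_sc: "nlin n f \<Longrightarrow> nlin n (\<lambda>v. sc c (f v))"
  unfolding nlin_def
proof (intro allI)
  fix v r assume "\<forall>v r. f v r = (\<Sum>c<n. v c * f (uv c) r)"
  then have "f v r = (\<Sum>c<n. v c * f (uv c) r)" by blast
  then show "sc c (f v) r = (\<Sum>d<n. v d * sc c (f (uv d)) r)" by (simp add: sum_distrib_left ac_simps)
qed

lemma nlin_zero: "nlin n (\<lambda>v. 0)"
  by (simp add: nlin_def)

lemma nlin_sum: "(\<And>i. i \<in> A \<Longrightarrow> nlin n (f i)) \<Longrightarrow> nlin n (\<lambda>v. \<Sum>i\<in>A. f i v)"
proof (induction A rule: infinite_finite_induct)
  case (insert x F)
  then have "nlin n (\<lambda>v. f x v + (\<Sum>i\<in>F. f i v))" by (intro nlin_add) auto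
  with insert(1,2) show ?case by (simp only: sum.insert simp_thms)
qed (simp_all only: sum.infinite sum.empty nlin_zero simp_thms)

lemma nlin_eqI:
  assumes "nlin n f" "nlin n g" "\<And>c. c < n \<Longrightarrow> f (uv c) = g (uv c)"
  shows "f = g"
proof (intro ext)
  fix v r show "f v r = g v r"
    using assms(3) by (simp add: nlin_expand[OF assms(1), of v] nlin_expand[OF assms(2), of v])
qed

lemma tlin_id: "tlin n (\<lambda>v. v)"
proof (unfold tlin_def, intro allI impI)
  fix v r assume "r < n"
  have "(\<Sum>c<n. v c * uv c r) = (\<Sum>c<n. v c * uv r c)"
    by (intro sum.cong refl) (simp add: uv_def)
  then show "v r = (\<Sum>c<n. v c * uv c r)" using \<open>r < n\<close> by simp
qed

section \<open>The bracket as a bilinear map and its grading by weights\<close>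

definition br :: "ctype \<Rightarrow> (int list \<Rightarrow> int list \<Rightarrow> int) \<Rightarrow> (nat \<Rightarrow> 'r::comm_ring_1) \<Rightarrow> (nat \<Rightarrow> 'r) \<Rightarrow> nat \<Rightarrow> 'r" where
  "br T N u v = (\<lambda>m. \<Sum>i<bdim T. \<Sum>j<bdim T. u i * v j * of_int (brk T N i j m))"

lemma br_uv: "i < bdim T \<Longrightarrow> j < bdim T \<Longrightarrow> br T N (uv i) (uv j) = (\<lambda>m. of_int (brk T N i j m))"
  by (simp add: br_def mult.assoc flip: sum_distrib_left)

lemma br_uv_left: "i < bdim T \<Longrightarrow> br T N (uv i) v = (\<lambda>m. \<Sum>j<bdim T. v j * of_int (brk T N i j m))"
  by (simp add: br_def mult.assoc flip: sum_distrib_left)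

lemma br_uv_right: "j < bdim T \<Longrightarrow> br T N u (uv j) = (\<lambda>m. \<Sum>i<bdim T. u i * of_int (brk T N i j m))"
  by (simp add: br_def mult.assoc flip: sum_distrib_left)

lemma nlin_br_right: "nlin (bdim T) (\<lambda>v. br T N u v)"
proof (unfold nlin_def, intro allI)
  fix v r
  have "br T N u v r = (\<Sum>j<bdim T. \<Sum>i<bdim T. u i * v j * of_int (brk T N i j r))"
    unfolding br_def by (rule sum.swap)
  then show "br T N u v r = (\<Sum>c<bdim T. v c * br T N u (uv c) r)"
    by (simp add: br_uv_right sum_distrib_left ac_simps)
qed

lemma nlin_br_left: "nlin (bdim T) (\<lambda>u. br T N u v)"
proof (unfold nlin_def, intro allI)
  fix u r
  show "br T N u v r = (\<Sum>c<bdim T. u c * br T N (uv c) v r)"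
    by (simp add: br_def[of _ _ u] br_uv_left sum_distrib_left ac_simps)
qed

lemmas br_add_right = vlin_add[OF nlin_vlin[OF nlin_br_right]]
  and br_add_left = vlin_add[OF nlin_vlin[OF nlin_br_left]]
  and br_sc_right = vlin_sc[OF nlin_vlin[OF nlin_br_right]]
  and br_sc_left = vlin_sc[OF nlin_vlin[OF nlin_br_left]]
  and br_zero_right [simp] = vlin_zero[OF nlin_vlin[OF nlin_br_right]]
  and br_zero_left [simp] = vlin_zero[OF nlin_vlin[OF nlin_br_left]]
  and br_minus_right = vlin_minus[OF nlin_vlin[OF nlin_br_right]]
  and br_minus_left = vlin_minus[OF nlin_vlin[OF nlin_br_left]]

lemma vadd_comm: "length u = length v \<Longrightarrow> vadd u v = vadd v u"
  by (simp add: list_eq_iff_nth_eq)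

lemma vadd_zv [simp]: "length u = rank T \<Longrightarrow> vadd u (zv T) = u" "length u = rank T \<Longrightarrow> vadd (zv T) u = u"
  by (simp_all add: list_eq_iff_nth_eq)

lemma brk_rr:
  assumes "a \<in> Phi T" "b \<in> Phi T"
  shows "brk T N (ridx T a) (ridx T b) =
    (if b = vneg a then (\<lambda>k. if k < rank T then coroot_coef T a k else 0)
     else if vadd a b \<in> Phi T then (\<lambda>k. if k = ridx T (vadd a b) then N a b else 0) else (\<lambda>_. 0))"
  using assms Phi_length[OF assms(1)] Phi_length[OF assms(2)] by (simp add: brk_def Let_def vadd_zero_iff)

lemma brk_hh: "i < rank T \<Longrightarrow> j < rank T \<Longrightarrow> brk T N i j = (\<lambda>_. 0)"
  by (simp add: brk_def Let_def)

lemma brk_hr: "i < rank T \<Longrightarrow> b \<in> Phi T \<Longrightarrow>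
    brk T N i (ridx T b) = (\<lambda>k. if k = ridx T b then cartan_int T b (sroot T i) else 0)"
  by (auto simp: brk_def Let_def fun_eq_iff)

lemma brk_rh: "j < rank T \<Longrightarrow> a \<in> Phi T \<Longrightarrow>
    brk T N (ridx T a) j = (\<lambda>k. if k = ridx T a then - cartan_int T a (sroot T j) else 0)"
  by (auto simp: brk_def Let_def fun_eq_iff)

lemma rank_le_bdim: "i < rank T \<Longrightarrow> i < bdim T"
  by (simp add: bdim_def)

text \<open>The Cartan part has degree zero in this grading; the weight arguments below rest on it
  through \<open>br_support\<close>.\<close>

lemma brk_weight:
  assumes "i < bdim T" "j < bdim T" "brk T N i j m \<noteq> 0"
  shows "m < bdim T \<and> wt T m = vadd (wt T i) (wt T j)"
  using assms(1)
proof (cases rule: index_cases)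
  case 1
  note i = this
  show ?thesis using assms(2)
  proof (cases rule: index_cases)
    case 1 with i assms(3) show ?thesis by (simp add: brk_hh)
  next
    case (2 b) with i assms(3) show ?thesis by (auto simp: brk_hr Phi_length split: if_splits)
  qed
next
  case (2 a)
  note i = this
  show ?thesis using assms(2)
  proof (cases rule: index_cases)
    case 1 with i assms(3) show ?thesis by (auto simp: brk_rh Phi_length split: if_splits)
  next
    case (2 b)
    have z: "vadd a (vneg a) = zv T" using i Phi_length[of a T] by (subst vadd_zero_iff) auto
    show ?thesis using i 2 assms(3) z by (auto simp: brk_rr rank_le_bdim split: if_splits)
  qed
qed

lemma br_support:
  assumes "br T N u v m \<noteq> (0::'r::comm_ring_1)"
  obtains i j where "i < bdim T" "j < bdim T" "u i \<noteq> 0" "v j \<noteq> 0" "m < bdim T"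
    "wt T m = vadd (wt T i) (wt T j)"
proof -
  have "\<exists>i<bdim T. \<exists>j<bdim T. u i * v j * of_int (brk T N i j m) \<noteq> 0"
    using assms unfolding br_def by (metis (no_types, lifting) lessThan_iff sum.neutral)
  then obtain i j where ij: "i < bdim T" "j < bdim T" "u i * v j * of_int (brk T N i j m) \<noteq> 0" by blast
  then have "brk T N i j m \<noteq> 0" "u i \<noteq> 0" "v j \<noteq> 0" by auto
  with ij brk_weight[of i T j N m] show thesis using that by blast
qed

lemma br_of_int:
  "br T N (\<lambda>k. of_int (u k)) (\<lambda>k. of_int (v k)) = (\<lambda>m. of_int (br T N u v m))"
  by (simp add: br_def)

locale chev =
  fixes T :: ctype and N :: "int list \<Rightarrow> int list \<Rightarrow> int"
  assumes constants: "chev_constants T N"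
begin

abbreviation "n \<equiv> bdim T"
abbreviation "ix \<equiv> ridx T"
abbreviation "B \<equiv> br T N"
abbreviation E :: "int list \<Rightarrow> nat \<Rightarrow> 'r::comm_ring_1" where "E a \<equiv> uv (ridx T a)"

lemma abs_N: "a \<in> Phi T \<Longrightarrow> b \<in> Phi T \<Longrightarrow> vadd a b \<in> Phi T \<Longrightarrow> \<bar>N a b\<bar> = int (pstr T a b) + 1"
  using constants unfolding chev_constants_def by blast

lemma brk_anti: "i < n \<Longrightarrow> j < n \<Longrightarrow> brk T N i j m = - brk T N j i m"
  using constants unfolding chev_constants_def by meson

lemma B_anti: "B u v = - B v u"
proof
  fix m
  have "B u v m = (\<Sum>j<n. \<Sum>i<n. u i * v j * of_int (brk T N i j m))"
    unfolding br_def by (rule sum.swap)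
  also have "\<dots> = (\<Sum>j<n. \<Sum>i<n. - (v j * u i * of_int (brk T N j i m)))"
  proof (intro sum.cong refl)
    fix i j assume "j \<in> {..<n}" "i \<in> {..<n}"
    then have "brk T N i j m = - brk T N j i m" by (intro brk_anti) auto
    then show "u i * v j * of_int (brk T N i j m) = - (v j * u i * of_int (brk T N j i m))" by simp
  qed
  also have "\<dots> = (- B v u) m" by (simp add: br_def sum_negf)
  finally show "B u v m = (- B v u) m" .
qed

lemma jacobi:
  fixes u v w :: "nat \<Rightarrow> int"
  shows "B u (B v w) + B v (B w u) + B w (B u v) = 0"
proof -
  have basis: "B (uv i) (B (uv j) (uv k)) + B (uv j) (B (uv k) (uv i)) + B (uv k) (B (uv i) (uv j)) = (0 :: nat \<Rightarrow> int)"
    if "i < n" "j < n" "k < n" for i j k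
  proof
    fix m
    have lbr: "lbr T N = (br T N :: (nat \<Rightarrow> int) \<Rightarrow> _)" by (simp add: lbr_def br_def fun_eq_iff)
    have b: "B (uv j) (uv k) = brk T N j k" if "j < n" "k < n" for j k
      by (simp add: br_uv[OF that])
    have un: "unitv i = uv i" for i by (simp add: unitv_def uv_def)
    show "(B (uv i) (B (uv j) (uv k)) + B (uv j) (B (uv k) (uv i)) + B (uv k) (B (uv i) (uv j))) m = (0 :: nat \<Rightarrow> int) m"
    proof -
      have "lbr T N (unitv i) (brk T N j k) m + lbr T N (unitv j) (brk T N k i) m
          + lbr T N (unitv k) (brk T N i j) m = 0"
        using constants that unfolding chev_constants_def by blast
      then show ?thesis unfolding lbr un using that
        by (simp only: b plus_fun_apply zero_fun_apply)
    qed
  qed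
  have nl: "nlin n (\<lambda>u. B u (B v w) + B v (B w u) + B w (B u v))"
    "nlin n (\<lambda>v. B u (B v w) + B v (B w u) + B w (B u v))"
    "nlin n (\<lambda>w. B u (B v w) + B v (B w u) + B w (B u v))" for u v w :: "nat \<Rightarrow> int"
    by (intro nlin_add nlin_br_left nlin_br_right nlin_comp[OF nlin_br_right nlin_br_left]
        nlin_comp[OF nlin_br_right nlin_br_right])+
  have "(\<lambda>w. B (uv i) (B (uv j) w) + B (uv j) (B w (uv i)) + B w (B (uv i) (uv j))) = (\<lambda>w::nat \<Rightarrow> int. 0)"
    if "i < n" "j < n" for i j
    using that by (intro nlin_eqI[OF nl(3) nlin_zero]) (simp add: basis)
  then have "(\<lambda>v. B (uv i) (B v w) + B v (B w (uv i)) + B w (B (uv i) v)) = (\<lambda>v::nat \<Rightarrow> int. 0)"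
    if "i < n" for i w
    using that by (intro nlin_eqI[OF nl(2) nlin_zero]) (meson fun_cong)
  then have "(\<lambda>u. B u (B v w) + B v (B w u) + B w (B u v)) = (\<lambda>u::nat \<Rightarrow> int. 0)" for v w
    by (intro nlin_eqI[OF nl(1) nlin_zero]) (meson fun_cong)
  then show ?thesis by (meson fun_cong)
qed

lemma B_derivation:
  fixes u v w :: "nat \<Rightarrow> int"
  shows "B w (B u v) = B (B w u) v + B u (B w v)"
proof -
  have "B u (B v w) = - B u (B w v)" by (subst B_anti[of v w]) (rule br_minus_right)
  moreover have "B v (B w u) = - B (B w u) v" by (rule B_anti)
  ultimately have "- B u (B w v) + - B (B w u) v + B w (B u v) = 0" using jacobi[of u v w] by simp
  then show ?thesis by (simp add: algebra_simps)
qed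

end

section \<open>Strings of roots\<close>

lemmas vec_apply = sc_apply plus_fun_apply zero_fun_apply minus_apply uminus_apply
declare vec_apply [simp del]

lemma sc_minus_right: "sc c (- v) = - sc c v"
  by (simp add: fun_eq_iff vec_apply)

lemma sc_cancel: "(a::int) \<noteq> 0 \<Longrightarrow> sc a u = sc a v \<Longrightarrow> u = v"
  by (simp add: fun_eq_iff vec_apply)

lemma sc_sum: "sc c (\<Sum>i\<in>A. f i) = (\<Sum>i\<in>A. sc c (f i))"
  by (simp add: fun_eq_iff sum_fun_apply vec_apply sum_distrib_left)

lemma length_sroot [simp]: "length (sroot T i) = rank T"
  by (simp add: sroot_def)

lemma sroot_Phi [simp]: "i < rank T \<Longrightarrow> sroot T i \<in> Phi T"
  by (cases T) (auto simp: Phi_iff sroot_def numeral_eq_Suc ip_F4[simplified numeral_eq_Suc] ip_def less_Suc_eq lessThan_Suc)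

text \<open>Makes the \<open>div\<close> in \<open>cartan_int\<close> exact.\<close>

lemma root_norm_dvd:
  assumes "a \<in> Phi T" "length v = rank T"
  shows "ip T a a dvd 2 * ip T v a"
proof (cases "ip T a a = 2")
  case False
  then have l: "ip T a a = long_norm T" using assms by (auto simp: Phi_iff)
  then have "long_norm T div 2 dvd ip T v a" using long_root_dvd assms by blast
  then have "2 * (long_norm T div 2) dvd 2 * ip T v a" by simp
  moreover have "2 * (long_norm T div 2) = long_norm T" by (cases T) simp_all
  ultimately show ?thesis using l by simp
qed simp

lemma cartan_int_mult:
  assumes "a \<in> Phi T" "length v = rank T"
  shows "cartan_int T v a * ip T a a = 2 * ip T v a"
  unfolding cartan_int_def using root_norm_dvd[OF assms] by simp

lemma root_norm_pos: "a \<in> Phi T \<Longrightarrow> ip T a a > 0"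
  by (cases T) (auto simp: Phi_iff)

lemma cartan_int_eqI:
  assumes "a \<in> Phi T" "length v = rank T" "2 * ip T v a = c * ip T a a"
  shows "cartan_int T v a = c"
  using cartan_int_mult[OF assms(1,2)] assms(3) root_norm_pos[OF assms(1)] by simp

text \<open>Exactness of the division in \<open>coroot_coef\<close>: the coroot 2a/(a,a) has integer
  coordinates with respect to the simple coroots.\<close>

lemma coroot_coef_mult:
  assumes "a \<in> Phi T" "k < rank T"
  shows "coroot_coef T a k * ip T a a = a ! k * ip T (sroot T k) (sroot T k)"
proof -
  have "\<forall>a\<in>set (root_enum T). \<forall>k<rank T. ip T a a dvd a ! k * ip T (sroot T k) (sroot T k)"
  proof (cases T)
    case F4
    have s: "sroot F4 0 = [1,0,0,0]" "sroot F4 1 = [0,1,0,0]" "sroot F4 2 = [0,0,1,0]" "sroot F4 3 = [0,0,0,1]"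
      by (simp_all add: sroot_def numeral_eq_Suc)
    have "\<forall>a\<in>set (root_enum F4). ip F4 a a dvd a ! 0 * ip F4 (sroot F4 0) (sroot F4 0)"
      "\<forall>a\<in>set (root_enum F4). ip F4 a a dvd a ! 1 * ip F4 (sroot F4 1) (sroot F4 1)"
      "\<forall>a\<in>set (root_enum F4). ip F4 a a dvd a ! 2 * ip F4 (sroot F4 2) (sroot F4 2)"
      "\<forall>a\<in>set (root_enum F4). ip F4 a a dvd a ! 3 * ip F4 (sroot F4 3) (sroot F4 3)"
      unfolding s by (simp_all add: root_enum_def ip_F4)
    moreover have "k = 0 \<or> k = 1 \<or> k = 2 \<or> k = 3" if "k < 4" for k :: nat using that by auto
    ultimately show ?thesis unfolding F4 rank_simps by metis
  next
    case G2
    have s: "sroot G2 0 = [1,0]" "sroot G2 1 = [0,1]" by (simp_all add: sroot_def numeral_eq_Suc)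
    have "\<forall>a\<in>set (root_enum G2). ip G2 a a dvd a ! 0 * ip G2 (sroot G2 0) (sroot G2 0)"
      "\<forall>a\<in>set (root_enum G2). ip G2 a a dvd a ! 1 * ip G2 (sroot G2 1) (sroot G2 1)"
      unfolding s by (simp_all add: root_enum_def ip_G2)
    moreover have "k = 0 \<or> k = 1" if "k < 2" for k :: nat using that by auto
    ultimately show ?thesis unfolding G2 rank_simps by metis
  qed
  then show ?thesis using assms unfolding coroot_coef_def by (simp add: Phi_eq)
qed

lemma ip_sroot_expand: "length v = rank T \<Longrightarrow> length a = rank T \<Longrightarrow> ip T v a = (\<Sum>k<rank T. a ! k * ip T v (sroot T k))"
  by (elim length_rankE) (auto simp: ip_F4 ip_G2 sroot_def lessThan_Suc numeral_eq_Suc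
      ip_F4[unfolded numeral_eq_Suc] ip_G2[unfolded numeral_eq_Suc] algebra_simps)

text \<open>After multiplication by (a,a) both sides become twice the expansion of the inner product
  of \<open>b\<close> and \<open>a\<close> along the simple roots. It lets the bracket of the coroot
  of \<open>a\<close> with \<open>E b\<close> be expressed by the Cartan integer.\<close>

lemma coroot_pairing:
  assumes "a \<in> Phi T" "b \<in> Phi T"
  shows "(\<Sum>k<rank T. coroot_coef T a k * cartan_int T b (sroot T k)) = cartan_int T b a"
proof -
  have "(\<Sum>k<rank T. coroot_coef T a k * cartan_int T b (sroot T k)) * ip T a a
      = (\<Sum>k<rank T. (coroot_coef T a k * ip T a a) * cartan_int T b (sroot T k))"
    by (simp add: sum_distrib_left ac_simps)
  also have "\<dots> = (\<Sum>k<rank T. a ! k * (cartan_int T b (sroot T k) * ip T (sroot T k) (sroot T k)))"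
    using assms by (intro sum.cong refl) (simp add: coroot_coef_mult)
  also have "\<dots> = (\<Sum>k<rank T. 2 * (a ! k * ip T b (sroot T k)))"
    using assms by (intro sum.cong refl) (simp add: cartan_int_mult Phi_length)
  also have "\<dots> = 2 * ip T b a"
    using assms by (simp add: ip_sroot_expand[of b T a] Phi_length sum_distrib_left)
  also have "\<dots> = cartan_int T b a * ip T a a" using assms by (simp add: cartan_int_mult Phi_length)
  finally show ?thesis using root_norm_pos[OF assms(1)] by simp
qed

lemma root_not_double:
  assumes "a \<in> Phi T" shows "vadd a a \<notin> Phi T" "a \<noteq> vneg a"
proof -
  have "ip T (vadd a a) (vadd a a) = 4 * ip T a a" using assms by (simp add: ip_lin Phi_length)
  moreover have "ip T a a = 2 \<or> ip T a a = long_norm T" using assms by (simp add: Phi_iff)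
  ultimately have "ip T (vadd a a) (vadd a a) \<notin> {2, long_norm T}" by (cases T) (elim disjE; simp)+
  then show "vadd a a \<notin> Phi T" by (auto simp: Phi_iff)
  have "ip T a (vneg a) = - ip T a a" using assms by (simp add: ip_lin Phi_length)
  then show "a \<noteq> vneg a" using root_norm_pos[OF assms] by auto
qed

lemma pstr_eqI:
  assumes "i \<le> 3" "\<And>j. 1 \<le> j \<Longrightarrow> j \<le> i \<Longrightarrow> vadd b (vsmul (- int j) a) \<in> Phi T"
    "vadd b (vsmul (- int (Suc i)) a) \<notin> Phi T"
  shows "pstr T a b = i"
proof -
  have "{k. k \<le> 4 \<and> (\<forall>j\<in>{1..k}. vadd b (vsmul (- int j) a) \<in> Phi T)} = {..i}"
  proof (intro equalityI subsetI)
    fix k assume "k \<in> {k. k \<le> 4 \<and> (\<forall>j\<in>{1..k}. vadd b (vsmul (- int j) a) \<in> Phi T)}"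
    then have k: "\<forall>j\<in>{1..k}. vadd b (vsmul (- int j) a) \<in> Phi T" by blast
    show "k \<in> {..i}"
    proof (rule ccontr)
      assume "k \<notin> {..i}"
      then have "Suc i \<in> {1..k}" by auto
      with k assms(3) show False by blast
    qed
  next
    fix k assume "k \<in> {..i}"
    then show "k \<in> {k. k \<le> 4 \<and> (\<forall>j\<in>{1..k}. vadd b (vsmul (- int j) a) \<in> Phi T)}"
      using assms(1,2) by auto
  qed
  then show ?thesis unfolding pstr_def by (simp add: Max_eq_iff)
qed

definition emb :: "(nat \<Rightarrow> int) \<Rightarrow> nat \<Rightarrow> 'r::comm_ring_1" where
  "emb v = (\<lambda>k. of_int (v k))"

lemma emb_uv [simp]: "emb (uv c) = uv c"
  by (auto simp: emb_def uv_def)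

lemma emb_sc [simp]: "emb (sc a v) = sc (of_int a) (emb v)"
  by (simp add: emb_def sc_def)

lemma emb_0 [simp]: "emb 0 = 0"
  by (simp add: emb_def fun_eq_iff vec_apply)

lemma emb_add: "emb (u + v) = emb u + emb v"
  by (simp add: emb_def fun_eq_iff vec_apply)

context chev begin

definition Hc :: "int list \<Rightarrow> nat \<Rightarrow> 'r::comm_ring_1" where
  "Hc a = (\<lambda>k. if k < rank T then of_int (coroot_coef T a k) else 0)"

lemma B_emb: "B (emb u) (emb v) = emb (B u v)"
  using br_of_int[of T N u v] by (simp add: emb_def)

lemma B_EE: "a \<in> Phi T \<Longrightarrow> b \<in> Phi T \<Longrightarrow> vadd a b \<in> Phi T \<Longrightarrow> B (E a) (E b) = sc (of_int (N a b)) (E (vadd a b))"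
  by (auto simp: vec_apply br_uv brk_rr fun_eq_iff uv_apply vadd_zero_iff[symmetric] Phi_length)

lemma B_EE0: "a \<in> Phi T \<Longrightarrow> b \<in> Phi T \<Longrightarrow> vadd a b \<notin> Phi T \<Longrightarrow> b \<noteq> vneg a \<Longrightarrow> B (E a) (E b) = 0"
  by (auto simp: vec_apply br_uv brk_rr fun_eq_iff)

lemma B_opp: "a \<in> Phi T \<Longrightarrow> B (E a) (E (vneg a)) = Hc a"
  by (auto simp: br_uv brk_rr fun_eq_iff Hc_def)

lemma B_EE_self: "a \<in> Phi T \<Longrightarrow> B (E a) (E a) = 0"
  using root_not_double by (intro B_EE0) auto

lemma B_uv_E: "i < rank T \<Longrightarrow> b \<in> Phi T \<Longrightarrow> B (uv i) (E b) = sc (of_int (cartan_int T b (sroot T i))) (E b)"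
  by (auto simp: vec_apply br_uv brk_hr fun_eq_iff uv_apply rank_le_bdim)

lemma B_E_uv: "i < rank T \<Longrightarrow> b \<in> Phi T \<Longrightarrow> B (E b) (uv i) = sc (- of_int (cartan_int T b (sroot T i))) (E b)"
  by (auto simp: vec_apply br_uv brk_rh fun_eq_iff uv_apply rank_le_bdim)

lemma Hc_expand: "(Hc a :: nat \<Rightarrow> 'b::comm_ring_1) = (\<Sum>i<rank T. sc (of_int (coroot_coef T a i)) (uv i))"
proof
  fix k
  have "(\<Sum>i<rank T. (of_int (coroot_coef T a i) :: 'b) * uv i k) = (\<Sum>i<rank T. if i = k then of_int (coroot_coef T a i) else 0)"
    by (intro sum.cong refl) (simp add: uv_def)
  then show "(Hc a :: nat \<Rightarrow> 'b) k = (\<Sum>i<rank T. sc (of_int (coroot_coef T a i)) (uv i)) k"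
    unfolding Hc_def sum_fun_apply sc_apply by simp
qed

lemma B_Hc:
  assumes "a \<in> Phi T" "b \<in> Phi T"
  shows "B (Hc a) (E b) = sc (of_int (cartan_int T b a)) (E b)"
proof -
  have "B (Hc a) (E b) = (\<Sum>i<rank T. sc (of_int (coroot_coef T a i * cartan_int T b (sroot T i))) (E b))"
    unfolding Hc_expand using assms
    by (subst vlin_sum[OF nlin_vlin[OF nlin_br_left]]) (intro sum.cong refl, simp add: br_sc_left B_uv_E)
  also have "\<dots> = sc (\<Sum>i<rank T. of_int (coroot_coef T a i * cartan_int T b (sroot T i))) (E b)"
    by (auto simp: vec_apply fun_eq_iff sum_fun_apply sum_distrib_right)
  also have "\<dots> = sc (of_int (cartan_int T b a)) (E b)"
    using coroot_pairing[OF assms] by (metis of_int_sum)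
  finally show ?thesis .
qed

lemma cartan_self: "a \<in> Phi T \<Longrightarrow> cartan_int T a a = 2"
  by (intro cartan_int_eqI) (auto simp: Phi_length)

lemma cartan_neg: "a \<in> Phi T \<Longrightarrow> length v = rank T \<Longrightarrow> cartan_int T (vneg v) a = - cartan_int T v a"
  using cartan_int_mult[of a T v] by (intro cartan_int_eqI) (auto simp: Phi_length ip_lin)

text \<open>In the strings \<open>f k = \<plusminus>e\<^bsub>\<gamma>+(k-i)b\<^esub>\<close> the signs are chosen so that all coefficients are
  positive, i.e. \<open>f k\<close> is the divided power \<open>e\<^sub>b\<^sup>k / k!\<close> applied to \<open>f 0\<close>.\<close>
definition slstr :: "int list \<Rightarrow> nat \<Rightarrow> (nat \<Rightarrow> nat \<Rightarrow> int) \<Rightarrow> bool" where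
  "slstr b m f \<longleftrightarrow> m \<le> 3 \<and> (\<forall>k<m. B (E b) (f k) = sc (int (k + 1)) (f (k + 1))) \<and> B (E b) (f m) = 0 \<and>
     (\<forall>k<m. B (E (vneg b)) (f (k + 1)) = sc (int (m - k)) (f k)) \<and> B (E (vneg b)) (f 0) = 0"

text \<open>The three-dimensional subalgebra of \<open>b\<close> is itself a string from -b to b;
  the sign at the top compensates [e_b, h_b] = -2 e_b.\<close>

lemma slstr_Hc:
  assumes "b \<in> Phi T"
  shows "slstr b 2 (\<lambda>k. if k = 0 then E (vneg b) else if k = 1 then Hc b else - E b)"
proof -
  have H: "B (E b) (Hc b) = - sc 2 (E b :: nat \<Rightarrow> int)"
    using B_anti[of "E b" "Hc b :: nat \<Rightarrow> int"] B_Hc[OF assms assms, where 'a = int] cartan_self[OF assms] by simp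
  have H': "B (E (vneg b)) (Hc b) = sc 2 (E (vneg b) :: nat \<Rightarrow> int)"
    using B_anti[of "E (vneg b)" "Hc b :: nat \<Rightarrow> int"] B_Hc[OF assms vneg_Phi[OF assms], where 'a = int]
      cartan_self[OF assms] cartan_neg[OF assms, of b] by (simp add: Phi_length[OF assms] sc_minus)
  have H'': "B (E (vneg b)) (- E b) = (Hc b :: nat \<Rightarrow> int)"
    using B_anti[of "E (vneg b)" "E b :: nat \<Rightarrow> int"] B_opp[OF assms, where 'a = int] by (simp add: br_minus_right)
  have "k < 2 \<longleftrightarrow> k = 0 \<or> k = 1" for k :: nat by auto
  then show ?thesis unfolding slstr_def using assms H H' H''
    by (auto simp: B_opp B_EE_self br_minus_right sc_minus sc_minus_right)
qed

text \<open>Only absolute values of structure constants are given. At position k the value is k + 1,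
  so one choice of signs along the string normalises all raising coefficients; the lowering
  coefficients are then forced by the sl2 relations instead of being read off from
  \<open>N\<close>.\<close>

lemma slstr_root:
  assumes "b \<in> Phi T" "g \<in> Phi T" "g \<noteq> b" "g \<noteq> vneg b"
  obtains i m s where "i \<le> m" "m \<le> (if T = F4 then 2 else 3)"
    "slstr b m (\<lambda>k. sc (s k) (E (vadd g (vsmul (int k - int i) b))))" "\<And>k. s k = 1 \<or> s k = - 1"
    "2 * ip T g b = (2 * int i - int m) * ip T b b" "pstr T b g = i"
    "\<And>k. -1 \<le> k \<Longrightarrow> k \<le> 4 \<Longrightarrow> vadd g (vsmul (k - int i) b) \<in> Phi T \<longleftrightarrow> 0 \<le> k \<and> k \<le> int m"
proof -
  from string_exists[OF assms] obtain i m :: nat where im: "i \<le> m" "m \<le> (if T = F4 then 2 else 3)"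
    "2 * ip T g b = (2 * int i - int m) * ip T b b"
    "\<And>k. -1 \<le> k \<Longrightarrow> k \<le> 4 \<Longrightarrow> vadd g (vsmul (k - int i) b) \<in> Phi T \<longleftrightarrow> 0 \<le> k \<and> k \<le> int m"
    by metis
  have m3: "m \<le> 3" using im(2) by (auto split: if_splits)
  have lg: "length b = rank T" "length g = rank T" using assms by (auto simp: Phi_length)
  define rt where "rt k = vadd g (vsmul (k - int i) b)" for k :: int
  have lrt: "length (rt k) = rank T" for k using lg by (simp add: rt_def)
  have rtP: "rt k \<in> Phi T \<longleftrightarrow> 0 \<le> k \<and> k \<le> int m" if "-1 \<le> k" "k \<le> 4" for k
    using im(4)[OF that] by (simp add: rt_def)
  have rt_add: "vadd b (rt k) = rt (k + 1)" "vadd (vneg b) (rt k) = rt (k - 1)" for k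
    using lg by (auto simp: rt_def list_eq_iff_nth_eq algebra_simps)
  have rt_sub: "vadd (rt k) (vsmul (- int j) b) = rt (k - int j)" for k j
    using lg by (auto simp: rt_def list_eq_iff_nth_eq algebra_simps)
  have rti: "rt (int i) = g" using lg by (auto simp: rt_def list_eq_iff_nth_eq)
  \<comment> \<open>If \<open>g\<close> were c b, the ratio of norms would be c^2; for two roots
    this ratio is 1, the lacing number or its inverse. So c = +-1, which is excluded.\<close>
  have ne: "rt k \<noteq> b \<and> rt k \<noteq> vneg b \<and> rt k \<noteq> zv T" for k
  proof -
    have *: False if "g = vsmul c b" for c
    proof -
      have n: "ip T g g = c^2 * ip T b b" using that lg by (simp add: ip_lin power2_eq_square)
      have "c^2 = 1 \<or> c^2 = 0 \<or> c^2 \<ge> 4"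
        using abs_le_square_iff[of 2 c] by (cases "\<bar>c\<bar> \<ge> 2") (auto, metis abs_1 abs_0 less_2_cases_iff nat_less_iff power2_abs zabs_less_one_iff zero_eq_power2 one_power2 int_one_le_iff_zero_less linorder_not_le numeral_2_eq_2 zle_add1_eq_le one_add_one order_antisym_conv not_less)
      moreover have "c^2 \<noteq> 0" using n root_norm_pos[OF assms(2)] by auto
      moreover have "\<not> c^2 \<ge> 4"
      proof
        assume "c^2 \<ge> 4"
        then have "4 * ip T b b \<le> c^2 * ip T b b" using root_norm_pos[OF assms(1)] by (intro mult_right_mono) auto
        then show False using n assms(1,2) by (cases T) (auto simp: Phi_iff)
      qed
      ultimately have "c = 1 \<or> c = -1" by (simp add: power2_eq_1_iff)
      then show False using that assms(3,4) lg by (auto simp: list_eq_iff_nth_eq)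
    qed
    have "g = vsmul (1 - (k - int i)) b" if "rt k = b"
      using that lg by (auto simp: rt_def list_eq_iff_nth_eq algebra_simps)
    moreover have "g = vsmul (-1 - (k - int i)) b" if "rt k = vneg b"
      using that lg by (auto simp: rt_def list_eq_iff_nth_eq algebra_simps)
    moreover have "g = vsmul (- (k - int i)) b" if "rt k = zv T"
      using that lg by (auto simp: rt_def list_eq_iff_nth_eq algebra_simps)
    ultimately show ?thesis using * by blast
  qed
  have ps: "pstr T b (rt (int k)) = k" if "k \<le> m" for k
    proof (rule pstr_eqI)
    show "vadd (rt (int k)) (vsmul (- int (Suc k)) b) \<notin> Phi T"
      unfolding rt_sub using rtP[of "-1"] by simp
  qed (use that m3 rtP in \<open>auto simp: rt_sub\<close>)
  \<comment> \<open>The sign of each structure constant is passed on to the next vector.\<close>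
  define s where "s = rec_nat (1::int) (\<lambda>k x. x * sgn (N b (rt (int k))))"
  have s0: "s 0 = 1" and sS: "\<And>k. s (Suc k) = s k * sgn (N b (rt (int k)))" by (simp_all add: s_def)
  \<comment> \<open>The default 1 beyond the end of the string makes the sign property hold for all
    k.\<close>
  define s' where "s' k = (if k \<le> m then s k else 1)" for k
  have Nv: "\<bar>N b (rt (int k))\<bar> = int k + 1" if "k < m" for k
    using abs_N[of b "rt (int k)"] assms(1) rtP[of "int k"] rtP[of "int k + 1"] that m3 ps[of k]
    by (simp add: rt_add)
  have s1: "k \<le> m \<Longrightarrow> s k = 1 \<or> s k = - 1" for k
  proof (induction k)
    case (Suc k)
    then have "N b (rt (int k)) \<noteq> 0" using Nv[of k] by auto
    then have "sgn (N b (rt (int k))) = 1 \<or> sgn (N b (rt (int k))) = -1" by (auto simp: sgn_if)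
    with Suc show ?case by (auto simp: sS)
  qed (simp add: s0)
  have s1': "s' k = 1 \<or> s' k = - 1" for k using s1 by (auto simp: s'_def)
  define f where "f k = sc (s' k) (E (rt (int k)) :: nat \<Rightarrow> int)" for k
  have up: "B (E b) (f k) = sc (int (k + 1)) (f (k + 1))" if "k < m" for k
  proof -
    have "B (E b) (f k) = sc (s k * N b (rt (int k))) (E (rt (int k + 1)))"
      using that m3 assms(1) rtP[of "int k"] rtP[of "int k + 1"]
      by (simp add: f_def s'_def br_sc_right B_EE rt_add)
    also have "s k * N b (rt (int k)) = int (k + 1) * s (Suc k)"
      using Nv[OF that] by (auto simp: sS sgn_if split: if_splits)
    finally show ?thesis using that by (simp add: f_def s'_def add.commute)
  qed
  have top: "B (E b) (f m) = 0"
    using m3 assms(1) rtP[of "int m"] rtP[of "int m + 1"] ne[of "int m"]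
    by (simp add: f_def br_sc_right B_EE0 rt_add)
  have bot: "B (E (vneg b)) (f 0) = 0"
    using m3 assms(1) rtP[of 0] rtP[of "-1"] ne[of 0]
    by (simp add: f_def br_sc_right B_EE0 rt_add)
  have wtk: "B (Hc b) (f k) = sc (2 * int k - int m) (f k)" if "k \<le> m" for k
  proof -
    have "cartan_int T (rt (int k)) b = 2 * int k - int m"
      using assms(1) lg im(3) by (intro cartan_int_eqI) (auto simp: rt_def ip_lin algebra_simps)
    then show ?thesis using that m3 assms(1) rtP[of "int k"] by (simp add: f_def br_sc_right B_Hc mult.commute)
  qed
  have F: "B (E (vneg b)) (E b) = - (Hc b :: nat \<Rightarrow> int)"
    using B_anti[of "E (vneg b)" "E b :: nat \<Rightarrow> int"] B_opp[OF assms(1), where 'a = int] by simp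
  \<comment> \<open>Since [e_{-b}, e_b] = -h_b and h_b acts on \<open>f k\<close> by 2k - m, each
    lowering coefficient follows from the preceding one; the factor k + 2 is cancelled over the
    integers.\<close>
  have down: "B (E (vneg b)) (f (k + 1)) = sc (int (m - k)) (f k)" if "k < m" for k
    using that
  proof (induction k)
    case 0
    have "sc (int 1) (B (E (vneg b)) (f 1)) = B (E (vneg b)) (B (E b) (f 0))"
      using up[of 0] 0 by (simp add: br_sc_right)
    also have "\<dots> = B (- Hc b) (f 0) + B (E b) (B (E (vneg b)) (f 0))"
      by (subst B_derivation) (simp add: F)
    also have "\<dots> = sc (int m) (f 0)" using wtk[of 0] bot by (simp add: br_minus_left sc_minus)
    finally show ?case by simp
  next
    case (Suc k)
    have "sc (int (k + 2)) (B (E (vneg b)) (f (k + 2))) = B (E (vneg b)) (B (E b) (f (k + 1)))"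
      using up[of "k + 1"] Suc by (simp add: br_sc_right)
    also have "\<dots> = B (- Hc b) (f (k + 1)) + B (E b) (B (E (vneg b)) (f (k + 1)))"
      by (subst B_derivation) (simp add: F)
    also have "\<dots> = - sc (2 * int (k + 1) - int m) (f (k + 1)) + sc (int (m - k) * int (k + 1)) (f (k + 1))"
      using wtk[of "k + 1"] up[of k] Suc by (simp add: br_minus_left br_sc_right)
    also have "\<dots> = sc (- (2 * int (k + 1) - int m) + int (m - k) * int (k + 1)) (f (k + 1))"
      by (simp only: sc_minus sc_add_left)
    also have "- (2 * int (k + 1) - int m) + int (m - k) * int (k + 1) = int (k + 2) * int (m - (k + 1))"
      using Suc(2) by (simp add: of_nat_diff algebra_simps)
    finally have "sc (int (k + 2)) (B (E (vneg b)) (f (k + 2))) = sc (int (k + 2)) (sc (int (m - (k + 1))) (f (k + 1)))"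
      by simp
    then have "\<forall>r. int (k + 2) * B (E (vneg b)) (f (k + 2)) r = int (k + 2) * sc (int (m - (k + 1))) (f (k + 1)) r"
      by (simp add: fun_eq_iff sc_apply)
    then have "B (E (vneg b)) (f (k + 2)) = sc (int (m - (k + 1))) (f (k + 1))" by (auto simp: fun_eq_iff)
    then show ?case by simp
  qed
  have "slstr b m f" unfolding slstr_def using m3 up top down bot by blast
  then have sl: "slstr b m (\<lambda>k. sc (s' k) (E (vadd g (vsmul (int k - int i) b))))"
    unfolding f_def rt_def by simp
  show thesis by (rule that[OF im(1,2) sl s1' im(3) _ im(4)]) (use ps[OF im(1)] rti in auto)
qed

end

section \<open>Divided powers\<close>

context chev begin

definition adp :: "int list \<Rightarrow> nat \<Rightarrow> (nat \<Rightarrow> int) \<Rightarrow> nat \<Rightarrow> int" where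
  "adp b k = (B (E b)) ^^ k"

lemma adp_0 [simp]: "adp b 0 v = v"
  by (simp add: adp_def)

lemma adp_Suc: "adp b (Suc k) v = B (E b) (adp b k v)"
  by (simp add: adp_def)

lemma adp_add: "adp b i (adp b j v) = adp b (i + j) v"
  by (simp add: adp_def funpow_add)

lemma slstr_adp:
  assumes "slstr b m f" "k \<le> m"
  shows "adp b j (f k) = (if k + j \<le> m then sc (int (fact j * ((k + j) choose j))) (f (k + j)) else 0)"
proof (induction j)
  case (Suc j)
  consider "k + Suc j \<le> m" | "k + j = m" | "k + j > m" by linarith
  then show ?case
  proof cases
    case 1
    then have "adp b (Suc j) (f k) = sc (int (fact j * ((k + j) choose j))) (B (E b) (f (k + j)))"
      using Suc by (simp add: adp_Suc br_sc_right)
    also have "B (E b) (f (k + j)) = sc (int (k + j + 1)) (f (k + j + 1))"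
      using assms 1 by (auto simp: slstr_def)
    also have "sc (int (fact j * ((k + j) choose j))) (sc (int (k + j + 1)) (f (k + j + 1)))
        = sc (int (fact j * (Suc (k + j) * ((k + j) choose j)))) (f (k + Suc j))"
      by (simp add: algebra_simps)
    also have "Suc (k + j) * ((k + j) choose j) = Suc j * ((k + Suc j) choose (Suc j))"
      using Suc_times_binomial_eq[of "k + j" j] by (simp add: mult.commute)
    finally show ?thesis using 1 by (simp add: algebra_simps)
  next
    case 2
    then show ?thesis using Suc assms by (auto simp: adp_Suc br_sc_right slstr_def)
  next
    case 3
    then show ?thesis using Suc by (simp add: adp_Suc)
  qed
qed (use assms(2) in simp)

text \<open>The simple coroots need not be multiples of members of such strings;
  \<open>adp_h\<close> treats them directly.\<close>

lemma basis_string: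
  assumes "b \<in> Phi T" "c < n"
  shows "(\<exists>m f k s. m \<le> (if T = F4 then 2 else 3) \<and> slstr b m f \<and> k \<le> m \<and> uv c = sc s (f k))
     \<or> c < rank T"
  using assms(2)
proof (cases rule: index_cases)
  case (2 g)
  let ?f = "\<lambda>k::nat. if k = 0 then E (vneg b) else if k = 1 then Hc b else - E b :: nat \<Rightarrow> int"
  have sl: "slstr b 2 ?f" by (rule slstr_Hc[OF assms(1)])
  consider "g = b" | "g = vneg b" | "g \<noteq> b" "g \<noteq> vneg b" by blast
  then show ?thesis
  proof cases
    case 1
    have "uv c = sc (- 1) (?f 2)" using 1 2 by (simp add: sc_minus)
    with sl show ?thesis by (intro disjI1 exI[of _ 2] exI[of _ ?f] exI[of _ "2::nat"] exI[of _ "- 1"]) auto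
  next
    case gb: 2
    have "uv c = sc 1 (?f 0)" using gb 2 by simp
    with sl show ?thesis by (intro disjI1 exI[of _ 2] exI[of _ ?f] exI[of _ "0::nat"] exI[of _ 1]) auto
  next
    case 3
    obtain i m s where im: "i \<le> m" "m \<le> (if T = F4 then 2 else 3)"
      "slstr b m (\<lambda>k. sc (s k) (E (vadd g (vsmul (int k - int i) b))))" "\<And>k. s k = 1 \<or> s k = - 1"
      by (rule slstr_root[OF assms(1) 2(1) 3]) blast
    have "vadd g (vsmul 0 b) = g" using 2 assms(1) by (auto simp: list_eq_iff_nth_eq Phi_length)
    moreover have "s i * s i = 1" using im(4)[of i] by auto
    ultimately have "uv c = sc (s i) (sc (s i) (E (vadd g (vsmul (int i - int i) b))))" using 2 by simp
    with im show ?thesis by blast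
  qed
qed simp

lemma adp_h:
  assumes "b \<in> Phi T" "c < rank T"
  shows "adp b 1 (uv c) = sc (- cartan_int T b (sroot T c)) (E b)" "adp b (Suc (Suc j)) (uv c) = 0"
proof -
  show 1: "adp b 1 (uv c) = sc (- cartan_int T b (sroot T c)) (E b)"
    using B_E_uv[OF assms(2,1), where 'a = int] by (simp add: adp_Suc)
  have "adp b 2 (uv c) = 0" using adp_add[of b 1 1 "uv c"] 1 assms
    by (simp add: adp_Suc br_sc_right B_EE_self numeral_2_eq_2)
  then show "adp b (Suc (Suc j)) (uv c) = 0"
    by (induction j) (simp_all add: adp_Suc numeral_2_eq_2)
qed

lemma nlin_adp: "nlin n (adp b (Suc j))"
proof (induction j)
  case 0
  have "adp b (Suc 0) = B (E b)" by (auto simp: fun_eq_iff adp_Suc)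
  then show ?case using nlin_br_right[of T N "E b"] by simp
next
  case (Suc j)
  have "adp b (Suc (Suc j)) = (\<lambda>v. B (E b) (adp b (Suc j) v))" by (auto simp: fun_eq_iff adp_Suc)
  then show ?case using nlin_comp[OF nlin_br_right[of T N "E b"] Suc] by simp
qed

text \<open>The integrality behind the definition of root elements: it makes the division by k! in
  \<open>xr\<close> exact. On a string it holds because j-fold raising produces j! times a binomial
  coefficient.\<close>

lemma adp_uv_dvd:
  assumes "b \<in> Phi T" "c < n"
  shows "fact j dvd adp b j (uv c) r"
  using basis_string[OF assms]
proof (elim disjE exE conjE)
  fix m f k s assume "slstr b m f" "k \<le> m" "uv c = sc s (f k)"
  moreover have "adp b j (sc s (f k)) = sc s (adp b j (f k))"
    by (cases j) (simp_all add: vlin_sc[OF nlin_vlin[OF nlin_adp]])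
  ultimately show ?thesis by (auto simp: slstr_adp vec_apply)
next
  assume "c < rank T"
  consider "j = 0" | "j = 1" | i where "j = Suc (Suc i)" by (metis One_nat_def not0_implies_Suc)
  then show ?thesis
    using adp_h[OF assms(1) \<open>c < rank T\<close>] by cases (auto simp: vec_apply)
qed

lemma adp_uv_zero:
  assumes "b \<in> Phi T" "c < n" "j > (if T = F4 then 2 else 3)"
  shows "adp b j (uv c) = 0"
  using basis_string[OF assms(1,2)]
proof (elim disjE exE conjE)
  fix m f k s assume *: "slstr b m f" "k \<le> m" "uv c = sc s (f k)" "m \<le> (if T = F4 then 2 else 3)"
  have "adp b j (sc s (f k)) = sc s (adp b j (f k))"
    by (cases j) (simp_all add: vlin_sc[OF nlin_vlin[OF nlin_adp]])
  with * assms(3) show ?thesis by (simp add: slstr_adp)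
next
  assume "c < rank T"
  have "j = Suc (Suc (j - 2))" using assms(3) by (auto split: if_splits)
  then obtain i where "j = Suc (Suc i)" by blast
  then show ?thesis using adp_h[OF assms(1) \<open>c < rank T\<close>] by simp
qed

definition dker :: "int list \<Rightarrow> nat \<Rightarrow> nat \<Rightarrow> nat \<Rightarrow> int" where
  "dker b j r c = adp b j (uv c) r div fact j"

text \<open>The divided power (ad e_b)^j / j! over an arbitrary ring. The case j = 0 is separate
  because the identity also keeps the coordinates beyond \<open>n\<close>, which a sum over basis
  vectors would drop.\<close>

definition Dd :: "int list \<Rightarrow> nat \<Rightarrow> (nat \<Rightarrow> 'r::comm_ring_1) \<Rightarrow> nat \<Rightarrow> 'r" where
  "Dd b j v = (if j = 0 then v else (\<lambda>r. \<Sum>c<n. v c * of_int (dker b j r c)))"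

lemma Dd_0 [simp]: "Dd b 0 v = v"
  by (simp add: Dd_def)

lemma nlin_Dd: "j > 0 \<Longrightarrow> nlin n (Dd b j)"
  by (simp add: nlin_def Dd_def)

lemma vlin_Dd: "vlin (Dd b j)"
proof (cases "j = 0")
  case True then show ?thesis by (simp add: vlin_def)
qed (rule nlin_vlin[OF nlin_Dd], simp)

lemma tlin_Dd: "tlin n (Dd b j :: (nat \<Rightarrow> 'b::comm_ring_1) \<Rightarrow> nat \<Rightarrow> 'b)"
proof (cases "j = 0")
  case True
  then have "Dd b j = (\<lambda>v :: nat \<Rightarrow> 'b. v)" by (auto simp: fun_eq_iff)
  then show ?thesis by (simp add: tlin_id)
qed (rule nlin_tlin[OF nlin_Dd], simp)

lemma Dd_emb: "Dd b j (emb v) = emb (Dd b j v)"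
  by (simp add: Dd_def emb_def)

lemma Dd_fact:
  assumes "b \<in> Phi T" shows "sc (fact j) (Dd b j v) = adp b j v"
proof (cases j)
  case (Suc i)
  have "(\<lambda>v. sc (fact j) (Dd b j v)) = adp b j"
  proof (rule nlin_eqI)
    show "nlin n (\<lambda>v::nat \<Rightarrow> int. sc (fact j) (Dd b j v))" using Suc by (intro nlin_sc nlin_Dd) simp
    show "nlin n (adp b j)" using Suc nlin_adp by simp
    show "sc (fact j) (Dd b j (uv c)) = adp b j (uv c)" if "c < n" for c
      using that adp_uv_dvd[OF assms that, of j] Suc
      by (simp add: fun_eq_iff vec_apply Dd_def dker_def del: fact_Suc)
  qed
  from fun_cong[OF this, of v] show ?thesis by simp
qed simp

lemma Dd_1:
  assumes "b \<in> Phi T" shows "Dd b 1 v = B (E b) (v :: nat \<Rightarrow> 'b::comm_ring_1)"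
proof -
  have "Dd b 1 = (B (E b) :: (nat \<Rightarrow> 'b) \<Rightarrow> _)"
  proof (rule nlin_eqI)
    show "Dd b 1 (uv c) = (B (E b) (uv c) :: nat \<Rightarrow> 'b)" if "c < n" for c
    proof -
      have "Dd b 1 (uv c) = B (E b) (uv c :: nat \<Rightarrow> int)"
        using Dd_fact[OF assms, of 1 "uv c"] by (simp add: adp_Suc)
      then have "emb (Dd b 1 (uv c)) = (emb (B (E b) (uv c)) :: nat \<Rightarrow> 'b)" by simp
      then show ?thesis by (simp flip: Dd_emb B_emb)
    qed
  qed (simp_all add: nlin_Dd nlin_br_right)
  then show ?thesis by (rule fun_cong)
qed

lemma Dd_zero:
  assumes "b \<in> Phi T" "j > (if T = F4 then 2 else 3)"
  shows "Dd b j v = 0"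
proof -
  have "dker b j r c = 0" if "c < n" for r c
    using adp_uv_zero[OF assms(1) that assms(2)] by (simp add: dker_def vec_apply)
  then show ?thesis using assms(2) by (auto simp: Dd_def fun_eq_iff vec_apply)
qed

lemma Dd_zero4: "b \<in> Phi T \<Longrightarrow> j \<ge> 4 \<Longrightarrow> Dd b j v = 0"
  by (rule Dd_zero) auto

text \<open>After multiplication by i! j! both sides are \<open>adp b (i + j)\<close>. The factor is
  cancelled over the integers, and the result is carried to \<open>'b\<close> by comparing basis
  vectors, which lie in the image of \<open>emb\<close>.\<close>

lemma Dd_comp:
  assumes "b \<in> Phi T"
  shows "Dd b i (Dd b j v) = sc (of_nat ((i + j) choose i)) (Dd b (i + j) (v :: nat \<Rightarrow> 'b::comm_ring_1))"
proof (cases "i = 0 \<or> j = 0")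
  case False
  have Z: "Dd b i (Dd b j v) = sc (of_nat ((i + j) choose i)) (Dd b (i + j) v)" for v :: "nat \<Rightarrow> int"
  proof (rule sc_cancel[of "fact i * fact j"])
    have "sc (fact i * fact j) (Dd b i (Dd b j v)) = sc (fact i) (Dd b i (sc (fact j) (Dd b j v)))"
      by (simp add: vlin_sc[OF vlin_Dd])
    also have "\<dots> = adp b (i + j) v" by (simp only: Dd_fact[OF assms] adp_add)
    also have "\<dots> = sc (fact (i + j)) (Dd b (i + j) v)" by (simp add: Dd_fact[OF assms])
    also have "(fact (i + j) :: int) = fact i * fact j * of_nat ((i + j) choose i)"
      using binomial_fact_lemma[of i "i + j"] by (metis add_diff_cancel_left' le_add1 of_nat_fact of_nat_mult)
    finally show "sc (fact i * fact j) (Dd b i (Dd b j v)) = sc (fact i * fact j) (sc (of_nat ((i + j) choose i)) (Dd b (i + j) v))"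
      by simp
  qed simp
  have "(\<lambda>v. Dd b i (Dd b j v)) = (\<lambda>v::nat \<Rightarrow> 'b. sc (of_nat ((i + j) choose i)) (Dd b (i + j) v))"
  proof (rule nlin_eqI)
    show "nlin n (\<lambda>v::nat \<Rightarrow> 'b. Dd b i (Dd b j v))" using False by (intro nlin_comp[OF nlin_Dd nlin_Dd]) auto
    show "nlin n (\<lambda>v::nat \<Rightarrow> 'b. sc (of_nat ((i + j) choose i)) (Dd b (i + j) v))" using False by (intro nlin_sc nlin_Dd) auto
    fix c
    have "emb (Dd b i (Dd b j (uv c))) = (emb (sc (of_nat ((i + j) choose i)) (Dd b (i + j) (uv c))) :: nat \<Rightarrow> 'b)"
      by (simp only: Z)
    then show "Dd b i (Dd b j (uv c)) = (sc (of_nat ((i + j) choose i)) (Dd b (i + j) (uv c)) :: nat \<Rightarrow> 'b)"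
      by (simp flip: Dd_emb)
  qed
  from fun_cong[OF this, of v] show ?thesis by simp
qed auto

lemma adp_B: "adp b j (B u v) = (\<Sum>i\<le>j. sc (of_nat (j choose i)) (B (adp b i u) (adp b (j - i) v)))"
proof (induction j)
  case (Suc j)
  let ?t = "\<lambda>i k. B (adp b i u) (adp b k v)"
  have st: "B (E b) (?t i k) = ?t (Suc i) k + ?t i (Suc k)" for i k
    by (subst B_derivation) (simp add: adp_Suc)
  have "adp b (Suc j) (B u v) = (\<Sum>i\<le>j. sc (of_nat (j choose i)) (?t (Suc i) (j - i) + ?t i (Suc (j - i))))"
    by (simp add: adp_Suc[of b j] Suc vlin_sum[OF nlin_vlin[OF nlin_br_right]] br_sc_right st)
  also have "\<dots> = (\<Sum>i\<le>j. sc (of_nat (j choose i)) (?t (Suc i) (j - i))) + (\<Sum>i\<le>j. sc (of_nat (j choose i)) (?t i (Suc j - i)))"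
    by (simp add: sc_add sum.distrib Suc_diff_le)
  also have "(\<Sum>i\<le>j. sc (of_nat (j choose i)) (?t i (Suc j - i))) = (\<Sum>i\<le>Suc j. sc (of_nat (j choose i)) (?t i (Suc j - i)))"
    by (simp add: binomial_eq_0)
  also have "\<dots> = ?t 0 (Suc j) + (\<Sum>i\<le>j. sc (of_nat (j choose Suc i)) (?t (Suc i) (j - i)))"
    by (subst sum.atMost_Suc_shift) simp
  finally have "adp b (Suc j) (B u v) = ?t 0 (Suc j) + (\<Sum>i\<le>j. sc (of_nat (Suc j choose Suc i)) (?t (Suc i) (j - i)))"
    by (simp add: sum.distrib sc_add_left algebra_simps)
  also have "\<dots> = (\<Sum>i\<le>Suc j. sc (of_nat (Suc j choose i)) (?t i (Suc j - i)))"
    by (subst sum.atMost_Suc_shift) simp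
  finally show ?case .
qed simp

text \<open>The binomial coefficients of \<open>adp_B\<close> disappear on division by j!. This is
  done over the integers; two extensions by linearity, one in each argument, then give the rule over
  \<open>'b\<close>.\<close>

lemma Dd_B:
  assumes "b \<in> Phi T"
  shows "Dd b j (B u v) = (\<Sum>i\<le>j. B (Dd b i u) (Dd b (j - i) (v :: nat \<Rightarrow> 'b::comm_ring_1)))"
proof -
  have Z: "Dd b j (B u v) = (\<Sum>i\<le>j. B (Dd b i u) (Dd b (j - i) v))" for u v :: "nat \<Rightarrow> int"
  proof (rule sc_cancel[of "fact j"])
    have "sc (fact j) (Dd b j (B u v)) = (\<Sum>i\<le>j. sc (of_nat (j choose i)) (B (sc (fact i) (Dd b i u)) (sc (fact (j - i)) (Dd b (j - i) v))))"
      by (simp only: Dd_fact[OF assms] adp_B)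
    also have "\<dots> = (\<Sum>i\<le>j. sc (fact j) (B (Dd b i u) (Dd b (j - i) v)))"
    proof (intro sum.cong refl)
      fix i assume "i \<in> {..j}"
      then have "(fact j :: int) = of_nat (j choose i) * (fact i * fact (j - i))"
        using binomial_fact_lemma[of i j] by (metis atMost_iff mult.commute of_nat_fact of_nat_mult)
      then show "sc (of_nat (j choose i)) (B (sc (fact i) (Dd b i u)) (sc (fact (j - i)) (Dd b (j - i) v)))
          = sc (fact j) (B (Dd b i u) (Dd b (j - i) v))"
        by (simp add: br_sc_right br_sc_left ac_simps)
    qed
    finally show "sc (fact j) (Dd b j (B u v)) = sc (fact j) (\<Sum>i\<le>j. B (Dd b i u) (Dd b (j - i) v))"
      by (simp add: sc_sum)
  qed simp
  have nl1: "nlin n (\<lambda>u::nat \<Rightarrow> 'b. Dd b j (B u v))" "nlin n (\<lambda>v::nat \<Rightarrow> 'b. Dd b j (B u v))" for u v :: "nat \<Rightarrow> 'b"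
    by (rule vlin_comp_nlin[OF vlin_Dd nlin_br_left] vlin_comp_nlin[OF vlin_Dd nlin_br_right])+
  have nl2: "nlin n (\<lambda>u::nat \<Rightarrow> 'b. \<Sum>i\<le>j. B (Dd b i u) (Dd b (j - i) v))"
    "nlin n (\<lambda>v::nat \<Rightarrow> 'b. \<Sum>i\<le>j. B (Dd b i u) (Dd b (j - i) v))" for u v :: "nat \<Rightarrow> 'b"
    by (intro nlin_sum nlin_comp_tlin[OF nlin_br_left tlin_Dd] nlin_comp_tlin[OF nlin_br_right tlin_Dd])+
  have "Dd b j (B (uv c) (uv d)) = (\<Sum>i\<le>j. B (Dd b i (uv c)) (Dd b (j - i) (uv d :: nat \<Rightarrow> 'b)))" for c d
  proof -
    have es: "emb (\<Sum>i\<in>A. g i) = (\<Sum>i\<in>A. emb (g i) :: nat \<Rightarrow> 'b)" for A and g :: "nat \<Rightarrow> nat \<Rightarrow> int"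
      by (induction A rule: infinite_finite_induct) (simp_all add: emb_add)
    have "emb (Dd b j (B (uv c) (uv d))) = (emb (\<Sum>i\<le>j. B (Dd b i (uv c)) (Dd b (j - i) (uv d))) :: nat \<Rightarrow> 'b)"
      by (simp only: Z)
    then show ?thesis by (simp add: es flip: Dd_emb B_emb)
  qed
  then have "(\<lambda>v::nat \<Rightarrow> 'b. Dd b j (B (uv c) v)) = (\<lambda>v. \<Sum>i\<le>j. B (Dd b i (uv c)) (Dd b (j - i) v))" for c
    by (intro nlin_eqI[OF nl1(2) nl2(2)])
  then have "Dd b j (B (uv c) v) = (\<Sum>i\<le>j. B (Dd b i (uv c)) (Dd b (j - i) v))" for c
    by (rule fun_cong)
  then have "(\<lambda>u::nat \<Rightarrow> 'b. Dd b j (B u v)) = (\<lambda>u. \<Sum>i\<le>j. B (Dd b i u) (Dd b (j - i) v))"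
    by (intro nlin_eqI[OF nl1(1) nl2(1)])
  from fun_cong[OF this, of u] show ?thesis by simp
qed

lemma Dd_slstr:
  assumes "b \<in> Phi T" "slstr b m f" "k \<le> m"
  shows "Dd b j (f k) = (if k + j \<le> m then sc (of_nat ((k + j) choose j)) (f (k + j)) else 0)"
proof (rule sc_cancel[of "fact j"])
  show "sc (fact j) (Dd b j (f k)) = sc (fact j) (if k + j \<le> m then sc (of_nat ((k + j) choose j)) (f (k + j)) else 0)"
    using slstr_adp[OF assms(2,3), of j] by (simp add: Dd_fact[OF assms(1)])
qed simp

end

section \<open>Root elements as automorphisms\<close>

text \<open>Root elements over arbitrary commutative rings: identities are proved over the integers, where
  factorials cancel, and mapped to the field.\<close>
definition xm :: "ctype \<Rightarrow> (int list \<Rightarrow> int list \<Rightarrow> int) \<Rightarrow> int list \<Rightarrow> 'r::comm_ring_1 \<Rightarrow> 'r mat" where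
  "xm T N a t = mat (bdim T) (bdim T)
     (\<lambda>(r, c). \<Sum>k<bdim T. t ^ k * of_int (((adm T N a) ^\<^sub>m k) $$ (r, c) div fact k))"

lemma xr_eq_xm: "xr T N a t = xm T N a t"
  by (simp add: xr_def xm_def)

text \<open>The inverse parameter is a separate argument, so that the matrix also exists over the
  integers, where the values t = t' = +-1 are needed.\<close>

definition nm :: "ctype \<Rightarrow> (int list \<Rightarrow> int list \<Rightarrow> int) \<Rightarrow> int list \<Rightarrow> 'r::comm_ring_1 \<Rightarrow> 'r \<Rightarrow> 'r mat" where
  "nm T N a t t' = xm T N a t * xm T N (vneg a) (- t') * xm T N a t"

lemma nr_eq_nm: "nr T N a t = nm T N a t (inverse t)"
  by (simp add: nr_def nm_def xr_eq_xm)

lemma xm_carrier [simp]: "xm T N a t \<in> carrier_mat (bdim T) (bdim T)"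
  by (simp add: xm_def)

lemma nm_carrier [simp]: "nm T N a t t' \<in> carrier_mat (bdim T) (bdim T)"
  unfolding nm_def by (intro mult_carrier_mat[of _ "bdim T" "bdim T"] xm_carrier)

lemma map_xm: "map_mat of_int (xm T N a t) = xm T N a (of_int t)"
  by (rule eq_matI) (auto simp: xm_def)

lemma map_nm: "map_mat of_int (nm T N a t t') = (nm T N a (of_int t) (of_int t') :: 'b::comm_ring_1 mat)"
proof -
  have "map_mat of_int (A * B) = (map_mat of_int A * map_mat of_int B :: 'b mat)"
    if "A \<in> carrier_mat (bdim T) (bdim T)" "B \<in> carrier_mat (bdim T) (bdim T)" for A B
    by (rule of_int_hom.mat_hom_mult[OF that])
  note this[simp]
  show ?thesis unfolding nm_def
    by (simp add: map_xm mult_carrier_mat[of _ "bdim T" "bdim T"])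
qed

definition mv :: "nat \<Rightarrow> 'r::comm_ring_1 mat \<Rightarrow> (nat \<Rightarrow> 'r) \<Rightarrow> nat \<Rightarrow> 'r" where
  "mv n A v = (\<lambda>r. if r < n then \<Sum>c<n. A $$ (r, c) * v c else v r)"

lemma mv_mult:
  assumes "A \<in> carrier_mat n n" "B \<in> carrier_mat n n"
  shows "mv n (A * B) v = mv n A (mv n B v)"
proof
  fix r
  show "mv n (A * B) v r = mv n A (mv n B v) r"
  proof (cases "r < n")
    case True
    have "(\<Sum>c<n. (A * B) $$ (r, c) * v c) = (\<Sum>c<n. \<Sum>d<n. A $$ (r, d) * B $$ (d, c) * v c)"
      using assms True by (intro sum.cong refl) (auto simp: scalar_prod_def sum_distrib_right atLeast0LessThan)
    also have "\<dots> = (\<Sum>d<n. \<Sum>c<n. A $$ (r, d) * B $$ (d, c) * v c)" by (rule sum.swap)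
    also have "\<dots> = (\<Sum>d<n. A $$ (r, d) * (\<Sum>c<n. B $$ (d, c) * v c))"
      by (simp add: sum_distrib_left mult.assoc)
    finally show ?thesis using True by (simp add: mv_def)
  qed (simp add: mv_def)
qed

lemma mv_one [simp]: "mv n (1\<^sub>m n) v = v"
proof
  fix r
  have "(\<Sum>c<n. 1\<^sub>m n $$ (r, c) * v c) = (\<Sum>c<n. uv r c * v c)" if "r < n"
    using that by (intro sum.cong refl) (auto simp: uv_apply)
  then show "mv n (1\<^sub>m n) v r = v r" by (simp add: mv_def)
qed

lemma mv_uv: "r < n \<Longrightarrow> c < n \<Longrightarrow> mv n A (uv c) r = A $$ (r, c)"
  by (simp add: mv_def)

lemma mat_eqI_mv:
  assumes "A \<in> carrier_mat n n" "B \<in> carrier_mat n n" "\<And>c. c < n \<Longrightarrow> mv n A (uv c) = mv n B (uv c)"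
  shows "A = B"
proof (rule eq_matI)
  fix i j assume "i < dim_row B" "j < dim_col B"
  then have "i < n" "j < n" using assms by auto
  then show "A $$ (i, j) = B $$ (i, j)" using assms(3) mv_uv by metis
qed (use assms in auto)

lemma vlin_mv: "vlin (mv n A)"
  by (auto simp: vlin_def mv_def fun_eq_iff vec_apply algebra_simps sum.distrib sum_distrib_left)

lemma tlin_mv: "tlin n (mv n A)"
  by (auto simp: tlin_def mv_def ac_simps)

lemmas mv_add = vlin_add[OF vlin_mv] and mv_sc = vlin_sc[OF vlin_mv] and mv_zero [simp] = vlin_zero[OF vlin_mv]
  and mv_sum = vlin_sum[OF vlin_mv]

lemma mv_emb: "A \<in> carrier_mat n n \<Longrightarrow> mv n (map_mat of_int A) (emb v) = emb (mv n A v)"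
  by (auto simp: mv_def emb_def fun_eq_iff)

text \<open>Cauchy product of two polynomials of degree at most 3; it has degree at most 6.\<close>

lemma conv4:
  fixes f :: "nat \<Rightarrow> nat \<Rightarrow> 'b::comm_monoid_add"
  assumes "\<And>i j. i \<ge> 4 \<or> j \<ge> 4 \<Longrightarrow> f i j = 0"
  shows "(\<Sum>k<7. \<Sum>i\<le>k. f i (k - i)) = (\<Sum>i<4. \<Sum>j<4. f i j)"
proof -
  have f: "f i j = 0" if "i = 4 \<or> i = 5 \<or> i = 6 \<or> j = 4 \<or> j = 5 \<or> j = 6" for i j
    using that assms by auto
  have "(\<Sum>k<7. \<Sum>i\<le>k. f i (k - i)) = (\<Sum>k<Suc (Suc (Suc (Suc (Suc (Suc (Suc 0)))))). \<Sum>i\<le>k. f i (k - i))"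
    by (simp add: numeral_eq_Suc)
  also have "\<dots> = (\<Sum>i<4. \<Sum>j<4. f i j)"
    using f by (simp add: numeral_eq_Suc lessThan_Suc atMost_Suc add.assoc add.commute add.left_commute)
  finally show ?thesis .
qed

lemma sum_upto4: "(\<Sum>k<4::nat. f k) = f 0 + f 1 + f 2 + (f 3 :: 'b::comm_monoid_add)"
  by (simp add: numeral_eq_Suc lessThan_Suc add.assoc add.commute add.left_commute)

definition reflr :: "ctype \<Rightarrow> int list \<Rightarrow> int list \<Rightarrow> int list" where
  "reflr T b g = vadd g (vsmul (- cartan_int T g b) b)"

context chev begin

definition aut :: "'r::comm_ring_1 mat \<Rightarrow> bool" where
  "aut A \<longleftrightarrow> A \<in> carrier_mat n n \<and> (\<forall>u v. mv n A (B u v) = B (mv n A u) (mv n A v))"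

lemma aut_mult: "aut A \<Longrightarrow> aut A' \<Longrightarrow> aut (A * A')"
  unfolding aut_def by (auto simp: mv_mult intro: mult_carrier_mat)

lemma aut_one: "aut (1\<^sub>m n)"
  by (simp add: aut_def)

lemma aut_carrier: "aut A \<Longrightarrow> A \<in> carrier_mat n n"
  by (simp add: aut_def)

lemma B_outside: "m \<ge> n \<Longrightarrow> B u v m = 0"
  using br_support[of T N u v m] by (metis not_less)

lemma dker_outside: "j > 0 \<Longrightarrow> r \<ge> n \<Longrightarrow> dker b j r c = 0"
  by (cases j) (simp_all add: dker_def adp_Suc B_outside)

lemma adm_pow:
  assumes "b \<in> Phi T" "r < n" "c < n"
  shows "(adm T N b ^\<^sub>m k) $$ (r, c) = adp b k (uv c) r"
  using assms(2,3)
proof (induction k arbitrary: c)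
  case 0
  then show ?case by (simp add: adm_def uv_apply)
next
  case (Suc k)
  have car: "adm T N b \<in> carrier_mat n n" by (simp add: adm_def)
  have "(adm T N b ^\<^sub>m Suc k) $$ (r, c) = (\<Sum>d<n. (adm T N b ^\<^sub>m k) $$ (r, d) * adm T N b $$ (d, c))"
    using Suc.prems car pow_carrier_mat[OF car, of k] by (simp add: scalar_prod_def atLeast0LessThan)
  also have "\<dots> = (\<Sum>d<n. B (E b) (uv c) d * adp b k (uv d) r)"
    using Suc assms(1) by (intro sum.cong refl) (simp add: adm_def br_uv)
  also have "\<dots> = adp b k (B (E b) (uv c)) r"
  proof -
    have "tlin n (adp b k)"
    proof (cases k)
      case 0
      then have "adp b k = (\<lambda>v. v)" by (auto simp: fun_eq_iff)
      then show ?thesis by (simp add: tlin_id)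
    next
      case (Suc i) then show ?thesis using nlin_tlin[OF nlin_adp] by blast
    qed
    from this Suc.prems(1) show ?thesis by (rule tlin_expand[symmetric])
  qed
  also have "\<dots> = adp b (Suc k) (uv c) r"
    using adp_add[of b k 1 "uv c"] by (simp add: adp_Suc)
  finally show ?case .
qed

lemma mv_xm:
  fixes v :: "nat \<Rightarrow> 'b::comm_ring_1"
  assumes "b \<in> Phi T"
  shows "mv n (xm T N b t) v = (\<Sum>k<4. sc (t ^ k) (Dd b k v))"
proof
  fix r
  show "mv n (xm T N b t) v r = (\<Sum>k<4. sc (t ^ k) (Dd b k v)) r"
  proof (cases "r < n")
    case True
    have dk: "Dd b k v r = (\<Sum>c<n. v c * of_int (dker b k r c))" for k
    proof (cases "k = 0")
      case True
      have "(\<Sum>c<n. v c * of_int (dker b 0 r c)) = (\<Sum>c<n. v c * uv r c)"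
        by (intro sum.cong refl) (simp add: dker_def uv_apply)
      with True \<open>r < n\<close> show ?thesis by simp
    qed (simp add: Dd_def)
    have "mv n (xm T N b t) v r = (\<Sum>c<n. (\<Sum>k<n. t ^ k * of_int (dker b k r c)) * v c)"
      using True assms by (auto simp: mv_def xm_def adm_pow dker_def intro!: sum.cong)
    also have "\<dots> = (\<Sum>c<n. \<Sum>k<n. t ^ k * (v c * of_int (dker b k r c)))"
      by (simp add: sum_distrib_right sum_distrib_left ac_simps)
    also have "\<dots> = (\<Sum>k<n. \<Sum>c<n. t ^ k * (v c * of_int (dker b k r c)))" by (rule sum.swap)
    also have "\<dots> = (\<Sum>k<n. t ^ k * Dd b k v r)" by (simp add: dk sum_distrib_left)
    also have "\<dots> = (\<Sum>k<4. t ^ k * Dd b k v r)"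
    proof (rule sum.mono_neutral_right)
      show "{..<4} \<subseteq> {..<n}" using four_less_bdim[of T] by auto
      show "\<forall>i\<in>{..<n} - {..<4}. t ^ i * Dd b i v r = 0"
        by (auto simp: zero_fun_apply Dd_zero4[OF assms])
    qed simp
    finally show ?thesis by (simp add: sum_fun_apply sc_apply)
  next
    case False
    have "k > 0 \<Longrightarrow> Dd b k v r = 0" for k
      using False by (simp add: Dd_def dker_outside)
    then show ?thesis using False by (simp add: mv_def sum_upto4 vec_apply)
  qed
qed

lemma aut_xm:
  assumes "b \<in> Phi T" shows "aut (xm T N b (t::'b::comm_ring_1))"
  unfolding aut_def
proof (intro conjI allI)
  fix u v :: "nat \<Rightarrow> 'b"
  have "mv n (xm T N b t) (B u v) = (\<Sum>k<7. sc (t ^ k) (Dd b k (B u v)))"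
    unfolding mv_xm[OF assms]
    by (rule sum.mono_neutral_left) (auto simp: Dd_zero4[OF assms])
  also have "\<dots> = (\<Sum>k<7. \<Sum>i\<le>k. B (sc (t ^ i) (Dd b i u)) (sc (t ^ (k - i)) (Dd b (k - i) v)))"
    by (intro sum.cong refl) (simp add: Dd_B[OF assms] sc_sum br_sc_left br_sc_right flip: power_add)
  also have "\<dots> = (\<Sum>i<4. \<Sum>j<4. B (sc (t ^ i) (Dd b i u)) (sc (t ^ j) (Dd b j v)))"
    by (rule conv4) (auto simp: Dd_zero4[OF assms])
  also have "\<dots> = B (mv n (xm T N b t) u) (mv n (xm T N b t) v)"
    unfolding mv_xm[OF assms]
    by (simp add: vlin_sum[OF nlin_vlin[OF nlin_br_left]] vlin_sum[OF nlin_vlin[OF nlin_br_right]]) (rule sum.swap)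
  finally show "mv n (xm T N b t) (B u v) = B (mv n (xm T N b t) u) (mv n (xm T N b t) v)" .
qed simp

lemma xm_inverse:
  assumes "b \<in> Phi T" shows "xm T N b t * xm T N b (- t :: 'b::comm_ring_1) = 1\<^sub>m n"
proof (rule mat_eqI_mv)
  fix c
  let ?v = "uv c :: nat \<Rightarrow> 'b"
  have "mv n (xm T N b t * xm T N b (- t)) ?v = (\<Sum>i<4. \<Sum>j<4. sc (t ^ i * (- t) ^ j) (Dd b i (Dd b j ?v)))"
    by (simp add: mv_mult[OF xm_carrier xm_carrier] mv_xm[OF assms] vlin_sum[OF vlin_Dd] vlin_sc[OF vlin_Dd] sc_sum)
  also have "\<dots> = (\<Sum>k<7. \<Sum>i\<le>k. sc (t ^ i * (- t) ^ (k - i)) (Dd b i (Dd b (k - i) ?v)))"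
    by (rule conv4[symmetric]) (auto simp: Dd_zero4[OF assms] vlin_zero[OF vlin_Dd])
  also have "\<dots> = (\<Sum>k<7::nat. if k = 0 then ?v else 0)"
  proof (intro sum.cong refl)
    fix k
    have "(\<Sum>i\<le>k. sc (t ^ i * (- t) ^ (k - i)) (Dd b i (Dd b (k - i) ?v)))
      = (\<Sum>i\<le>k. sc (of_nat (k choose i) * t ^ i * (- t) ^ (k - i)) (Dd b k ?v))"
      by (intro sum.cong refl) (simp add: Dd_comp[OF assms] ac_simps)
    also have "\<dots> = sc ((t + - t) ^ k) (Dd b k ?v)"
      unfolding binomial_ring[of t "- t" k] by (auto simp: fun_eq_iff sum_fun_apply sc_apply sum_distrib_right)
    finally show "(\<Sum>i\<le>k. sc (t ^ i * (- t) ^ (k - i)) (Dd b i (Dd b (k - i) ?v))) = (if k = 0 then ?v else 0)"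
      by (simp add: power_0_left)
  qed
  also have "\<dots> = mv n (1\<^sub>m n) ?v" by simp
  finally show "mv n (xm T N b t * xm T N b (- t)) ?v = mv n (1\<^sub>m n) ?v" .
qed (simp_all add: mult_carrier_mat[of _ n n])

lemma xm_zero: assumes "b \<in> Phi T" shows "xm T N b (0::'b::comm_ring_1) = 1\<^sub>m n"
  by (rule mat_eqI_mv[of _ n]) (simp_all add: mv_xm[OF assms] sum_upto4)

lemma mat_assoc: "A \<in> carrier_mat n n \<Longrightarrow> A' \<in> carrier_mat n n \<Longrightarrow> C \<in> carrier_mat n n \<Longrightarrow> A * A' * C = A * (A' * C)"
  by (rule assoc_mult_mat)

lemma nm_inverse:
  assumes "b \<in> Phi T" shows "nm T N b t t' * nm T N b (- t) (- t' :: 'b::comm_ring_1) = 1\<^sub>m n"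
proof (rule mat_eqI_mv)
  fix c
  have x: "mv n (xm T N a s) (mv n (xm T N a (- s)) v) = v" if "a \<in> Phi T" for a s and v :: "nat \<Rightarrow> 'b"
    using xm_inverse[OF that, of s] by (simp flip: mv_mult[OF xm_carrier xm_carrier])
  have "vneg b \<in> Phi T" using assms by simp
  note x = x[OF assms] x[OF this, of "- t'", simplified]
  show "mv n (nm T N b t t' * nm T N b (- t) (- t')) (uv c) = mv n (1\<^sub>m n) (uv c :: nat \<Rightarrow> 'b)"
    by (simp add: nm_def mv_mult[of _ n] mult_carrier_mat[of _ n n] x)
qed (simp_all add: mult_carrier_mat[of _ n n])

lemma aut_nm: "b \<in> Phi T \<Longrightarrow> aut (nm T N b t t')"
  unfolding nm_def by (intro aut_mult aut_xm) auto

lemma slstr_rev: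
  assumes "slstr b m f" shows "slstr (vneg b) m (\<lambda>k. f (m - k))"
proof -
  have up: "B (E (vneg b)) (f (m - k)) = sc (int (k + 1)) (f (m - (k + 1)))" if "k < m" for k
  proof -
    have "m - (k + 1) < m" "m - (k + 1) + 1 = m - k" "m - (m - (k + 1)) = k + 1" using that by auto
    then show ?thesis using assms unfolding slstr_def by metis
  qed
  have down: "B (E (vneg (vneg b))) (f (m - (k + 1))) = sc (int (m - k)) (f (m - k))" if "k < m" for k
  proof -
    have "m - (k + 1) < m" "m - (k + 1) + 1 = m - k" using that by auto
    then show ?thesis using assms unfolding slstr_def by (metis vneg_vneg)
  qed
  show ?thesis using assms up down unfolding slstr_def by simp
qed


lemma mv_xm_slstr:
  assumes "b \<in> Phi T" "slstr b m f" "k \<le> m"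
  shows "mv n (xm T N b t) (emb (f k)) =
    (\<Sum>j<4. if k + j \<le> m then sc (t ^ j * of_nat ((k + j) choose j)) (emb (f (k + j)) :: nat \<Rightarrow> 'b::comm_ring_1) else 0)"
  by (simp add: mv_xm[OF assms(1)] Dd_emb Dd_slstr[OF assms] if_distrib[of emb] if_distrib[of "sc _"] cong: if_cong)

lemma mv_xm_slstr_down:
  assumes "b \<in> Phi T" "slstr b m f" "k \<le> m"
  shows "mv n (xm T N (vneg b) t) (emb (f k)) =
    (\<Sum>j<4. if j \<le> k then sc (t ^ j * of_nat ((m - k + j) choose j)) (emb (f (k - j)) :: nat \<Rightarrow> 'b::comm_ring_1) else 0)"
proof -
  have "mv n (xm T N (vneg b) t) (emb (f (m - (m - k)))) =
    (\<Sum>j<4. if m - k + j \<le> m then sc (t ^ j * of_nat ((m - k + j) choose j)) (emb (f (m - (m - k + j))) :: nat \<Rightarrow> 'b) else 0)"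
    using mv_xm_slstr[OF vneg_Phi[OF assms(1)] slstr_rev[OF assms(2)], of "m - k" t] by simp
  also have "\<dots> = (\<Sum>j<4. if j \<le> k then sc (t ^ j * of_nat ((m - k + j) choose j)) (emb (f (k - j)) :: nat \<Rightarrow> 'b) else 0)"
    using assms(3) by (intro sum.cong refl) (auto simp: diff_diff_eq[symmetric])
  finally show ?thesis using assms(3) by simp
qed

text \<open>A string is an integral form of the representation of SL_2 of dimension m + 1, on which
  \<open>nm\<close> reverses the weights. Since m is at most 3, the ten pairs (m, k) are simply
  computed.\<close>

lemma mv_nm_slstr:
  assumes "b \<in> Phi T" "slstr b m f" "k \<le> m" "t * t' = 1"
  shows "mv n (nm T N b t t') (emb (f k)) =
    sc ((- 1) ^ k * t ^ (m - k) * t' ^ k) (emb (f (m - k)) :: nat \<Rightarrow> 'b::comm_ring_1)"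
proof -
  have r1: "t' * t = 1" using assms(4) by (simp add: mult.commute)
  have r2: "t * (t' * x) = x" "t' * (t * x) = x" for x
    using assms(4) r1 by (simp_all flip: mult.assoc)
  note up = mv_xm_slstr[OF assms(1,2), where t = t] and down = mv_xm_slstr_down[OF assms(1,2), where t = "- t'"]
  have exp: "mv n (nm T N b t t') v = mv n (xm T N b t) (mv n (xm T N (vneg b) (- t')) (mv n (xm T N b t) v))" for v :: "nat \<Rightarrow> 'b"
    unfolding nm_def by (simp add: mv_mult[of _ n] mult_carrier_mat[of _ n n])
  have "m \<le> 3" using assms(2) by (simp add: slstr_def)
  then have "m = 0 \<or> m = 1 \<or> m = 2 \<or> m = 3" by auto
  moreover have "k = 0 \<or> k = 1 \<or> k = 2 \<or> k = 3" using assms(3) \<open>m \<le> 3\<close> by auto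
  moreover have bin: "(2::nat) choose 2 = 1" "(3::nat) choose 2 = 3" "(3::nat) choose 3 = 1" "(2::nat) choose Suc 0 = 2" "(3::nat) choose Suc 0 = 3"
    by (simp_all add: numeral_eq_Suc)
  ultimately show ?thesis using assms(3)
    by (elim disjE; simp add: exp up down sum_upto4 mv_add mv_sc bin numeral_3_eq_3[symmetric] numeral_2_eq_2[symmetric])
       (simp_all add: fun_eq_iff vec_apply algebra_simps power2_eq_square power3_eq_cube assms(4) r1 r2)
qed

end

section \<open>Weyl group representatives\<close>

lemma emb_minus: "emb (- v) = - emb v"
  by (simp add: emb_def fun_eq_iff vec_apply)

lemma reflr_Phi:
  assumes "b \<in> Phi T" "g \<in> Phi T" shows "reflr T b g \<in> Phi T"
proof -
  let ?c = "cartan_int T g b"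
  have lg: "length b = rank T" "length g = rank T" using assms by (auto simp: Phi_length)
  have "ip T (reflr T b g) (reflr T b g) = ip T g g - ?c * (2 * ip T g b) + ?c * (?c * ip T b b)"
    using lg by (simp add: reflr_def ip_lin ip_sym[of b T g] algebra_simps)
  also have "\<dots> = ip T g g" using cartan_int_mult[OF assms(1) lg(2)] by simp
  finally show ?thesis using assms(2) lg by (simp add: Phi_iff reflr_def)
qed

section \<open>Monoids generated by sets of matrices\<close>

lemma gen_by_carrier: "X \<subseteq> carrier_mat d d \<Longrightarrow> g \<in> gen_by d X \<Longrightarrow> g \<in> carrier_mat d d"
  by (rotate_tac, induction rule: gen_by.induct) (auto intro!: mult_carrier_mat)

lemma gen_by_mult:
  assumes "X \<subseteq> carrier_mat d d" "g \<in> gen_by d X" "h \<in> gen_by d X"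
  shows "g * h \<in> gen_by d X"
  using assms(2)
proof (induction rule: gen_by.induct)
  case one
  then show ?case using assms(3) gen_by_carrier[OF assms(1,3)] by simp
next
  case (step g x)
  have "x * g * h = x * (g * h)"
    using step assms(1) gen_by_carrier[OF assms(1)] assms(3) by (intro assoc_mult_mat) auto
  then show ?case using gen_by.step[OF step.IH step.hyps(2)] by simp
qed

lemma gen_by_base: "X \<subseteq> carrier_mat d d \<Longrightarrow> x \<in> X \<Longrightarrow> x \<in> gen_by d X"
  using gen_by.step[OF gen_by.one, of x X d] by auto

lemma gen_by_mono:
  assumes "Y \<subseteq> carrier_mat d d" "X \<subseteq> gen_by d Y" shows "gen_by d X \<subseteq> gen_by d Y"
proof
  fix g assume "g \<in> gen_by d X"
  then show "g \<in> gen_by d Y"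
    by (induction rule: gen_by.induct) (use assms gen_by_mult[OF assms(1)] gen_by.one in auto)
qed

lemma gen_by_inverse:
  assumes "X \<subseteq> carrier_mat d d" "\<And>x. x \<in> X \<Longrightarrow> \<exists>y\<in>gen_by d X. x * y = 1\<^sub>m d \<and> y * x = 1\<^sub>m d"
    "g \<in> gen_by d X"
  shows "\<exists>h\<in>gen_by d X. g * h = 1\<^sub>m d \<and> h * g = 1\<^sub>m d"
  using assms(3)
proof (induction rule: gen_by.induct)
  case one
  then show ?case by (auto intro!: bexI[of _ "1\<^sub>m d"] gen_by.one)
next
  case (step g x)
  then obtain h where h: "h \<in> gen_by d X" "g * h = 1\<^sub>m d" "h * g = 1\<^sub>m d" by blast
  obtain y where y: "y \<in> gen_by d X" "x * y = 1\<^sub>m d" "y * x = 1\<^sub>m d" using assms(2) step by blast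
  note c [simp] = gen_by_carrier[OF assms(1)]
  have car: "x \<in> carrier_mat d d" "y \<in> carrier_mat d d" "g \<in> carrier_mat d d" "h \<in> carrier_mat d d"
    using step assms(1) h y by auto
  have "x * g * (h * y) = x * (g * h) * y"
    using car by (simp add: assoc_mult_mat[of _ d d _ d _ d])
  moreover have "h * y * (x * g) = h * (y * x) * g"
    using car by (simp add: assoc_mult_mat[of _ d d _ d _ d])
  ultimately show ?case
    using h y car gen_by_mult[OF assms(1) h(1) y(1)] by (intro bexI[of _ "h * y"]) auto
qed

section \<open>Positive roots and induction along simple roots\<close>

definition nonneg_vec :: "int list \<Rightarrow> bool" where
  "nonneg_vec g \<longleftrightarrow> list_all (\<lambda>c. 0 \<le> c) g"

lemma sroot_F4 [simp]: "sroot F4 0 = [1,0,0,0]" "sroot F4 (Suc 0) = [0,1,0,0]" "sroot F4 2 = [0,0,1,0]" "sroot F4 3 = [0,0,0,1]"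
  by (simp_all add: sroot_def numeral_eq_Suc)

lemma sroot_G2 [simp]: "sroot G2 0 = [1,0]" "sroot G2 (Suc 0) = [0,1]"
  by (simp_all add: sroot_def numeral_eq_Suc)

lemma less_four: "(i::nat) < 4 \<longleftrightarrow> i = 0 \<or> i = Suc 0 \<or> i = 2 \<or> i = 3"
  by auto

lemma less_two: "(i::nat) < 2 \<longleftrightarrow> i = 0 \<or> i = Suc 0"
  by auto

lemma pos_or_neg_root: "g \<in> Phi T \<Longrightarrow> nonneg_vec g \<or> nonneg_vec (vneg g)"
proof -
  have "\<forall>g\<in>set (root_enum T). nonneg_vec g \<or> nonneg_vec (vneg g)"
    by (cases T) (simp_all add: root_enum_def nonneg_vec_def)
  then show "g \<in> Phi T \<Longrightarrow> nonneg_vec g \<or> nonneg_vec (vneg g)" by (simp add: Phi_eq)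
qed

lemma pos_root_step:
  assumes "g \<in> Phi T" "nonneg_vec g"
  shows "\<exists>i<rank T. g = sroot T i \<or> (vadd g (vneg (sroot T i)) \<in> Phi T \<and> nonneg_vec (vadd g (vneg (sroot T i))))"
proof -
  have "\<forall>g\<in>set (root_enum F4). nonneg_vec g \<longrightarrow> (let P = (\<lambda>a. g = a \<or> (vadd g (vneg a) \<in> Phi F4 \<and> nonneg_vec (vadd g (vneg a))))
      in P [1,0,0,0] \<or> P [0,1,0,0] \<or> P [0,0,1,0] \<or> P [0,0,0,1])"
    by (simp add: root_enum_def nonneg_vec_def Phi_iff ip_F4)
  moreover have "\<forall>g\<in>set (root_enum G2). nonneg_vec g \<longrightarrow> (let P = (\<lambda>a. g = a \<or> (vadd g (vneg a) \<in> Phi G2 \<and> nonneg_vec (vadd g (vneg a))))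
      in P [1,0] \<or> P [0,1])"
    by (simp add: root_enum_def nonneg_vec_def Phi_iff ip_G2)
  ultimately show ?thesis using assms unfolding Phi_eq[symmetric]
    by (cases T) (simp_all only: rank_simps less_four less_two Let_def, (metis sroot_F4 sroot_G2)+)
qed

lemma sum_list_vadd_neg_sroot:
  assumes "length g = rank T" "i < rank T"
  shows "sum_list (vadd g (vneg (sroot T i))) = sum_list g - 1"
  using assms(1)
proof (cases rule: length_rankE)
  case 1
  then have "i = 0 \<or> i = Suc 0 \<or> i = 2 \<or> i = 3" using assms(2) by (simp add: less_four)
  then show ?thesis unfolding 1 by (elim disjE) simp_all
next
  case 2
  then have "i = 0 \<or> i = Suc 0" using assms(2) by (simp add: less_two)
  then show ?thesis unfolding 2 by (elim disjE) simp_all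
qed

lemma nonneg_vec_sum_list: "nonneg_vec g \<Longrightarrow> sum_list g \<ge> 0"
  unfolding nonneg_vec_def by (rule sum_list_nonneg) (auto simp: list_all_iff)

lemma root_induct [consumes 1, case_names simple add neg]:
  assumes "g \<in> Phi T"
    and "\<And>i. i < rank T \<Longrightarrow> P (sroot T i)"
    and "\<And>g i. g \<in> Phi T \<Longrightarrow> i < rank T \<Longrightarrow> vadd g (sroot T i) \<in> Phi T \<Longrightarrow> P g \<Longrightarrow> P (vadd g (sroot T i))"
    and "\<And>g. g \<in> Phi T \<Longrightarrow> P g \<Longrightarrow> P (vneg g)"
  shows "P g"
proof -
  have pos: "P g" if "g \<in> Phi T" "nonneg_vec g" for g
    using that
  proof (induction "nat (sum_list g)" arbitrary: g rule: less_induct)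
    case less
    from pos_root_step[OF less.prems] obtain i where i: "i < rank T"
      "g = sroot T i \<or> (vadd g (vneg (sroot T i)) \<in> Phi T \<and> nonneg_vec (vadd g (vneg (sroot T i))))" by blast
    show ?case
    proof (cases "g = sroot T i")
      case True then show ?thesis using assms(2) i by simp
    next
      case False
      let ?h = "vadd g (vneg (sroot T i))"
      have h: "?h \<in> Phi T" "nonneg_vec ?h" using i False by auto
      have "sum_list ?h = sum_list g - 1" using less.prems i by (simp add: sum_list_vadd_neg_sroot Phi_length)
      then have "nat (sum_list ?h) < nat (sum_list g)" using nonneg_vec_sum_list[OF h(2)] by linarith
      then have "P ?h" using less.hyps h by blast
      moreover have "vadd ?h (sroot T i) = g"
        using less.prems by (auto simp: list_eq_iff_nth_eq Phi_length)
      ultimately show ?thesis using assms(3)[of ?h i] h i less.prems by simp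
    qed
  qed
  show ?thesis
  proof (cases "nonneg_vec g")
    case False
    then have "P (vneg g)" using pos_or_neg_root[OF assms(1)] pos assms(1) by auto
    then show ?thesis using assms(4)[of "vneg g"] assms(1) by simp
  qed (use pos assms(1) in blast)
qed

lemma sroot_cartan_F4:
  "cartan_int F4 v [1,0,0,0] = (2 * ip F4 v [1,0,0,0]) div 4" "cartan_int F4 v [0,1,0,0] = (2 * ip F4 v [0,1,0,0]) div 4"
  "cartan_int F4 v [0,0,1,0] = ip F4 v [0,0,1,0]" "cartan_int F4 v [0,0,0,1] = ip F4 v [0,0,0,1]"
  by (simp_all add: cartan_int_def ip_F4)

lemma sroot_cartan_G2:
  "cartan_int G2 v [1,0] = ip G2 v [1,0]" "cartan_int G2 v [0,1] = (2 * ip G2 v [0,1]) div 6"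
  by (simp_all add: cartan_int_def ip_G2)

text \<open>The Cartan matrices of F4 and G2 are invertible modulo 2.\<close>
lemma cartan_sign_solve:
  fixes e :: "nat \<Rightarrow> int"
  assumes "\<And>i. e i = 1 \<or> e i = - 1"
  shows "\<exists>s. (\<forall>i. s i = 1 \<or> s i = - 1) \<and>
    (\<forall>j<rank T. (\<Prod>i<rank T. s i ^ nat \<bar>cartan_int T (sroot T j) (sroot T i)\<bar>) = e j)"
proof (cases T)
  case F4
  \<comment> \<open>Modulo 2 the equations read s1 = e0, s0 = e1, s1 s3 = e2, s2 = e3; the double
    bond contributes an even exponent in one direction.\<close>
  define s where "s i = (if i = 0 then e 1 else if i = 1 then e 0 else if i = 2 then e 3 else e 2 * e 0)" for i :: nat
  have sq: "e i ^ 2 = 1" "e i * (e i * x) = x" for i x using assms[of i] by (auto simp: power2_eq_square)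
  have "s i = 1 \<or> s i = - 1" for i using assms[of 0] assms[of 1] assms[of 2] assms[of 3] by (auto simp: s_def)
  moreover have "\<forall>j<rank F4. (\<Prod>i<rank F4. s i ^ nat \<bar>cartan_int F4 (sroot F4 j) (sroot F4 i)\<bar>) = e j"
  proof -
    have p: "(\<Prod>i<4::nat. f i) = f 0 * f 1 * f 2 * f 3" for f :: "nat \<Rightarrow> int"
      by (simp add: numeral_eq_Suc lessThan_Suc ac_simps)
    show ?thesis unfolding rank_simps p less_four
      by (auto simp: sroot_cartan_F4 ip_F4 s_def power_mult_distrib sq ac_simps)
  qed
  ultimately show ?thesis using F4 by blast
next
  case G2
  define s where "s i = (if i = 0 then e 1 else e 0)" for i :: nat
  have sq: "e i ^ 2 = 1" "e i ^ 3 = e i" for i using assms[of i] by auto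
  have "s i = 1 \<or> s i = - 1" for i using assms[of 0] assms[of 1] by (auto simp: s_def)
  moreover have "\<forall>j<rank G2. (\<Prod>i<rank G2. s i ^ nat \<bar>cartan_int G2 (sroot G2 j) (sroot G2 i)\<bar>) = e j"
  proof -
    have p: "(\<Prod>i<2::nat. f i) = f 0 * f 1" for f :: "nat \<Rightarrow> int"
      by (simp add: numeral_eq_Suc lessThan_Suc ac_simps)
    show ?thesis unfolding rank_simps p less_two
      by (auto simp: sroot_cartan_G2 ip_G2 s_def sq)
  qed
  ultimately show ?thesis using G2 by blast
qed

context chev begin

lemma nm_root:
  assumes "b \<in> Phi T" "g \<in> Phi T"
  obtains \<epsilon> :: int and i m :: nat where "\<epsilon> = 1 \<or> \<epsilon> = - 1" "i \<le> m" "2 * int i - int m = cartan_int T g b"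
    "\<And>t t' :: 'b::comm_ring_1. t * t' = 1 \<Longrightarrow>
       mv n (nm T N b t t') (E g) = sc (of_int \<epsilon> * t ^ (m - i) * t' ^ i) (E (reflr T b g))"
proof -
  let ?f = "\<lambda>k::nat. if k = 0 then E (vneg b) else if k = 1 then Hc b else - E b :: nat \<Rightarrow> int"
  have lb: "length b = rank T" using assms by (simp add: Phi_length)
  have sl: "slstr b 2 ?f" by (rule slstr_Hc[OF assms(1)])
  consider "g = b" | "g = vneg b" | "g \<noteq> b" "g \<noteq> vneg b" by blast
  then show thesis
  proof cases
    case 1
    have r: "reflr T b g = vneg b" unfolding 1 reflr_def cartan_self[OF assms(1)] using lb
      by (auto simp: list_eq_iff_nth_eq)
    have e: "E g = sc (- 1) (emb (?f 2) :: nat \<Rightarrow> 'b)" using 1 by (simp add: emb_minus sc_minus1)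
    show thesis
    proof (rule that[of "- 1" 2 2])
      fix t t' :: 'b assume "t * t' = 1"
      from mv_nm_slstr[OF assms(1) sl order.refl this]
      show "mv n (nm T N b t t') (E g) = sc (of_int (- 1) * t ^ (2 - 2) * t' ^ 2) (E (reflr T b g))"
        unfolding e r mv_sc by simp
    qed (use 1 cartan_self[OF assms(1)] in auto)
  next
    case 2
    have c: "cartan_int T g b = - 2" using 2 cartan_neg[OF assms(1) lb] cartan_self[OF assms(1)] by simp
    have r: "reflr T b g = b" using 2 lb c by (auto simp: reflr_def list_eq_iff_nth_eq)
    have e: "E g = (emb (?f 0) :: nat \<Rightarrow> 'b)" using 2 by simp
    show thesis
    proof (rule that[of "- 1" 0 2])
      fix t t' :: 'b assume "t * t' = 1"
      from mv_nm_slstr[OF assms(1) sl _ this, of 0]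
      show "mv n (nm T N b t t') (E g) = sc (of_int (- 1) * t ^ (2 - 0) * t' ^ 0) (E (reflr T b g))"
        unfolding e r by (simp add: emb_minus sc_minus sc_minus_right)
    qed (use c in auto)
  next
    case 3
    obtain i m s where im: "i \<le> m" "slstr b m (\<lambda>k. sc (s k) (E (vadd g (vsmul (int k - int i) b))))"
      "\<And>k. s k = 1 \<or> s k = - 1" "2 * ip T g b = (2 * int i - int m) * ip T b b"
      by (rule slstr_root[OF assms 3]) blast
    let ?g = "\<lambda>k. sc (s k) (E (vadd g (vsmul (int k - int i) b))) :: nat \<Rightarrow> int"
    have c: "cartan_int T g b = 2 * int i - int m"
      using im(4) assms by (intro cartan_int_eqI) (auto simp: Phi_length)
    have r: "vadd g (vsmul (int (m - i) - int i) b) = reflr T b g"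
      using im(1) by (simp add: reflr_def c of_nat_diff)
    have g: "vadd g (vsmul (int i - int i) b) = g" using assms by (auto simp: list_eq_iff_nth_eq Phi_length)
    have "s i * s i = 1" using im(3)[of i] by auto
    then have "(of_int (s i * s i) :: 'b) = 1" by simp
    then have e: "E g = sc (of_int (s i)) (emb (?g i) :: nat \<Rightarrow> 'b)" using g by simp
    show thesis
    proof (rule that[of "s i * s (m - i) * (- 1) ^ i" i m])
      show "s i * s (m - i) * (- 1) ^ i = 1 \<or> s i * s (m - i) * (- 1) ^ i = - 1"
        using im(3)[of i] im(3)[of "m - i"] by (cases "even i") auto
      fix t t' :: 'b assume "t * t' = 1"
      from mv_nm_slstr[OF assms(1) im(2,1) this]
      show "mv n (nm T N b t t') (E g) = sc (of_int (s i * s (m - i) * (- 1) ^ i) * t ^ (m - i) * t' ^ i) (E (reflr T b g))"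
        unfolding e mv_sc by (simp add: r ac_simps)
    qed (use im c in auto)
  qed
qed

lemma reflr_reflr: "b \<in> Phi T \<Longrightarrow> g \<in> Phi T \<Longrightarrow> reflr T b (reflr T b g) = g"
  and cartan_reflr: "b \<in> Phi T \<Longrightarrow> g \<in> Phi T \<Longrightarrow> cartan_int T (reflr T b g) b = - cartan_int T g b"
proof -
  assume a: "b \<in> Phi T" "g \<in> Phi T"
  have lg: "length b = rank T" "length g = rank T" using a by (auto simp: Phi_length)
  show c: "cartan_int T (reflr T b g) b = - cartan_int T g b"
    using a lg cartan_int_mult[OF a(1) lg(2)]
    by (intro cartan_int_eqI) (auto simp: reflr_def ip_lin algebra_simps)
  show "reflr T b (reflr T b g) = g"
    unfolding reflr_def[of T b "reflr T b g"] c using lg by (auto simp: reflr_def list_eq_iff_nth_eq)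
qed

lemma uv_Hc: "i < rank T \<Longrightarrow> (uv i :: nat \<Rightarrow> 'b::comm_ring_1) = Hc (sroot T i)"
proof
  fix k assume i: "i < rank T"
  have "coroot_coef T (sroot T i) k = (if k = i then 1 else 0)" if k: "k < rank T"
  proof -
    have p: "ip T (sroot T i) (sroot T i) \<noteq> 0" using root_norm_pos[OF sroot_Phi[OF i]] by simp
    have "sroot T i ! k = (if k = i then 1 else 0)" using i k by (simp add: sroot_def)
    then show ?thesis using coroot_coef_mult[OF sroot_Phi[OF i] k] p by (auto split: if_splits)
  qed
  then show "(uv i :: nat \<Rightarrow> 'b) k = Hc (sroot T i) k" using i by (auto simp: uv_apply Hc_def)
qed

lemma diag_fixes_h:
  assumes "aut A" "\<And>g. g \<in> Phi T \<Longrightarrow> mv n A (E g) = sc (\<chi> g) (E g :: nat \<Rightarrow> 'b::comm_ring_1)"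
    "\<And>g. g \<in> Phi T \<Longrightarrow> \<chi> g * \<chi> (vneg g) = 1" "i < rank T"
  shows "mv n A (uv i) = uv i"
proof -
  let ?a = "sroot T i"
  have a: "?a \<in> Phi T" using assms(4) by simp
  have "mv n A (Hc ?a) = B (mv n A (E ?a)) (mv n A (E (vneg ?a)))"
    using assms(1) unfolding aut_def B_opp[OF a, symmetric] by blast
  also have "\<dots> = sc (\<chi> ?a * \<chi> (vneg ?a)) (Hc ?a)"
    using a by (simp add: assms(2) br_sc_left br_sc_right B_opp mult.commute)
  finally show ?thesis unfolding uv_Hc[OF assms(4)] using assms(3)[OF a] by simp
qed

lemma diag_eq:
  assumes "aut A" "aut A'"
    "\<And>g. g \<in> Phi T \<Longrightarrow> mv n A (E g) = sc (\<chi> g) (E g :: nat \<Rightarrow> 'b::comm_ring_1)"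
    "\<And>g. g \<in> Phi T \<Longrightarrow> mv n A' (E g) = sc (\<chi> g) (E g)"
    "\<And>g. g \<in> Phi T \<Longrightarrow> \<chi> g * \<chi> (vneg g) = 1"
  shows "A = A'"
proof (rule mat_eqI_mv[OF aut_carrier[OF assms(1)] aut_carrier[OF assms(2)]])
  fix c assume "c < n"
  then show "mv n A (uv c) = mv n A' (uv c)"
  proof (cases rule: index_cases)
    case 1
    then show ?thesis using diag_fixes_h[OF assms(1,3,5)] diag_fixes_h[OF assms(2,4,5)] by simp
  qed (simp add: assms)
qed

end

section \<open>The torus\<close>

lemma cartan_int_vadd:
  assumes "a \<in> Phi T" "length u = rank T" "length v = rank T"
  shows "cartan_int T (vadd u v) a = cartan_int T u a + cartan_int T v a"
  using assms cartan_int_mult[OF assms(1,2)] cartan_int_mult[OF assms(1,3)]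
  by (intro cartan_int_eqI) (auto simp: ip_lin algebra_simps)

lemma cartan_int_vsmul:
  assumes "a \<in> Phi T" "length u = rank T"
  shows "cartan_int T (vsmul c u) a = c * cartan_int T u a"
  using assms cartan_int_mult[OF assms(1,2)]
  by (intro cartan_int_eqI) (auto simp: ip_lin algebra_simps)

lemma cartan_int_zv: "a \<in> Phi T \<Longrightarrow> cartan_int T (zv T) a = 0"
  by (intro cartan_int_eqI) (auto simp: ip_def)

lemma sign_powi: "s = 1 \<or> s = - 1 \<Longrightarrow> (of_int s :: 'a::field) powi c = of_int (s ^ nat \<bar>c\<bar>)"
  by (auto simp: power_int_def power_int_minus_one_minus split: if_splits)

lemma sign_power_add: "s = 1 \<or> s = - 1 \<Longrightarrow> (s::int) ^ nat \<bar>a + b\<bar> = s ^ nat \<bar>a\<bar> * s ^ nat \<bar>b\<bar>"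
  by (auto simp: minus_one_power_iff even_nat_iff)

context chev begin

lemma mat_one_left [simp]: "A \<in> carrier_mat n n \<Longrightarrow> 1\<^sub>m n * A = (A :: 'b::comm_ring_1 mat)"
  by (rule left_mult_one_mat)

lemma mat_one_right [simp]: "A \<in> carrier_mat n n \<Longrightarrow> A * 1\<^sub>m n = (A :: 'b::comm_ring_1 mat)"
  by (rule right_mult_one_mat)

lemma mat_closed [simp]: "A \<in> carrier_mat n n \<Longrightarrow> A' \<in> carrier_mat n n \<Longrightarrow> A * A' \<in> carrier_mat n n"
  by (rule mult_carrier_mat)

lemma xr_inverse: "b \<in> Phi T \<Longrightarrow> xr T N b t * xr T N b (- t) = 1\<^sub>m n" "b \<in> Phi T \<Longrightarrow> xr T N b (- t) * xr T N b t = 1\<^sub>m n"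
  using xm_inverse[of b t] xm_inverse[of b "- t"] by (simp_all add: xr_eq_xm)

lemma xr_carrier [simp]: "xr T N b t \<in> carrier_mat n n"
  by (simp add: xr_eq_xm)

lemma nr_carrier [simp]: "nr T N b t \<in> carrier_mat n n"
  by (simp add: nr_eq_nm)

lemma hr_carrier [simp]: "hr T N b t \<in> carrier_mat n n"
  by (simp add: hr_def mult_carrier_mat[of _ n n])

lemma aut_hr: "b \<in> Phi T \<Longrightarrow> aut (hr T N b t)"
  unfolding hr_def nr_eq_nm by (intro aut_mult aut_nm)

lemma hr_E:
  assumes "b \<in> Phi T" "g \<in> Phi T" "(t::'a::field) \<noteq> 0"
  shows "mv n (hr T N b t) (E g) = sc (t powi cartan_int T g b) (E g)"
proof -
  obtain \<epsilon> :: int and i m :: nat where 1: "\<epsilon> = 1 \<or> \<epsilon> = - 1" "i \<le> m" "2 * int i - int m = cartan_int T g b"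
    "\<And>t t' :: 'a. t * t' = 1 \<Longrightarrow>
       mv n (nm T N b t t') (E g) = sc (of_int \<epsilon> * t ^ (m - i) * t' ^ i) (E (reflr T b g))"
    by (rule nm_root[OF assms(1,2)]) blast
  obtain \<epsilon>' :: int and i' m' :: nat where 2: "\<epsilon>' = 1 \<or> \<epsilon>' = - 1" "i' \<le> m'"
    "2 * int i' - int m' = cartan_int T (reflr T b g) b"
    "\<And>t t' :: 'a. t * t' = 1 \<Longrightarrow>
       mv n (nm T N b t t') (E (reflr T b g)) = sc (of_int \<epsilon>' * t ^ (m' - i') * t' ^ i') (E (reflr T b (reflr T b g)))"
    by (rule nm_root[OF assms(1) reflr_Phi[OF assms(1,2)]]) blast
  have m1: "mv n (nr T N b (- 1)) (E g) = sc (of_int \<epsilon> * (- 1) ^ (m - i) * (- 1) ^ i) (E (reflr T b g) :: nat \<Rightarrow> 'a)"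
    unfolding nr_eq_nm using 1(4)[of "- 1" "- 1"] by (simp add: inverse_minus_eq)
  \<comment> \<open>The same product of signs occurs in n_b(1) n_b(-1) = 1, hence it equals 1. This
    removes the signs left open by \<open>nm_root\<close>.\<close>
  have "nm T N b 1 1 * nm T N b (- 1) (- 1) = (1\<^sub>m n :: 'a mat)"
    using nm_inverse[OF assms(1), of 1 1] by simp
  then have "E g = mv n (nm T N b 1 1) (mv n (nm T N b (- 1) (- 1)) (E g :: nat \<Rightarrow> 'a))"
    by (simp flip: mv_mult[OF nm_carrier nm_carrier])
  also have "\<dots> = sc (of_int \<epsilon> * (- 1) ^ (m - i) * (- 1) ^ i * of_int \<epsilon>') (E g)"
    using 1(4)[of "- 1" "- 1"] 2(4)[of 1 1] assms by (simp add: mv_sc reflr_reflr)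
  finally have "(E g (ix g) :: 'a) = sc (of_int \<epsilon> * (- 1) ^ (m - i) * (- 1) ^ i * of_int \<epsilon>') (E g) (ix g)" by simp
  then have e: "of_int \<epsilon> * (- 1) ^ (m - i) * (- 1) ^ i * of_int \<epsilon>' = (1::'a)" by (simp add: sc_apply)
  have "mv n (hr T N b t) (E g) = mv n (nr T N b t) (sc (of_int \<epsilon> * (- 1) ^ (m - i) * (- 1) ^ i) (E (reflr T b g)))"
    unfolding hr_def by (simp add: mv_mult[of _ n] m1)
  also have "\<dots> = sc (of_int \<epsilon> * (- 1) ^ (m - i) * (- 1) ^ i * of_int \<epsilon>' * (t ^ (m' - i') * inverse t ^ i')) (E g)"
    using 2(4)[of t "inverse t"] assms by (simp add: nr_eq_nm mv_sc reflr_reflr ac_simps)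
  also have "\<dots> = sc (t ^ (m' - i') * inverse t ^ i') (E g)" unfolding e by simp
  also have "t ^ (m' - i') * inverse t ^ i' = t powi (int (m' - i') - int i')"
    using assms(3) by (simp add: power_int_diff power_inverse field_simps)
  also have "int (m' - i') - int i' = cartan_int T g b"
    using 2(2,3) cartan_reflr[OF assms(1,2)] by simp
  finally show ?thesis .
qed

lemma powi_neg_mult: "(t::'a::field) \<noteq> 0 \<Longrightarrow> b \<in> Phi T \<Longrightarrow> g \<in> Phi T \<Longrightarrow>
    t powi cartan_int T g b * t powi cartan_int T (vneg g) b = 1"
  by (simp add: cartan_neg Phi_length power_int_minus)

lemma hr_uv:
  assumes "b \<in> Phi T" "(t::'a::field) \<noteq> 0" "i < rank T"
  shows "mv n (hr T N b t) (uv i) = uv i"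
  by (rule diag_fixes_h[OF aut_hr[OF assms(1)] hr_E[OF assms(1) _ assms(2)] powi_neg_mult[OF assms(2,1)] assms(3)])

lemma hr_inverse:
  assumes "b \<in> Phi T" "(t::'a::field) \<noteq> 0"
  shows "hr T N b t * hr T N b (inverse t) = 1\<^sub>m n"
proof (rule diag_eq[where \<chi> = "\<lambda>_. 1"])
  show "mv n (hr T N b t * hr T N b (inverse t)) (E g) = sc 1 (E g)" if "g \<in> Phi T" for g
    using that assms by (simp add: mv_mult[of _ n] hr_E mv_sc power_int_inverse field_simps)
qed (use assms in \<open>auto intro: aut_mult aut_hr aut_one\<close>)

lemma hr_uv_all:
  assumes "b \<in> Phi T" "(t::'a::field) \<noteq> 0" "c < n"
  shows "mv n (hr T N b t) (uv c) = sc (t powi cartan_int T (wt T c) b) (uv c)"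
  using assms(3) by (cases rule: index_cases) (use assms in \<open>auto simp: hr_uv hr_E cartan_int_zv\<close>)

lemma hr_entry:
  assumes "b \<in> Phi T" "(t::'a::field) \<noteq> 0" "r < n"
  shows "mv n (hr T N b t) v r = t powi cartan_int T (wt T r) b * v r"
proof -
  have "mv n (hr T N b t) v r = (\<Sum>c<n. v c * (t powi cartan_int T (wt T c) b * uv c r))"
    using assms by (subst tlin_expand[OF tlin_mv]) (auto simp: hr_uv_all sc_apply)
  also have "\<dots> = (\<Sum>c<n. (v c * t powi cartan_int T (wt T c) b) * uv r c)"
    by (intro sum.cong refl) (simp add: uv_apply)
  finally show ?thesis using assms(3) by simp
qed

lemma adp_weight: "c < n \<Longrightarrow> b \<in> Phi T \<Longrightarrow> adp b k (uv c) r \<noteq> 0 \<Longrightarrow> r < n \<and> wt T r = vadd (wt T c) (vsmul (int k) b)"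
proof (induction k arbitrary: r)
  case 0
  then have "r = c" by (auto simp: uv_apply split: if_splits)
  with 0 show ?case by (auto simp: list_eq_iff_nth_eq Phi_length)
next
  case (Suc k)
  from Suc.prems(3) have "B (E b) (adp b k (uv c)) r \<noteq> 0" by (simp add: adp_Suc)
  then obtain i j where ij: "i < n" "j < n" "(E b :: nat \<Rightarrow> int) i \<noteq> 0" "adp b k (uv c) j \<noteq> 0" "r < n"
    "wt T r = vadd (wt T i) (wt T j)" by (rule br_support)
  then have "i = ix b" by (auto simp: uv_apply split: if_splits)
  with ij Suc show ?case by (auto simp: list_eq_iff_nth_eq Phi_length algebra_simps)
qed

lemma Dd_weight:
  assumes "c < n" "b \<in> Phi T" "Dd b k (uv c) r \<noteq> 0"
  shows "r < n \<and> wt T r = vadd (wt T c) (vsmul (int k) b)"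
proof -
  have "Dd b k (uv c) = emb (Dd b k (uv c))" by (simp flip: Dd_emb)
  then have "Dd b k (uv c :: nat \<Rightarrow> int) r \<noteq> 0" using assms(3) by (metis emb_def of_int_0)
  then have "adp b k (uv c) r \<noteq> 0" unfolding Dd_fact[OF assms(2), symmetric] by (simp add: sc_apply)
  then show ?thesis using adp_weight assms by blast
qed

lemma hr_xr_conj:
  assumes "g \<in> Phi T" "(s::'a::field) \<noteq> 0" "b \<in> Phi T"
  shows "hr T N g s * xr T N b t = xr T N b (s powi cartan_int T b g * t) * hr T N g s"
proof (rule mat_eqI_mv[of _ n])
  fix c assume c: "c < n"
  let ?u = "s powi cartan_int T b g"
  have D: "mv n (hr T N g s) (Dd b k (uv c)) = sc (?u ^ k * s powi cartan_int T (wt T c) g) (Dd b k (uv c))" for k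
  proof
    fix r
    show "mv n (hr T N g s) (Dd b k (uv c)) r = sc (?u ^ k * s powi cartan_int T (wt T c) g) (Dd b k (uv c)) r"
    proof (cases "Dd b k (uv c) r = (0::'a)")
      case True
      then show ?thesis using hr_entry[OF assms(1,2), of r] by (cases "r < n") (auto simp: sc_apply mv_def)
    next
      case False
      from Dd_weight[OF c assms(3) this] have w: "r < n" "wt T r = vadd (wt T c) (vsmul (int k) b)" by auto
      have "cartan_int T (wt T r) g = cartan_int T b g * int k + cartan_int T (wt T c) g"
        unfolding w using assms c by (simp add: cartan_int_vadd cartan_int_vsmul Phi_length)
      then show ?thesis using hr_entry[OF assms(1,2) w(1)] assms(2)
        by (simp add: sc_apply power_int_add power_int_mult)
    qed
  qed
  show "mv n (hr T N g s * xr T N b t) (uv c) = mv n (xr T N b (?u * t) * hr T N g s) (uv c)"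
    using hr_uv_all[OF assms(1,2) c]
    by (simp add: mv_mult[of _ n] xr_eq_xm mv_xm[OF assms(3)] mv_sum mv_sc D sc_sum vlin_sc[OF vlin_Dd] power_mult_distrib ac_simps)
qed (simp_all add: mult_carrier_mat[of _ n n])

text \<open>The representative is an automorphism sending e_b to a sign times the root vector of the
  reflected root, so it carries powers of one adjoint map to powers of the other. Cancelling k! over
  the integers gives the divided powers.\<close>

lemma nm_conj:
  assumes "g \<in> Phi T" "b \<in> Phi T"
  obtains \<epsilon> :: int where "\<epsilon> = 1 \<or> \<epsilon> = - 1"
    "\<And>t. nm T N g 1 1 * xm T N b t = xm T N (reflr T g b) (of_int \<epsilon> * t) * (nm T N g 1 1 :: 'b::comm_ring_1 mat)"
proof -
  let ?M = "nm T N g 1 1 :: int mat" and ?R = "nm T N g 1 1 :: 'b mat"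
  let ?b = "reflr T g b"
  have b': "?b \<in> Phi T" using reflr_Phi assms by blast
  obtain \<epsilon> :: int and i m :: nat where e: "\<epsilon> = 1 \<or> \<epsilon> = - 1"
    "\<And>t t' :: int. t * t' = 1 \<Longrightarrow> mv n (nm T N g t t') (E b) = sc (of_int \<epsilon> * t ^ (m - i) * t' ^ i) (E ?b)"
    by (rule nm_root[OF assms]) blast
  have Eb: "mv n ?M (E b) = sc \<epsilon> (E ?b)" using e(2)[of 1 1] by simp
  have autM: "aut ?M" by (rule aut_nm[OF assms(1)])
  have a: "mv n ?M (adp b k v) = sc (\<epsilon> ^ k) (adp ?b k (mv n ?M v))" for k v
  proof (induction k)
    case (Suc k)
    have "mv n ?M (B (E b) (adp b k v)) = B (mv n ?M (E b)) (mv n ?M (adp b k v))"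
      using autM by (simp add: aut_def)
    then show ?case by (simp add: adp_Suc Eb Suc br_sc_left br_sc_right mult.commute)
  qed simp
  have DZ: "mv n ?M (Dd b k v) = sc (\<epsilon> ^ k) (Dd ?b k (mv n ?M v))" for k and v :: "nat \<Rightarrow> int"
  proof (rule sc_cancel[of "fact k"])
    show "sc (fact k) (mv n ?M (Dd b k v)) = sc (fact k) (sc (\<epsilon> ^ k) (Dd ?b k (mv n ?M v)))"
      using a[of k v] unfolding Dd_fact[OF assms(2), symmetric] Dd_fact[OF b', symmetric]
      by (simp add: mv_sc mult.commute)
  qed simp
  have mapM: "map_mat of_int ?M = ?R" using map_nm[of T N g 1 1] by simp
  have D: "mv n ?R (Dd b k (uv c)) = sc (of_int \<epsilon> ^ k) (Dd ?b k (mv n ?R (uv c)))" for k c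
  proof -
    have "emb (mv n ?M (Dd b k (uv c))) = (emb (sc (\<epsilon> ^ k) (Dd ?b k (mv n ?M (uv c)))) :: nat \<Rightarrow> 'b)"
      by (simp only: DZ)
    then show ?thesis by (simp add: mapM flip: Dd_emb mv_emb[OF nm_carrier])
  qed
  have "nm T N g 1 1 * xm T N b t = xm T N ?b (of_int \<epsilon> * t) * ?R" for t
  proof (rule mat_eqI_mv[of _ n])
    fix c
    show "mv n (?R * xm T N b t) (uv c) = mv n (xm T N ?b (of_int \<epsilon> * t) * ?R) (uv c)"
      by (simp add: mv_mult[of _ n] mv_xm[OF assms(2)] mv_xm[OF b'] mv_sum mv_sc D power_mult_distrib mult.commute)
  qed (simp_all add: mult_carrier_mat[of _ n n])
  with e(1) that show thesis by blast
qed

lemma nm_conj':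
  assumes "g \<in> Phi T" "b \<in> Phi T"
  obtains \<epsilon> :: int where "\<epsilon> = 1 \<or> \<epsilon> = - 1"
    "\<And>t. nm T N g (- 1) (- 1) * xm T N b t = xm T N (reflr T g b) (of_int \<epsilon> * t) * (nm T N g (- 1) (- 1) :: 'b::comm_ring_1 mat)"
proof -
  let ?n = "nm T N g 1 1 :: 'b mat" and ?n' = "nm T N g (- 1) (- 1) :: 'b mat"
  let ?b = "reflr T g b"
  have b': "?b \<in> Phi T" using reflr_Phi assms by blast
  obtain \<epsilon> :: int where e: "\<epsilon> = 1 \<or> \<epsilon> = - 1" "\<And>t. ?n * xm T N ?b t = xm T N b (of_int \<epsilon> * t) * ?n"
    by (rule nm_conj[OF assms(1) b', unfolded reflr_reflr[OF assms]]) blast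
  have inv: "?n * ?n' = 1\<^sub>m n" "?n' * ?n = 1\<^sub>m n"
    using nm_inverse[OF assms(1), of 1 1] nm_inverse[OF assms(1), of "- 1" "- 1"] by simp_all
  have "?n' * xm T N b t = xm T N ?b (of_int \<epsilon> * t) * ?n'" for t
  proof -
    have "(of_int (\<epsilon> * \<epsilon>) :: 'b) = 1" using e(1) by auto
    then have x: "?n * xm T N ?b (of_int \<epsilon> * t) = xm T N b t * ?n" using e(2)[of "of_int \<epsilon> * t"]
      by (simp add: mult.assoc[symmetric])
    have "?n' * xm T N b t = ?n' * ((xm T N b t * ?n) * ?n')"
      using inv by (simp add: mat_assoc mult_carrier_mat[of _ n n])
    also have "\<dots> = (?n' * ?n) * xm T N ?b (of_int \<epsilon> * t) * ?n'"
      unfolding x[symmetric] by (simp add: mat_assoc mult_carrier_mat[of _ n n])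
    finally show ?thesis using inv by simp
  qed
  with e(1) that show thesis by blast
qed

definition torus :: "'a::field mat set" where
  "torus = gen_by n {hr T N (sroot T i) t | i t. i < rank T \<and> t \<noteq> 0}"

text \<open>An automorphism of the integral form acting by signs on the root vectors is a sign
  character of the root lattice, and \<open>cartan_sign_solve\<close> writes it as a product of
  h_i(+-1). This is how two products of Weyl representatives with the same action on roots are
  compared.\<close>

lemma sign_diag_torus:
  assumes "aut M" "aut (map_mat of_int M :: 'a::field mat)"
    "\<And>g. g \<in> Phi T \<Longrightarrow> mv n M (E g) = sc (\<epsilon> g) (E g :: nat \<Rightarrow> int)"
    "\<And>g. g \<in> Phi T \<Longrightarrow> \<epsilon> g = 1 \<or> \<epsilon> g = - 1"
  shows "(map_mat of_int M :: 'a mat) \<in> torus"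
proof -
  have autM: "mv n M (B u v) = B (mv n M u) (mv n M v)" for u v using assms(1) by (simp add: aut_def)
  \<comment> \<open>Multiplicativity is read off from [e_g, e_h], whose structure constant is
    nonzero over the integers but may vanish in the field; hence the integral matrix
    \<open>M\<close>.\<close>
  have eps_add: "\<epsilon> (vadd g h) = \<epsilon> g * \<epsilon> h" if "g \<in> Phi T" "h \<in> Phi T" "vadd g h \<in> Phi T" for g h
  proof -
    have "mv n M (B (E g) (E h)) = sc (\<epsilon> g * \<epsilon> h * N g h) (E (vadd g h))"
      using that unfolding autM by (simp add: assms(3) br_sc_left br_sc_right B_EE ac_simps)
    moreover have "mv n M (B (E g) (E h)) = sc (N g h * \<epsilon> (vadd g h)) (E (vadd g h))"
      using that by (simp add: B_EE mv_sc assms(3))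
    ultimately have "sc (\<epsilon> g * \<epsilon> h * N g h) (E (vadd g h)) (ix (vadd g h)) = sc (N g h * \<epsilon> (vadd g h)) (E (vadd g h)) (ix (vadd g h))"
      by simp
    moreover have "N g h \<noteq> 0" using abs_N[OF that] by auto
    ultimately show ?thesis by (simp add: sc_apply)
  qed
  have neg: "\<epsilon> (vneg g) = \<epsilon> g" if "g \<in> Phi T" for g
  proof -
    have "mv n M (Hc g) = sc (\<epsilon> g * \<epsilon> (vneg g)) (Hc g)"
      unfolding B_opp[OF that, symmetric] using that by (simp add: autM assms(3) br_sc_left br_sc_right mult.commute)
    then have "mv n M (B (Hc g) (E g)) = sc (\<epsilon> g * \<epsilon> (vneg g) * \<epsilon> g * 2) (E g)"
      using that unfolding autM by (simp add: assms(3) br_sc_left br_sc_right B_Hc cartan_self ac_simps)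
    moreover have "mv n M (B (Hc g) (E g)) = sc (2 * \<epsilon> g) (E g)"
      using that by (simp add: B_Hc cartan_self mv_sc assms(3))
    ultimately have "sc (\<epsilon> g * \<epsilon> (vneg g) * \<epsilon> g * 2) (E g) (ix g) = sc (2 * \<epsilon> g) (E g) (ix g)" by simp
    then show ?thesis using assms(4)[OF that] assms(4)[of "vneg g"] that by (auto simp: sc_apply)
  qed
  define e where "e j = (if j < rank T then \<epsilon> (sroot T j) else 1)" for j
  obtain s where s: "\<And>i. s i = 1 \<or> s i = - 1"
    "\<And>j. j < rank T \<Longrightarrow> (\<Prod>i<rank T. s i ^ nat \<bar>cartan_int T (sroot T j) (sroot T i)\<bar>) = e j"
  proof -
    have "e i = 1 \<or> e i = - 1" for i using assms(4) by (simp add: e_def)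
    from cartan_sign_solve[OF this, of T] obtain s where "(\<forall>i. s i = 1 \<or> s i = - 1) \<and>
      (\<forall>j<rank T. (\<Prod>i<rank T. s i ^ nat \<bar>cartan_int T (sroot T j) (sroot T i)\<bar>) = e j)" ..
    then show thesis by (intro that[of s]) simp_all
  qed
  define \<chi> where "\<chi> g = (\<Prod>i<rank T. s i ^ nat \<bar>cartan_int T g (sroot T i)\<bar>)" for g
  have chi_add: "\<chi> (vadd g h) = \<chi> g * \<chi> h" if "g \<in> Phi T" "h \<in> Phi T" for g h
    using that s(1) unfolding \<chi>_def prod.distrib[symmetric]
    by (intro prod.cong refl) (simp add: cartan_int_vadd Phi_length sign_power_add)
  have chi_neg: "\<chi> (vneg g) = \<chi> g" if "g \<in> Phi T" for g
    using that unfolding \<chi>_def by (intro prod.cong refl) (simp add: cartan_neg Phi_length)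
  have eq: "\<epsilon> g = \<chi> g" if "g \<in> Phi T" for g
    using that
  proof (induction rule: root_induct)
    case (simple i) then show ?case using s(2) by (simp add: \<chi>_def e_def)
  next
    case (add g i)
    then have "\<epsilon> (sroot T i) = \<chi> (sroot T i)" using s(2) by (simp add: \<chi>_def e_def)
    with add show ?case by (simp add: chi_add eps_add)
  next
    case (neg g) then show ?case by (simp add: chi_neg \<open>\<And>g. g \<in> Phi T \<Longrightarrow> \<epsilon> (vneg g) = \<epsilon> g\<close>)
  qed
  define \<tau> where "\<tau> = foldr (\<lambda>i A. hr T N (sroot T i) (of_int (s i) :: 'a) * A)"
  have s0: "(of_int (s i) :: 'a) \<noteq> 0" for i using s(1)[of i] by auto
  have X: "{hr T N (sroot T i) t | i t. i < rank T \<and> t \<noteq> 0} \<subseteq> (carrier_mat n n :: 'a mat set)" by auto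
  have tau: "\<tau> is (1\<^sub>m n) \<in> torus \<and> aut (\<tau> is (1\<^sub>m n)) \<and> (\<forall>g\<in>Phi T. mv n (\<tau> is (1\<^sub>m n)) (E g) =
      sc (prod_list (map (\<lambda>i. of_int (s i) powi cartan_int T g (sroot T i)) is)) (E g))"
    if "set is \<subseteq> {..<rank T}" for "is"
    using that
  proof (induction "is")
    case Nil
    show ?case by (simp add: \<tau>_def torus_def gen_by.one aut_one)
  next
    case (Cons i "is")
    let ?A = "\<tau> is (1\<^sub>m n)"
    have t: "\<tau> (i # is) (1\<^sub>m n) = hr T N (sroot T i) (of_int (s i)) * ?A" by (simp add: \<tau>_def)
    have i: "i < rank T" and IH: "?A \<in> torus" "aut ?A"
      "\<And>g. g \<in> Phi T \<Longrightarrow> mv n ?A (E g) = sc (prod_list (map (\<lambda>i. of_int (s i) powi cartan_int T g (sroot T i)) is)) (E g)"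
      using Cons by auto
    have "hr T N (sroot T i) (of_int (s i)) * ?A \<in> torus"
    proof -
      have "hr T N (sroot T i) (of_int (s i)) \<in> {hr T N (sroot T i) t | i t. i < rank T \<and> (t::'a) \<noteq> 0}"
        using i s0[of i] by (intro CollectI exI conjI) auto
      then show ?thesis using IH(1) unfolding torus_def by (intro gen_by.step)
    qed
    moreover have "aut (hr T N (sroot T i) (of_int (s i)) * ?A)" using IH(2) i by (intro aut_mult aut_hr) auto
    moreover have "mv n (hr T N (sroot T i) (of_int (s i)) * ?A) (E g)
        = sc (prod_list (map (\<lambda>i. of_int (s i) powi cartan_int T g (sroot T i)) (i # is))) (E g)"
      if "g \<in> Phi T" for g
      using that i s0 IH(3)[OF that] aut_carrier[OF IH(2)]
      by (simp add: mv_mult[of _ n] mv_sc hr_E mult.commute)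
    ultimately show ?case unfolding t by blast
  qed
  have pl: "prod_list (map (\<lambda>i. of_int (s i) powi cartan_int T g (sroot T i)) [0..<rank T]) = (of_int (\<chi> g) :: 'a)" for g
  proof -
    have "prod_list (map (\<lambda>i. of_int (s i) powi cartan_int T g (sroot T i)) [0..<rank T])
       = (\<Prod>i<rank T. of_int (s i) powi cartan_int T g (sroot T i) :: 'a)"
      by (subst prod.distinct_set_conv_list[symmetric]) (simp_all add: atLeast0LessThan)
    then show ?thesis by (simp add: \<chi>_def sign_powi[OF s(1)])
  qed
  have "set [0..<rank T] \<subseteq> {..<rank T}" by auto
  note tau = tau[OF this, unfolded pl]
  have "(map_mat of_int M :: 'a mat) = \<tau> [0..<rank T] (1\<^sub>m n)"
  proof (rule diag_eq[where \<chi> = "\<lambda>g. of_int (\<chi> g)"])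
    fix g assume g: "g \<in> Phi T"
    have "mv n (map_mat of_int M) (E g) = (emb (mv n M (E g)) :: nat \<Rightarrow> 'a)"
      using mv_emb[OF aut_carrier[OF assms(1)], of "E g", where 'a = 'a] by simp
    then show "mv n (map_mat of_int M) (E g) = sc (of_int (\<chi> g)) (E g :: nat \<Rightarrow> 'a)"
      using assms(3)[OF g] eq[OF g] by simp
    have "\<chi> g * \<chi> g = 1" using assms(4)[OF g] eq[OF g] by auto
    then show "(of_int (\<chi> g) :: 'a) * of_int (\<chi> (vneg g)) = 1"
      unfolding chi_neg[OF g] by (metis of_int_1 of_int_mult)
  qed (use assms(2) tau in auto)
  with tau show ?thesis by simp
qed

end

section \<open>Parabolic subgroups and opposition\<close>

lemma refl_simps_F4:
  "refl F4 (Suc 0) [a,b,c,d] = [b - a, b, c, d]" "refl F4 2 [a,b,c,d] = [a, a - b + c, c, d]"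
  "refl F4 3 [a,b,c,d] = [a, b, 2*b - c + d, d]" "refl F4 4 [a,b,c,d] = [a, b, c, c - d]"
proof -
  have "(8 * a - 4 * b) div 4 = 2 * a - b" for a b :: int by presburger
  moreover have "(8 * b - (4 * a + 4 * c)) div 4 = 2 * b - (a + c)" for a b c :: int by presburger
  ultimately show "refl F4 (Suc 0) [a,b,c,d] = [b - a, b, c, d]" "refl F4 2 [a,b,c,d] = [a, a - b + c, c, d]"
  "refl F4 3 [a,b,c,d] = [a, b, 2*b - c + d, d]" "refl F4 4 [a,b,c,d] = [a, b, c, c - d]"
    by (simp_all add: refl_def sroot_cartan_F4 ip_F4 algebra_simps)
qed

lemma refl_simps_G2:
  "refl G2 (Suc 0) [a,b] = [3*b - a, b]" "refl G2 2 [a,b] = [a, a - b]"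
proof -
  have "(12 * b - 6 * a) div 6 = 2 * b - a" for a b :: int by presburger
  then show "refl G2 (Suc 0) [a,b] = [3*b - a, b]" "refl G2 2 [a,b] = [a, a - b]"
    by (simp_all add: refl_def sroot_cartan_G2 ip_G2 algebra_simps)
qed

text \<open>In both types the longest element is -1, so opposition preserves the labels.\<close>

lemma foldr_w0_word:
  assumes "length v = rank T" shows "foldr (refl T) (w0_word T) v = vneg v"
  using assms
proof (cases rule: length_rankE)
  case (1 a b c d)
  \<comment> \<open>A Coxeter element; its cube is simplified first, and the sixth power is the
    square of that.\<close>
  define c where "c = foldr (refl F4) [1,2,3,4]"
  have c1: "c [a,b,c',d] = [b - d, a + b - d, 2*b - d, c' - d]" for a b c' d
    by (simp add: c_def refl_simps_F4 algebra_simps)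
  have c3: "c (c (c [a,b,c',d])) = [a - d, 2*a + b - c' - d, 2*a + 2*b - c' - 2*d, 2*a - d]" for a b c' d
    by (simp add: c1 algebra_simps)
  have "concat (replicate 6 [1,2,3,4]) = [1,2,3,4] @ [1,2,3,4] @ [1,2,3,4] @ [1,2,3,4] @ [1,2,3,4] @ [1,2,3,4::nat]"
    by (simp add: numeral_eq_Suc)
  then have "foldr (refl F4) (w0_word F4) v = c (c (c (c (c (c v)))))"
    by (simp only: w0_word.simps foldr_append c_def o_apply)
  then show ?thesis unfolding 1 by (simp add: c3)
next
  case (2 a b)
  show ?thesis unfolding 2 by (simp add: numeral_3_eq_3 refl_simps_G2)
qed

lemma opp_label_id:
  assumes "i \<in> S T" shows "opp_label T i = i"
proof -
  have inj: "sroot T (i - 1) = sroot T (j - 1) \<Longrightarrow> i = j" if "i \<in> S T" "j \<in> S T" for i j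
  proof -
    assume "sroot T (i - 1) = sroot T (j - 1)"
    then have "sroot T (i - 1) ! (i - 1) = sroot T (j - 1) ! (i - 1)" by simp
    then show "i = j" using that by (auto simp: sroot_def S_def nth_list_update split: if_splits)
  qed
  show ?thesis unfolding opp_label_def
  proof (rule the_equality)
    show "i \<in> S T \<and> foldr (refl T) (w0_word T) (sroot T (i - 1)) = vneg (sroot T (i - 1))"
      using assms by (simp add: foldr_w0_word)
    fix j assume j: "j \<in> S T \<and> foldr (refl T) (w0_word T) (sroot T (i - 1)) = vneg (sroot T (j - 1))"
    then have "vneg (vneg (sroot T (i - 1))) = vneg (vneg (sroot T (j - 1)))" by (simp add: foldr_w0_word)
    then show "j = i" using inj[OF assms, of j] j by simp
  qed
qed

lemma S_index: "i \<in> S T \<Longrightarrow> i - 1 < rank T"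
  by (auto simp: S_def)

lemma gen_by_subset: "Y \<subseteq> carrier_mat d d \<Longrightarrow> X \<subseteq> Y \<Longrightarrow> gen_by d X \<subseteq> gen_by d Y"
  by (rule gen_by_mono) (auto intro: gen_by_base)

context chev begin

abbreviation G :: "'a::field mat set" where "G \<equiv> chev_group T N"
abbreviation P :: "nat set \<Rightarrow> 'a::field mat set" where "P K \<equiv> parabolic T N K"

definition pgens :: "nat set \<Rightarrow> 'a::field mat set" where
  "pgens K = borel_gens T N \<union> {xr T N (vneg (sroot T (i - 1))) t | i t. i \<in> K}"

lemma P_gen: "P K = gen_by n (pgens K)"
  by (simp add: parabolic_def pgens_def)

lemma G_gens_carrier: "{xr T N a t | a t. a \<in> Phi T} \<subseteq> carrier_mat n n"
  by auto

lemma pgens_carrier: "pgens K \<subseteq> carrier_mat n n"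
  by (auto simp: pgens_def borel_gens_def)

lemma G_mult: "g \<in> G \<Longrightarrow> h \<in> G \<Longrightarrow> g * h \<in> G"
  unfolding chev_group_def by (rule gen_by_mult[OF G_gens_carrier])

lemma P_mult: "g \<in> P K \<Longrightarrow> h \<in> P K \<Longrightarrow> g * h \<in> P K"
  unfolding P_gen by (rule gen_by_mult[OF pgens_carrier])

lemma G_one: "1\<^sub>m n \<in> G" and P_one: "1\<^sub>m n \<in> P K"
  by (simp_all add: chev_group_def P_gen gen_by.one)

lemma G_carrier: "g \<in> G \<Longrightarrow> g \<in> carrier_mat n n"
  unfolding chev_group_def by (rule gen_by_carrier[OF G_gens_carrier])

lemma P_carrier: "g \<in> P K \<Longrightarrow> g \<in> carrier_mat n n"
  unfolding P_gen by (rule gen_by_carrier[OF pgens_carrier])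

lemma xr_G: "a \<in> Phi T \<Longrightarrow> xr T N a t \<in> G"
  unfolding chev_group_def by (rule gen_by_base[OF G_gens_carrier]) auto

lemma nr_G: "a \<in> Phi T \<Longrightarrow> nr T N a t \<in> G"
  unfolding nr_def by (intro G_mult xr_G) auto

lemma hr_G: "a \<in> Phi T \<Longrightarrow> hr T N a t \<in> G"
  unfolding hr_def by (intro G_mult nr_G) auto

lemma G_inverse:
  assumes "g \<in> G" obtains g' where "g' \<in> G" "g * g' = 1\<^sub>m n" "g' * g = 1\<^sub>m n"
proof -
  have "\<exists>y\<in>G. x * y = 1\<^sub>m n \<and> y * x = 1\<^sub>m n" if x: "x \<in> {xr T N a t | a t. a \<in> Phi T}" for x :: "'a mat"
  proof -
    obtain a t where "x = xr T N a t" "a \<in> Phi T" using x by blast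
    then show ?thesis using xr_inverse[of a t] xr_G[of a "- t"] by blast
  qed
  then show thesis using that gen_by_inverse[OF G_gens_carrier, folded chev_group_def, of g] assms by blast
qed

lemma xr_pos_P: "pos_root T a \<Longrightarrow> xr T N a t \<in> P K"
  unfolding P_gen by (rule gen_by_base[OF pgens_carrier]) (auto simp: pgens_def borel_gens_def)

lemma xr_neg_P: "i \<in> K \<Longrightarrow> xr T N (vneg (sroot T (i - 1))) t \<in> P K"
  unfolding P_gen by (rule gen_by_base[OF pgens_carrier]) (auto simp: pgens_def)

lemma hr_P: "i < rank T \<Longrightarrow> t \<noteq> 0 \<Longrightarrow> hr T N (sroot T i) t \<in> P K"
  unfolding P_gen by (rule gen_by_base[OF pgens_carrier]) (auto simp: pgens_def borel_gens_def)

lemma sroot_pos: "i < rank T \<Longrightarrow> pos_root T (sroot T i)"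
proof -
  have "set (sroot T i) \<subseteq> insert 1 (set (zv T))" unfolding sroot_def by (rule set_update_subset_insert)
  then show "i < rank T \<Longrightarrow> pos_root T (sroot T i)" by (fastforce simp: pos_root_def)
qed

lemma nr_P: "i \<in> K \<Longrightarrow> K \<subseteq> S T \<Longrightarrow> nr T N (sroot T (i - 1)) t \<in> P K"
  unfolding nr_def by (intro P_mult xr_neg_P xr_pos_P sroot_pos S_index) auto

lemma borel_P: "borel T N \<subseteq> P K"
  unfolding borel_def P_gen by (rule gen_by_subset[OF pgens_carrier]) (auto simp: pgens_def)

lemma torus_P: "torus \<subseteq> P K"
  unfolding torus_def P_gen by (rule gen_by_subset[OF pgens_carrier]) (auto simp: pgens_def borel_gens_def)

lemma P_mono: "K \<subseteq> K' \<Longrightarrow> P K \<subseteq> P K'"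
  unfolding P_gen by (rule gen_by_subset[OF pgens_carrier]) (auto simp: pgens_def)

lemma P_G:
  assumes "K \<subseteq> S T" shows "P K \<subseteq> (G :: 'a::field mat set)"
proof -
  have "pgens K \<subseteq> (G :: 'a mat set)"
  proof
    fix x :: "'a mat" assume "x \<in> pgens K"
    then consider a t where "x = xr T N a t" "pos_root T a" | i t where "x = hr T N (sroot T i) t" "i < rank T"
      | i t where "x = xr T N (vneg (sroot T (i - 1))) t" "i \<in> K"
      unfolding pgens_def borel_gens_def by blast
    then show "x \<in> G"
    proof cases
      case (3 i t)
      then show ?thesis using assms S_index[of i T] by (auto intro!: xr_G)
    qed (auto simp: pos_root_def xr_G hr_G)
  qed
  then show ?thesis unfolding P_gen chev_group_def by (rule gen_by_mono[OF G_gens_carrier])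
qed

lemma P_inverse:
  assumes "K \<subseteq> S T" "g \<in> P K" obtains g' where "g' \<in> P K" "g * g' = 1\<^sub>m n" "g' * g = 1\<^sub>m n"
proof -
  have "\<exists>y\<in>P K. x * y = 1\<^sub>m n \<and> y * x = 1\<^sub>m n" if x: "x \<in> pgens K" for x :: "'a mat"
  proof -
    consider a t where "x = xr T N a t" "pos_root T a" | i t where "x = hr T N (sroot T i) t" "i < rank T" "t \<noteq> 0"
      | i t where "x = xr T N (vneg (sroot T (i - 1))) t" "i \<in> K"
      using x unfolding pgens_def borel_gens_def by blast
    then show ?thesis
    proof cases
      case (1 a t)
      then show ?thesis using xr_inverse[of a t] xr_pos_P[of a "- t" K] by (auto simp: pos_root_def)
    next
      case (2 i t)
      then show ?thesis
        using hr_inverse[of "sroot T i" t] hr_inverse[of "sroot T i" "inverse t"] hr_P[of i "inverse t" K] by auto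
    next
      case (3 i t)
      then have "vneg (sroot T (i - 1)) \<in> Phi T" using assms(1) S_index by auto
      then show ?thesis unfolding 3(1) using xr_inverse[of "vneg (sroot T (i - 1))" t] xr_neg_P[OF 3(2), of "- t"] by blast
    qed
  qed
  then show thesis using that gen_by_inverse[OF pgens_carrier, folded P_gen, of K g] assms by blast
qed

section \<open>Products of Weyl group representatives\<close>

definition wmat :: "int list list \<Rightarrow> 'r::comm_ring_1 mat" where
  "wmat bs = foldr (\<lambda>b M. nm T N b 1 1 * M) bs (1\<^sub>m n)"

lemma wmat_Nil: "wmat [] = 1\<^sub>m n" and wmat_Cons: "wmat (b # bs) = nm T N b 1 1 * wmat bs"
  by (simp_all add: wmat_def)

lemma wmat_carrier [simp]: "wmat bs \<in> carrier_mat n n"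
  by (induction bs) (simp_all add: wmat_Nil wmat_Cons)

lemma wmat_append: "wmat (bs @ cs) = wmat bs * (wmat cs :: 'b::comm_ring_1 mat)"
  by (induction bs) (simp_all add: wmat_Nil wmat_Cons mat_assoc)

lemma w0_rep_wmat: "w0_rep T N = wmat (map (\<lambda>i. sroot T (i - 1)) (w0_word T))"
  by (simp add: w0_rep_def wmat_def nr_eq_nm foldr_map o_def)

lemma map_wmat: "map_mat of_int (wmat bs) = (wmat bs :: 'b::comm_ring_1 mat)"
proof (induction bs)
  case (Cons b bs)
  have "map_mat of_int (nm T N b 1 1 * wmat bs) = (map_mat of_int (nm T N b 1 1) * map_mat of_int (wmat bs) :: 'b mat)"
    by (rule of_int_hom.mat_hom_mult[of _ n n _ n]) simp_all
  moreover have "map_mat of_int (nm T N b 1 1) = (nm T N b 1 1 :: 'b mat)"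
    using map_nm[of T N b 1 1] by simp
  ultimately show ?case using Cons by (simp only: wmat_Cons)
qed (auto simp: wmat_Nil intro!: eq_matI)

lemma aut_wmat: "set bs \<subseteq> Phi T \<Longrightarrow> aut (wmat bs)"
  by (induction bs) (simp_all add: wmat_Nil wmat_Cons aut_one aut_mult aut_nm)

lemma wmat_E:
  assumes "set bs \<subseteq> Phi T" "g \<in> Phi T"
  shows "foldr (reflr T) bs g \<in> Phi T \<and>
    (\<exists>\<epsilon>::int. (\<epsilon> = 1 \<or> \<epsilon> = - 1) \<and> mv n (wmat bs) (E g) = sc (of_int \<epsilon>) (E (foldr (reflr T) bs g) :: nat \<Rightarrow> 'b::comm_ring_1))"
  using assms(1)
proof (induction bs)
  case Nil
  then show ?case using assms(2) by (auto simp: wmat_Nil intro!: exI[of _ 1])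
next
  case (Cons b bs)
  then obtain \<epsilon> :: int where e: "foldr (reflr T) bs g \<in> Phi T" "\<epsilon> = 1 \<or> \<epsilon> = - 1"
    "mv n (wmat bs) (E g) = sc (of_int \<epsilon>) (E (foldr (reflr T) bs g) :: nat \<Rightarrow> 'b)" by auto
  have b: "b \<in> Phi T" using Cons by simp
  obtain \<epsilon>' :: int and i m :: nat where e': "\<epsilon>' = 1 \<or> \<epsilon>' = - 1"
    "\<And>t t' :: 'b. t * t' = 1 \<Longrightarrow> mv n (nm T N b t t') (E (foldr (reflr T) bs g)) =
       sc (of_int \<epsilon>' * t ^ (m - i) * t' ^ i) (E (reflr T b (foldr (reflr T) bs g)))"
    by (rule nm_root[OF b e(1)]) blast
  have "mv n (wmat (b # bs)) (E g) = sc (of_int (\<epsilon> * \<epsilon>')) (E (foldr (reflr T) (b # bs) g) :: nat \<Rightarrow> 'b)"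
    using e'(2)[of 1 1] e(3) by (simp add: wmat_Cons mv_mult[of _ n] mv_sc)
  moreover have "\<epsilon> * \<epsilon>' = 1 \<or> \<epsilon> * \<epsilon>' = - 1" using e(2) e'(1) by auto
  ultimately show ?case using reflr_Phi[OF b e(1)] by (intro conjI exI[of _ "\<epsilon> * \<epsilon>'"]) simp_all
qed

lemma wmat_G: "set bs \<subseteq> Phi T \<Longrightarrow> wmat bs \<in> G"
proof (induction bs)
  case (Cons b bs)
  have "nm T N b 1 1 = (nr T N b 1 :: 'a mat)" by (simp add: nr_eq_nm)
  with Cons show ?case by (simp add: wmat_Cons G_mult nr_G)
qed (simp add: wmat_Nil G_one)

lemma wmat_P: "K \<subseteq> S T \<Longrightarrow> set is \<subseteq> K \<Longrightarrow> wmat (map (\<lambda>i. sroot T (i - 1)) is) \<in> P K"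
proof (induction "is")
  case (Cons i "is")
  have "nm T N b 1 1 = (nr T N b 1 :: 'a mat)" for b by (simp add: nr_eq_nm)
  with Cons show ?case by (simp add: wmat_Cons P_mult nr_P[unfolded One_nat_def])
qed (simp add: wmat_Nil P_one)

lemma w0_word_S: "set (w0_word T) \<subseteq> S T"
  by (cases T) (auto simp: S_def)

lemma w0_word_roots: "set (map (\<lambda>i. sroot T (i - 1)) (w0_word T)) \<subseteq> Phi T"
  using w0_word_S S_index by (auto simp: image_iff subset_iff)

lemma w0_rep_carrier [simp]: "w0_rep T N \<in> carrier_mat n n"
  by (simp add: w0_rep_wmat)

lemma w0_rep_G: "w0_rep T N \<in> G"
  unfolding w0_rep_wmat by (rule wmat_G[OF w0_word_roots])

section \<open>Opposition and the type in terms of double cosets\<close>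

lemma act_coset: "\<theta> \<in> carrier_mat n n \<Longrightarrow> g \<in> carrier_mat n n \<Longrightarrow> act \<theta> (coset g (P K)) = coset (\<theta> * g) (P K)"
  unfolding act_def coset_def image_image
  by (intro image_cong refl) (simp add: mat_assoc P_carrier)

lemma type_preservingI:
  assumes "(\<theta> :: 'a::field mat) \<in> G" shows "type_preserving T N \<theta>"
  unfolding type_preserving_def simplex_of_type_def
proof (intro allI impI conjI)
  fix J and \<sigma> :: "'a mat set" assume a: "J \<subseteq> S T \<and> (\<exists>g\<in>G. \<sigma> = coset g (P (S T - J)))"
  then show "J \<subseteq> S T" by blast
  obtain g where "g \<in> G" "\<sigma> = coset g (P (S T - J))" using a by blast
  then show "\<exists>g\<in>G. act \<theta> \<sigma> = coset g (P (S T - J))"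
    using assms by (intro bexI[of _ "\<theta> * g"]) (auto simp: act_coset G_carrier G_mult)
qed

lemma opposite_iff:
  assumes "(\<theta> :: 'a::field mat) \<in> G" "J \<subseteq> S T"
  shows "(\<exists>\<sigma>. simplex_of_type T N J \<sigma> \<and> opposite T N \<sigma> (act \<theta> \<sigma>)) \<longleftrightarrow>
    (\<exists>g\<in>G. \<exists>p1\<in>P (S T - J). \<exists>p2\<in>P (S T - J). \<theta> * g = g * (p1 * (w0_rep T N * p2)))" (is "?L \<longleftrightarrow> ?R")
proof
  let ?P = "P (S T - J) :: 'a mat set" and ?B = "borel T N :: 'a mat set" and ?w = "w0_rep T N :: 'a mat"
  note tc = assms(1)[THEN G_carrier]
  have KS: "S T - J \<subseteq> S T" by auto
  have BP: "\<And>b. b \<in> ?B \<Longrightarrow> b \<in> ?P" using borel_P by blast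
  have oneB: "1\<^sub>m n \<in> ?B" by (simp add: borel_def gen_by.one)
  {
    assume ?L
    then obtain \<sigma> C D where s: "simplex_of_type T N J \<sigma>" "C \<subseteq> \<sigma>" "D \<subseteq> act \<theta> \<sigma>" "weyl_dist_w0 T N C D"
      unfolding opposite_def by blast
    obtain g where g: "g \<in> G" "\<sigma> = coset g ?P" using s(1) unfolding simplex_of_type_def by blast
    obtain g0 h0 b1 b2 where w: "g0 \<in> G" "h0 \<in> G" "C = coset g0 ?B" "D = coset h0 ?B" "b1 \<in> ?B" "b2 \<in> ?B"
      "h0 = g0 * b1 * ?w * b2" using s(4) unfolding weyl_dist_w0_def by blast
    note gc = G_carrier[OF g(1)]
    have "g0 \<in> C" unfolding w coset_def using oneB G_carrier[OF w(1)] by (intro image_eqI[of _ _ "1\<^sub>m n"]) auto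
    then obtain p where p: "p \<in> ?P" "g0 = g * p" using s(2) g(2) unfolding coset_def by blast
    have "h0 \<in> D" unfolding w(4) coset_def using oneB G_carrier[OF w(2)] by (intro image_eqI[of _ _ "1\<^sub>m n"]) auto
    then obtain p' where p': "p' \<in> ?P" "h0 = \<theta> * (g * p')" using s(3) g(2) unfolding coset_def act_def by blast
    obtain q where q: "q \<in> ?P" "p' * q = 1\<^sub>m n" using P_inverse[OF KS p'(1)] by blast
    note cs = gc tc P_carrier[OF p(1)] P_carrier[OF p'(1)] P_carrier[OF q(1)] P_carrier[OF BP[OF w(5)]] P_carrier[OF BP[OF w(6)]]
    have "\<theta> * g = \<theta> * (g * (p' * q))" using q cs by simp
    also have "\<dots> = h0 * q" unfolding p' using cs by (simp add: mat_assoc)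
    also have "\<dots> = g * ((p * b1) * (?w * (b2 * q)))" unfolding w(7) p using cs by (simp add: mat_assoc)
    finally show ?R using g(1) P_mult[OF p(1) BP[OF w(5)]] P_mult[OF BP[OF w(6)] q(1)] by blast
  }
  {
    assume ?R
    then obtain g p1 p2 where g: "g \<in> G" "p1 \<in> ?P" "p2 \<in> ?P" "\<theta> * g = g * (p1 * (?w * p2))" by blast
    obtain q where q: "q \<in> ?P" "p2 * q = 1\<^sub>m n" using P_inverse[OF KS g(3)] by blast
    note cs = G_carrier[OF g(1)] tc P_carrier[OF g(2)] P_carrier[OF g(3)] P_carrier[OF q(1)]
    let ?s = "coset g ?P"
    have gp: "g * p1 \<in> G" using g P_G[OF KS] by (intro G_mult) auto
    have gpw: "g * p1 * ?w \<in> G" using gp w0_rep_G by (rule G_mult)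
    have e: "g * p1 * ?w = \<theta> * (g * q)"
    proof -
      have "\<theta> * (g * q) = (\<theta> * g) * q" using cs by (simp add: mat_assoc)
      also have "\<dots> = g * p1 * ?w * (p2 * q)" unfolding g(4) using cs by (simp add: mat_assoc)
      finally show ?thesis using q cs by simp
    qed
    have s1: "simplex_of_type T N J ?s" unfolding simplex_of_type_def using assms(2) g(1) by blast
    have "opp_label T ` J = J" using opp_label_id assms(2) by (force simp: image_iff subset_iff)
    then have s2: "simplex_of_type T N (opp_label T ` J) (act \<theta> ?s)"
      unfolding simplex_of_type_def act_coset[OF tc G_carrier[OF g(1)]]
      using assms(2) by (intro conjI bexI[of _ "\<theta> * g"] G_mult[OF assms(1) g(1)]) auto
    have c1: "coset (g * p1) ?B \<subseteq> ?s"
    proof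
      fix x assume "x \<in> coset (g * p1) ?B"
      then obtain b where b: "b \<in> ?B" "x = g * p1 * b" unfolding coset_def by blast
      then have "x = g * (p1 * b)" using cs P_carrier[OF BP[OF b(1)]] by (simp add: mat_assoc)
      then show "x \<in> ?s" unfolding coset_def using P_mult[OF g(2) BP[OF b(1)]] by blast
    qed
    have c2: "coset (g * p1 * ?w) ?B \<subseteq> act \<theta> ?s"
    proof
      fix x assume "x \<in> coset (g * p1 * ?w) ?B"
      then obtain b where b: "b \<in> ?B" "x = g * p1 * ?w * b" unfolding coset_def by blast
      then have "x = \<theta> * (g * (q * b))" unfolding b e using cs P_carrier[OF BP[OF b(1)]] by (simp add: mat_assoc)
      then show "x \<in> act \<theta> ?s" unfolding coset_def act_def using P_mult[OF q(1) BP[OF b(1)]] by blast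
    qed
    have w: "weyl_dist_w0 T N (coset (g * p1) ?B) (coset (g * p1 * ?w) ?B)"
      unfolding weyl_dist_w0_def using gp gpw oneB G_carrier[OF gp]
      by (intro bexI[of _ "g * p1"] bexI[of _ "g * p1 * ?w"] conjI refl bexI[of _ "1\<^sub>m n"]) auto
    have ch: "chamber T N (coset (g * p1) ?B)" "chamber T N (coset (g * p1 * ?w) ?B)"
      unfolding chamber_def using gp gpw by blast+
    show ?L unfolding opposite_def using s1 s2 c1 c2 w ch by blast
  }
qed

text \<open>Vertices suffice: for i in J the parabolic of \<open>S T - J\<close> is contained in
  that of \<open>S T - {i}\<close>, so an opposite pair of type J yields one of type {i}.\<close>

lemma Type_iff:
  assumes "(\<theta> :: 'a::field mat) \<in> G"
  shows "i \<in> Type T N \<theta> \<longleftrightarrow> i \<in> S T \<and>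
    (\<exists>g\<in>G. \<exists>p1\<in>P (S T - {i}). \<exists>p2\<in>P (S T - {i}). \<theta> * g = g * (p1 * (w0_rep T N * p2)))" (is "_ \<longleftrightarrow> ?R")
proof
  assume "i \<in> Type T N \<theta>"
  then obtain J \<sigma> where J: "i \<in> J" "simplex_of_type T N J \<sigma>" "opposite T N \<sigma> (act \<theta> \<sigma>)"
    unfolding Type_def by blast
  have JS: "J \<subseteq> S T" using J(2) unfolding simplex_of_type_def by blast
  have "S T - J \<subseteq> S T - {i}" using J(1) by blast
  from P_mono[OF this] show ?R using iffD1[OF opposite_iff[OF assms JS]] J JS by blast
next
  assume R: ?R
  then have "{i} \<subseteq> S T" by blast
  from iffD2[OF opposite_iff[OF assms this]] R show "i \<in> Type T N \<theta>" unfolding Type_def by blast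
qed

end

section \<open>A product formula of Heisenberg type\<close>

text \<open>A ring of coefficients for formal power series, in which \<open>exp (s \<cdot> ad x)\<close> can be manipulated.\<close>
typedef endo = "{f :: (nat \<Rightarrow> int) \<Rightarrow> nat \<Rightarrow> int. \<forall>x y. f (x + y) = f x + f y}"
  morphisms app Endo
  by (rule exI[of _ "\<lambda>x. 0"]) simp

lemma app_Endo: "(\<And>x y. f (x + y) = f x + f y) \<Longrightarrow> app (Endo f) = f"
  by (simp add: Endo_inverse)

lemma app_add: "app f (x + y) = app f x + app f y"
  using app[of f] by simp

lemma endo_eqI: "(\<And>x. app f x = app g x) \<Longrightarrow> f = g"
  by (metis app_inject ext)

instantiation endo :: ring_1
begin

definition "0 = Endo (\<lambda>x. 0)"
definition "1 = Endo (\<lambda>x. x)"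
definition "f + g = Endo (\<lambda>x. app f x + app g x)"
definition "f - g = Endo (\<lambda>x. app f x - app g x)"
definition "- f = Endo (\<lambda>x. - app f x)"
definition "f * g = Endo (\<lambda>x. app f (app g x))"

lemma app_simps [simp]: "app 0 x = 0" "app 1 x = x" "app (f + g) x = app f x + app g x"
  "app (f - g) x = app f x - app g x" "app (- f) x = - app f x" "app (f * g) x = app f (app g x)"
  unfolding zero_endo_def one_endo_def plus_endo_def minus_endo_def uminus_endo_def times_endo_def
  by (subst app_Endo; simp add: app_add)+

instance
proof
  show "(0::endo) \<noteq> 1"
  proof
    assume "(0::endo) = 1"
    then have "app 0 (uv 0) 0 = app 1 (uv 0) 0" by simp
    then show False by (simp add: zero_fun_apply)
  qed
qed (rule endo_eqI, simp add: app_add algebra_simps)+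

end

lemma app_of_nat: "app (of_nat k) v = sc (of_nat k) v"
  by (induction k) (simp_all add: sc_add_left algebra_simps)

text \<open>Replaces division by k + 1 in the uniqueness of formal solutions of a differential
  equation; it is the reason for working with integral vectors.\<close>

lemma endo_torsion_free:
  fixes f :: endo assumes "of_nat (Suc k) * f = 0" shows "f = 0"
proof (rule endo_eqI)
  fix x
  have "app (of_nat (Suc k) * f) x = 0" using assms by simp
  then have "sc (int (Suc k)) (app f x) = sc (int (Suc k)) 0" by (simp only: app_simps app_of_nat sc_zero)
  then have "app f x = 0" by (rule sc_cancel[rotated]) simp
  then show "app f x = app 0 x" by simp
qed

lemma fps_ode_zero:
  fixes H :: "endo fps"
  assumes "fps_deriv H = fps_const c * H" "fps_nth H 0 = 0"
  shows "H = 0"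
proof (rule fps_ext)
  fix k show "fps_nth H k = fps_nth 0 k"
  proof (induction k)
    case (Suc k)
    have "of_nat (Suc k) * fps_nth H (Suc k) = c * fps_nth H k"
      using arg_cong[OF assms(1), of "\<lambda>F. fps_nth F k"] by simp
    then show ?case using Suc endo_torsion_free by fastforce
  qed (simp add: assms(2))
qed

lemma fps_ode_unique:
  fixes F F' :: "endo fps"
  assumes "fps_deriv F = fps_const c * F" "fps_deriv F' = fps_const c * F'" "fps_nth F 0 = fps_nth F' 0"
  shows "F = F'"
  using fps_ode_zero[of "F - F'" c] assms by (simp add: algebra_simps)

text \<open>Here \<open>U\<close>, \<open>V\<close>, \<open>W\<close>, \<open>F\<close> are the exponentials of \<open>s X\<close>, \<open>s Y\<close>, \<open>- s\<^sup>2 C\<close>, \<open>s (X + Y)\<close>;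
  both sides solve the same differential equation in \<open>s\<close>.\<close>
lemma heisenberg_exp:
  fixes X Y C :: "endo"
  assumes "X * Y = Y * X + 2 * C" "X * C = C * X" "Y * C = C * Y"
    and U: "fps_deriv U = fps_const X * U" "fps_nth U 0 = 1" "fps_const C * U = U * fps_const C"
    and V: "fps_deriv V = fps_const Y * V" "fps_nth V 0 = 1" "fps_const C * V = V * fps_const C"
    and W: "fps_deriv W = - (2 * fps_X * fps_const C * W)" "fps_nth W 0 = 1"
    and F: "fps_deriv F = fps_const (X + Y) * F" "fps_nth F 0 = 1"
  shows "F = U * V * W"
proof -
  let ?X = "fps_const X" and ?Y = "fps_const Y" and ?C = "fps_const C" and ?s = "fps_X :: endo fps"
  have s: "?s * f = f * ?s" for f by (rule fps_mult_fps_X_commute)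
  have XY: "?X * ?Y = ?Y * ?X + 2 * ?C" "?X * ?C = ?C * ?X" "?Y * ?C = ?C * ?Y"
    using assms(1-3) by (simp_all add: mult_2 flip: fps_const_add)
  \<comment> \<open>\<open>H\<close> measures the failure of U Y U^-1 = Y + 2 s C. It satisfies the
    same differential equation as \<open>U\<close>, with initial value 0, so it vanishes.\<close>
  define H where "H = U * ?Y - ?Y * U - 2 * ?s * ?C * U"
  have sX: "?s * (?X * f) = ?X * (?s * f)" "?s * (?C * f) = ?C * (?s * f)" for f
    by (simp_all only: mult.assoc[symmetric] s[of ?X] s[of ?C])
  have XC: "?X * (?C * f) = ?C * (?X * f)" for f by (simp only: mult.assoc[symmetric] XY)
  have XYf: "?X * (?Y * f) = ?Y * (?X * f) + 2 * (?C * f)" for f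
    by (simp only: mult.assoc[symmetric] XY distrib_right)
  have "fps_deriv H = ?X * H"
    unfolding H_def by (simp add: U(1) algebra_simps mult_2 sX XC XYf)
  moreover have "fps_nth H 0 = 0" using U(2) by (simp add: H_def)
  ultimately have "H = 0" by (rule fps_ode_zero)
  then have UY: "U * ?Y = ?Y * U + 2 * ?s * ?C * U" by (simp add: H_def algebra_simps)
  have "fps_deriv (U * V * W) = fps_const (X + Y) * (U * V * W)"
  proof -
    have "U * (?Y * (V * W)) = (U * ?Y) * (V * W)" by (simp only: mult.assoc)
    also have "\<dots> = ?Y * (U * (V * W)) + 2 * (?s * (?C * (U * (V * W))))"
      unfolding UY by (simp add: algebra_simps)
    finally have 1: "U * (?Y * (V * W)) = ?Y * (U * (V * W)) + 2 * (?s * (?C * (U * (V * W))))" .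
    have UVs: "U * (?s * f) = ?s * (U * f)" "V * (?s * f) = ?s * (V * f)"
      "U * (?C * f) = ?C * (U * f)" "V * (?C * f) = ?C * (V * f)" for f
      by (simp_all only: mult.assoc[symmetric] s[of U] s[of V] U(3) V(3))
    have c: "fps_const (X + Y) = ?X + ?Y" by simp
    show ?thesis unfolding c by (simp add: U(1) V(1) W(1) algebra_simps 1 mult_2 UVs del: fps_const_add)
  qed
  then show ?thesis using U V W F by (intro fps_ode_unique[OF F(1)]) simp_all
qed

text \<open>Evaluation at s = 1 is multiplicative on polynomials. It turns the identity of series
  into one of matrices.\<close>

lemma fps_total_mult:
  fixes f g :: "'b::ring_1 fps"
  assumes "\<And>k. k > a \<Longrightarrow> fps_nth f k = 0" "\<And>k. k > b \<Longrightarrow> fps_nth g k = 0"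
  shows "(\<Sum>k\<le>a + b. fps_nth (f * g) k) = (\<Sum>k\<le>a. fps_nth f k) * (\<Sum>k\<le>b. fps_nth g k)" "\<And>k. k > a + b \<Longrightarrow> fps_nth (f * g) k = 0"
proof -
  have "(\<Sum>k\<le>a + b. fps_nth (f * g) k) = (\<Sum>(i, j)\<in>{(i, j). i + j \<le> a + b}. fps_nth f i * fps_nth g j)"
    by (simp add: fps_mult_nth atLeast0AtMost sum.triangle_reindex_eq)
  also have "\<dots> = (\<Sum>(i, j)\<in>{..a} \<times> {..b}. fps_nth f i * fps_nth g j)"
  proof (rule sum.mono_neutral_right)
    have "{(i, j). i + j \<le> a + b} \<subseteq> {..a + b} \<times> {..a + b}" by auto
    then show "finite {(i, j). i + j \<le> a + b}" by (rule finite_subset) simp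
    show "\<forall>i\<in>{(i, j). i + j \<le> a + b} - {..a} \<times> {..b}. (case i of (i, j) \<Rightarrow> fps_nth f i * fps_nth g j) = 0"
    proof -
      have "fps_nth f i * fps_nth g j = 0" if "\<not> (i \<le> a \<and> j \<le> b)" for i j
        using that assms by (cases "i \<le> a") auto
      then show ?thesis by auto
    qed
    show "{..a} \<times> {..b} \<subseteq> {(i, j). i + j \<le> a + b}" by auto
  qed
  also have "\<dots> = (\<Sum>k\<le>a. fps_nth f k) * (\<Sum>k\<le>b. fps_nth g k)"
    by (simp add: sum_product sum.cartesian_product)
  finally show "(\<Sum>k\<le>a + b. fps_nth (f * g) k) = (\<Sum>k\<le>a. fps_nth f k) * (\<Sum>k\<le>b. fps_nth g k)" .
  show "fps_nth (f * g) k = 0" if "k > a + b" for k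
    unfolding fps_mult_nth
  proof (rule sum.neutral, rule ballI)
    fix i assume "i \<in> {0..k}"
    then have "i > a \<or> k - i > b" using that by auto
    then show "fps_nth f i * fps_nth g (k - i) = 0" using assms by auto
  qed
qed

lemma app_fps_deriv: "app (fps_nth (fps_deriv F) j) w = sc (1 + int j) (app (fps_nth F (Suc j)) w)"
proof -
  have "fps_nth (fps_deriv F) j = of_nat (Suc j) * fps_nth F (Suc j)" by simp
  then have "app (fps_nth (fps_deriv F) j) w = sc (int (Suc j)) (app (fps_nth F (Suc j)) w)"
    by (simp only: app_simps app_of_nat)
  then show ?thesis by simp
qed

lemma app_double: "app (2 * f) w = sc 2 (app f w)"
  unfolding mult_2 app_simps by (simp add: fun_eq_iff vec_apply)

lemma app_two: "app 2 w = sc 2 w"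
  using app_double[of 1 w] by simp

context chev begin

section \<open>Exponential series of adjoint maps and conjugates of root elements\<close>

definition ade :: "(nat \<Rightarrow> int) \<Rightarrow> endo" where "ade u = Endo (B u)"

lemma app_ade [simp]: "app (ade u) = B u"
  unfolding ade_def by (rule app_Endo) (rule br_add_right)

text \<open>The root element x_b(p s) as a series in s.\<close>

definition dpe :: "int list \<Rightarrow> int \<Rightarrow> endo fps" where
  "dpe b p = Abs_fps (\<lambda>j. Endo (\<lambda>v. sc (p ^ j) (Dd b j v)))"

lemma app_dpe [simp]: "app (fps_nth (dpe b p) j) v = sc (p ^ j) (Dd b j v)"
  unfolding dpe_def fps_nth_Abs_fps by (subst app_Endo) (simp_all add: vlin_add[OF vlin_Dd] sc_add)

lemma dpe_0: "fps_nth (dpe b p) 0 = 1"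
  by (rule endo_eqI) simp

lemma dpe_zero: "b \<in> Phi T \<Longrightarrow> j > 3 \<Longrightarrow> fps_nth (dpe b p) j = 0"
  by (rule endo_eqI) (simp add: Dd_zero4)

lemma deriv_dpe:
  assumes "b \<in> Phi T" shows "fps_deriv (dpe b p) = fps_const (ade (sc p (E b))) * dpe b p"
proof (rule fps_ext, rule endo_eqI)
  fix j v
  have "B (E b) (Dd b j v) = sc (1 + int j) (Dd b (Suc j) v)"
    using Dd_comp[OF assms, of 1 j v] by (simp add: Dd_1[OF assms, unfolded One_nat_def])
  then show "app (fps_nth (fps_deriv (dpe b p)) j) v = app (fps_nth (fps_const (ade (sc p (E b))) * dpe b p) j) v"
    by (simp add: app_fps_deriv br_sc_left br_sc_right ac_simps del: fps_deriv_nth)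
qed

lemma total_dpe:
  assumes "b \<in> Phi T" shows "app (\<Sum>k\<le>3. fps_nth (dpe b p) k) v = mv n (xm T N b p) v"
  by (simp add: mv_xm[OF assms] sum_upto4 numeral_3_eq_3 numeral_2_eq_2)

lemma ade_commute_dpe:
  assumes "b \<in> Phi T" "B (E b) u = 0"
  shows "fps_const (ade u) * dpe b p = dpe b p * fps_const (ade u)"
proof (rule fps_ext, rule endo_eqI)
  fix j v
  have z: "Dd b i u = 0" if "i > 0" for i
  proof (rule sc_cancel[of "fact i"])
    have "adp b i u = 0" using that assms(2)
    proof (induction i)
      case (Suc i) then show ?case by (cases "i = 0") (simp_all add: adp_Suc)
    qed simp
    then show "sc (fact i) (Dd b i u) = sc (fact i) 0" by (simp add: Dd_fact[OF assms(1)])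
  qed simp
  have "Dd b j (B u v) = (\<Sum>i\<le>j. B (Dd b i u) (Dd b (j - i) v))" by (rule Dd_B[OF assms(1)])
  also have "\<dots> = (\<Sum>i\<le>j. if i = 0 then B u (Dd b j v) else 0)" by (intro sum.cong refl) (auto simp: z)
  also have "\<dots> = B u (Dd b j v)" by simp
  finally show "app (fps_nth (fps_const (ade u) * dpe b p) j) v = app (fps_nth (dpe b p * fps_const (ade u)) j) v"
    by (simp add: br_sc_right)
qed

lemma ade_add: "ade (u + v) = ade u + ade v"
  by (rule endo_eqI) (simp add: br_add_left)

lemma ade_bracket: "ade u * ade v = ade v * ade u + ade (B u v)"
proof (rule endo_eqI)
  fix x show "app (ade u * ade v) x = app (ade v * ade u + ade (B u v)) x"
    using B_derivation[of u v x] by (simp add: add.commute)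
qed

lemma deriv_dpe_pair:
  assumes "r \<in> Phi T" "r' \<in> Phi T" "B (E r) (E r') = (0 :: nat \<Rightarrow> int)"
  shows "fps_deriv (dpe r p * dpe r' p') = fps_const (ade (sc p (E r) + sc p' (E r'))) * (dpe r p * dpe r' p')"
proof -
  have "fps_const (ade (sc p' (E r'))) * dpe r p = dpe r p * fps_const (ade (sc p' (E r')))"
    using assms by (intro ade_commute_dpe) (simp_all add: br_sc_right)
  then have "dpe r p * (fps_const (ade (sc p' (E r'))) * f) = fps_const (ade (sc p' (E r'))) * (dpe r p * f)" for f
    by (simp only: mult.assoc[symmetric])
  then show ?thesis
    by (simp add: deriv_dpe[OF assms(1)] deriv_dpe[OF assms(2)] ade_add algebra_simps flip: fps_const_add)
qed

text \<open>A x_b(1) A^-1 is the exponential of ad(A e_b). If A e_b = X + Y and [X, Y] = 2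
  \<open>p5\<close> e_r5 commutes with both, this is exp X exp Y exp(-[X, Y]/2); the factor 2 in
  \<open>heis\<close> keeps the last exponent integral.\<close>

lemma conj_product:
  assumes A: "aut (A :: int mat)" "A' \<in> carrier_mat n n" "A * A' = 1\<^sub>m n" "A' * A = 1\<^sub>m n"
    and b: "b \<in> Phi T"
    and r: "r1 \<in> Phi T" "r2 \<in> Phi T" "r3 \<in> Phi T" "r4 \<in> Phi T" "r5 \<in> Phi T"
    and v: "mv n A (E b) = (sc p1 (E r1) + sc p2 (E r2)) + (sc p3 (E r3) + sc p4 (E r4))"
    and com: "B (E r1) (E r2) = (0 :: nat \<Rightarrow> int)" "B (E r3) (E r4) = (0 :: nat \<Rightarrow> int)"
    and cen: "\<And>r. r \<in> {r1, r2, r3, r4} \<Longrightarrow> B (E r5) (E r) = (0 :: nat \<Rightarrow> int) \<and> B (E r) (E r5) = (0 :: nat \<Rightarrow> int)"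
    and heis: "B (sc p1 (E r1) + sc p2 (E r2)) (sc p3 (E r3) + sc p4 (E r4)) = sc (2 * p5) (E r5)"
  shows "A * xm T N b 1 * A' = xm T N r1 p1 * xm T N r2 p2 * (xm T N r3 p3 * xm T N r4 p4) * xm T N r5 (- p5)"
proof -
  define X where "X = ade (sc p1 (E r1) + sc p2 (E r2))"
  define Y where "Y = ade (sc p3 (E r3) + sc p4 (E r4))"
  define C where "C = ade (sc p5 (E r5))"
  define U where "U = dpe r1 p1 * dpe r2 p2"
  define V where "V = dpe r3 p3 * dpe r4 p4"
  \<comment> \<open>The series of exp(- s^2 C): the coefficients of x_r5(- p5 u) placed at u =
    s^2.\<close>
  define W where "W = Abs_fps (\<lambda>j. if even j then fps_nth (dpe r5 (- p5)) (j div 2) else 0)"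
  define F where "F = Abs_fps (\<lambda>j. Endo (\<lambda>v. mv n A (Dd b j (mv n A' v))))"
  note autA = A(1)[unfolded aut_def, THEN conjunct2, rule_format]
  have cA: "A \<in> carrier_mat n n" using A(1) by (rule aut_carrier)
  have AA': "mv n A' (mv n A w) = w" for w :: "nat \<Rightarrow> int"
    using A(4) by (simp flip: mv_mult[OF A(2) cA])
  have appF: "app (fps_nth F j) w = mv n A (Dd b j (mv n A' w))" for j w
    unfolding F_def fps_nth_Abs_fps by (subst app_Endo) (simp_all add: vlin_add[OF vlin_Dd] mv_add)
  have dF: "fps_deriv F = fps_const (X + Y) * F"
  proof (rule fps_ext, rule endo_eqI)
    fix j w
    have "B (E b) (Dd b j w') = sc (1 + int j) (Dd b (Suc j) w')" for w'
      using Dd_comp[OF b, of 1 j w'] by (simp add: Dd_1[OF b, unfolded One_nat_def])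
    then have "sc (1 + int j) (mv n A (Dd b (Suc j) (mv n A' w))) = B (mv n A (E b)) (mv n A (Dd b j (mv n A' w)))"
      by (simp flip: mv_sc autA)
    then show "app (fps_nth (fps_deriv F) j) w = app (fps_nth (fps_const (X + Y) * F) j) w"
      by (simp add: app_fps_deriv appF v X_def Y_def br_add_left del: fps_deriv_nth fps_const_add)
  qed
  have F0: "fps_nth F 0 = 1"
    using A(3) by (intro endo_eqI) (simp add: appF flip: mv_mult[OF cA A(2)])
  have c0: "B (sc p5 (E r5)) (sc p (E r)) = (0 :: nat \<Rightarrow> int)" "B (sc p (E r)) (sc p5 (E r5)) = (0 :: nat \<Rightarrow> int)"
    if "r \<in> {r1, r2, r3, r4}" for p r
    using cen[OF that] by (simp_all add: br_sc_left br_sc_right)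
  have XY: "X * Y = Y * X + 2 * C"
  proof -
    have "ade (sc (2 * p5) (E r5)) = 2 * C"
      by (rule endo_eqI) (simp only: app_double app_ade C_def br_sc_left sc_sc mult.assoc)
    then show ?thesis unfolding X_def Y_def by (subst ade_bracket) (simp add: heis)
  qed
  have XC: "X * C = C * X"
    unfolding X_def C_def by (subst ade_bracket) (simp add: br_add_left c0, rule endo_eqI, simp)
  have YC: "Y * C = C * Y"
    unfolding Y_def C_def by (subst ade_bracket) (simp add: br_add_left c0, rule endo_eqI, simp)
  have Cd: "fps_const C * dpe r p = dpe r p * fps_const C" if "r \<in> {r1, r2, r3, r4}" for r p
    unfolding C_def using that r cen by (intro ade_commute_dpe) (auto simp: br_sc_right)
  have CU: "fps_const C * U = U * fps_const C" "fps_const C * V = V * fps_const C"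
    unfolding U_def V_def using Cd by (metis (no_types) insertI1 insertI2 mult.assoc)+
  have dW: "fps_deriv W = - (2 * fps_X * fps_const C * W)"
  proof (rule fps_ext, rule endo_eqI)
    fix j w
    have nth: "fps_nth (- (2 * fps_X * fps_const C * W)) j = (if j = 0 then 0 else - (2 * (C * fps_nth W (j - 1))))"
      by (simp add: mult.assoc numeral_fps_const)
    show "app (fps_nth (fps_deriv W) j) w = app (fps_nth (- (2 * fps_X * fps_const C * W)) j) w"
    proof (cases "even j")
      case True
      then show ?thesis unfolding nth app_fps_deriv by (cases j) (simp_all add: W_def)
    next
      case False
      then obtain l where l: "j = Suc (2 * l)" by (metis oddE Suc_eq_plus1)
      have D: "B (E r5) (Dd r5 l w) = sc (1 + int l) (Dd r5 (Suc l) w)"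
        using Dd_comp[OF r(5), of 1 l w] by (simp add: Dd_1[OF r(5), unfolded One_nat_def])
      have "app (fps_nth (fps_deriv W) j) w = sc (2 * (1 + int l)) (sc ((- p5) ^ Suc l) (Dd r5 (Suc l) w))"
        unfolding app_fps_deriv l by (simp add: W_def)
      also have "\<dots> = - sc 2 (B (sc p5 (E r5)) (sc ((- p5) ^ l) (Dd r5 l w)))"
        unfolding br_sc_left br_sc_right D by (simp add: fun_eq_iff vec_apply)
      also have "\<dots> = app (fps_nth (- (2 * fps_X * fps_const C * W)) j) w"
        unfolding nth by (simp add: l app_double app_two W_def C_def)
      finally show ?thesis .
    qed
  qed
  have W0: "fps_nth W 0 = 1" by (simp add: W_def dpe_0)
  have "F = U * V * W"
  proof (rule heisenberg_exp[OF XY XC YC _ _ CU(1) _ _ CU(2) dW W0 dF F0])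
    show "fps_deriv U = fps_const X * U" "fps_deriv V = fps_const Y * V"
      unfolding U_def V_def X_def Y_def by (rule deriv_dpe_pair; use r com in simp)+
  qed (simp_all add: U_def V_def dpe_0)
  have z: "fps_nth (dpe r p) k = 0" if "r \<in> {r1, r2, r3, r4, r5}" "k > 3" for r p k
    using that r by (intro dpe_zero) auto
  have WZ: "fps_nth W k = 0" if "k > 6" for k
    using that z[of r5 "k div 2"] by (auto simp: W_def)
  have totW: "(\<Sum>k\<le>6. fps_nth W k) = (\<Sum>k\<le>3. fps_nth (dpe r5 (- p5)) k)"
  proof -
    have "{..6::nat} = {0,1,2,3,4,5,6}" "{..3::nat} = {0,1,2,3}" by auto
    then show ?thesis by (simp add: W_def)
  qed
  \<comment> \<open>Each \<open>dpe\<close> has degree at most 3 in its own variable, so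
    \<open>U\<close> and \<open>V\<close> have degree at most 6 in s, and so does \<open>W\<close>,
    whose variable is s^2; together 18.\<close>
  note UT = fps_total_mult[of 3 "dpe r1 p1" 3 "dpe r2 p2", folded U_def, OF z z]
  note VT = fps_total_mult[of 3 "dpe r3 p3" 3 "dpe r4 p4", folded V_def, OF z z]
  note UVT = fps_total_mult[of 6 U 6 V]
  have UV: "(\<Sum>k\<le>12. fps_nth (U * V) k) = (\<Sum>k\<le>6. fps_nth U k) * (\<Sum>k\<le>6. fps_nth V k)" "\<And>k. k > 12 \<Longrightarrow> fps_nth (U * V) k = 0"
    using UVT UT VT by simp_all
  have tot: "(\<Sum>k\<le>18. fps_nth F k) = (\<Sum>k\<le>3. fps_nth (dpe r1 p1) k) * (\<Sum>k\<le>3. fps_nth (dpe r2 p2) k) *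
      ((\<Sum>k\<le>3. fps_nth (dpe r3 p3) k) * (\<Sum>k\<le>3. fps_nth (dpe r4 p4) k)) * (\<Sum>k\<le>3. fps_nth (dpe r5 (- p5)) k)"
    using fps_total_mult(1)[of 12 "U * V" 6 W] UV WZ UT(1) VT(1) totW unfolding \<open>F = U * V * W\<close> by simp
  have "(\<Sum>k\<le>18. fps_nth F k) = (\<Sum>k\<le>3. fps_nth F k)"
  proof (rule sum.mono_neutral_right)
    show "\<forall>i\<in>{..18} - {..3}. fps_nth F i = 0"
      by (auto intro!: endo_eqI simp: appF Dd_zero4[OF b])
  qed auto
  then have totF: "app (\<Sum>k\<le>18. fps_nth F k) w = mv n A (mv n (xm T N b 1) (mv n A' w))" for w
    by (simp add: mv_xm[OF b] sum_upto4 numeral_3_eq_3 numeral_2_eq_2 appF mv_add)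
  show ?thesis
  proof (rule mat_eqI_mv[of _ n])
    fix c
    let ?w = "uv c :: nat \<Rightarrow> int"
    have "mv n (A * xm T N b 1 * A') ?w = app (\<Sum>k\<le>18. fps_nth F k) ?w"
      unfolding totF using cA A(2) by (simp add: mv_mult[of _ n])
    also have "\<dots> = mv n (xm T N r1 p1 * xm T N r2 p2 * (xm T N r3 p3 * xm T N r4 p4) * xm T N r5 (- p5)) ?w"
      unfolding tot using r by (simp add: total_dpe mv_mult[of _ n])
    finally show "mv n (A * xm T N b 1 * A') ?w
      = mv n (xm T N r1 p1 * xm T N r2 p2 * (xm T N r3 p3 * xm T N r4 p4) * xm T N r5 (- p5)) ?w" .
  qed (use cA A(2) in simp_all)
qed

end

section \<open>Nodes belonging to the type\<close>

context chev begin

lemma Dd_E: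
  assumes "b \<in> Phi T" "g \<in> Phi T" "g \<noteq> b" "g \<noteq> vneg b"
  obtains i m and s :: "nat \<Rightarrow> int" where "i \<le> m" "m \<le> (if T = F4 then 2 else 3)" "pstr T b g = i"
    "\<And>k. s k = 1 \<or> s k = - 1"
    "\<And>k. k \<le> m - i \<Longrightarrow> vadd g (vsmul (int k) b) \<in> Phi T"
    "\<And>k. Dd b k (E g) = (if k \<le> m - i
        then sc (of_int (s k * int ((i + k) choose k))) (E (vadd g (vsmul (int k) b))) else (0 :: nat \<Rightarrow> 'b::comm_ring_1))"
    "2 * ip T g b = (2 * int i - int m) * ip T b b"
    "\<And>k. -1 \<le> k \<Longrightarrow> k \<le> 4 \<Longrightarrow> vadd g (vsmul (k - int i) b) \<in> Phi T \<longleftrightarrow> 0 \<le> k \<and> k \<le> int m"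
proof -
  obtain i m s where im: "i \<le> m" "m \<le> (if T = F4 then 2 else 3)"
    "slstr b m (\<lambda>k. sc (s k) (E (vadd g (vsmul (int k - int i) b))))" "\<And>k. s k = 1 \<or> s k = - 1"
    "2 * ip T g b = (2 * int i - int m) * ip T b b" "pstr T b g = i"
    "\<And>k. -1 \<le> k \<Longrightarrow> k \<le> 4 \<Longrightarrow> vadd g (vsmul (k - int i) b) \<in> Phi T \<longleftrightarrow> 0 \<le> k \<and> k \<le> int m"
    by (rule slstr_root[OF assms]) blast
  let ?f = "\<lambda>k. sc (s k) (E (vadd g (vsmul (int k - int i) b))) :: nat \<Rightarrow> int"
  have m3: "m \<le> 3" using im(2) by (auto split: if_splits)
  have g0: "vadd g (vsmul (int i - int i) b) = g" using assms by (auto simp: list_eq_iff_nth_eq Phi_length)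
  have ss: "s i * s i = 1" using im(4)[of i] by auto
  then have Eg: "E g = sc (s i) (?f i)" using g0 by simp
  have mem: "vadd g (vsmul (int k) b) \<in> Phi T" if "k \<le> m - i" for k
    using im(7)[of "int k + int i"] that im(1) m3 by simp
  have D: "Dd b k (E g) = (if k \<le> m - i
        then sc (of_int (s i * s (i + k) * int ((i + k) choose k))) (E (vadd g (vsmul (int k) b))) else (0 :: nat \<Rightarrow> 'b))" for k
  proof -
    have "Dd b k (E g) = sc (s i) (Dd b k (?f i))" unfolding Eg by (rule vlin_sc[OF vlin_Dd])
    also have "\<dots> = (if k \<le> m - i then sc (s i * s (i + k) * int ((i + k) choose k)) (E (vadd g (vsmul (int k) b))) else 0)"
      unfolding Dd_slstr[OF assms(1) im(3,1)] using im(1) by (auto simp: ac_simps)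
    finally have "emb (Dd b k (E g)) = (emb (if k \<le> m - i then sc (s i * s (i + k) * int ((i + k) choose k)) (E (vadd g (vsmul (int k) b))) else 0) :: nat \<Rightarrow> 'b)"
      by simp
    then show ?thesis by (auto simp: Dd_emb[symmetric])
  qed
  have sg: "s i * s (i + k) = 1 \<or> s i * s (i + k) = - 1" for k using im(4)[of i] im(4)[of "i + k"] by auto
  show thesis by (rule that[OF im(1,2,6) sg mem D im(5,7)])
qed

lemma nr_neg_one: "nr T N b (- 1) = (nm T N b (- 1) (- 1) :: 'a::field mat)"
  by (simp add: nr_eq_nm inverse_minus_eq)

lemma nr_one: "nr T N b 1 = (nm T N b 1 1 :: 'a::field mat)"
  by (simp add: nr_eq_nm)

lemma x_neg_eq:
  assumes "d \<in> Phi T"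
  shows "xr T N (vneg d) (1::'a::field) = xr T N d 1 * (nr T N d (- 1) * xr T N d 1)"
proof -
  have e: "nr T N d (- 1) = xr T N d (- 1) * (xr T N (vneg d) 1 * xr T N d (- 1 :: 'a))"
    unfolding nr_def by (simp add: inverse_minus_eq mat_assoc)
  have "xr T N d 1 * (nr T N d (- 1) * xr T N d 1)
      = (xr T N d 1 * xr T N d (- 1)) * (xr T N (vneg d) 1 * (xr T N d (- 1) * xr T N d (1::'a)))"
    unfolding e by (simp add: mat_assoc)
  then show ?thesis using xr_inverse[OF assms, of "1::'a"] by simp
qed

text \<open>If the word for w0, a word in the Weyl group of P and the reflection in \<open>d\<close>
  multiply to the identity on the roots, then the corresponding product of representatives acts by
  signs and lies in the torus, hence in P. Solving for the representative of \<open>d\<close> places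
  it in P w0 P.\<close>

lemma word_PwP:
  assumes K: "K \<subseteq> S T" "set ws \<subseteq> K" and d: "d \<in> Phi T"
    and triv: "\<And>g. g \<in> Phi T \<Longrightarrow> foldr (refl T) (w0_word T) (foldr (refl T) ws (reflr T d g)) = g"
  obtains p1 p2 where "p1 \<in> P K" "p2 \<in> P K" "nr T N d (- 1) = p1 * (w0_rep T N * (p2 :: 'a::field mat))"
proof -
  let ?rt = "\<lambda>ws. map (\<lambda>i. sroot T (i - 1)) ws"
  let ?bs = "?rt (w0_word T) @ ?rt ws @ [d]"
  have wsP: "set (?rt ws) \<subseteq> Phi T" using K S_index by (auto simp: subset_iff)
  have bsP: "set ?bs \<subseteq> Phi T" using wsP w0_word_roots d by auto
  have fr: "foldr (reflr T) (?rt us) g = foldr (refl T) us g" for us g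
    by (induction us) (simp_all add: refl_def reflr_def)
  have fb: "foldr (reflr T) ?bs g = g" if "g \<in> Phi T" for g
    using triv[OF that] by (simp only: foldr_append fr foldr.simps o_apply id_apply)
  \<comment> \<open>The signs are collected over the integers, where \<open>sign_diag_torus\<close>
    applies.\<close>
  define \<epsilon> where "\<epsilon> g = (SOME \<epsilon>::int. (\<epsilon> = 1 \<or> \<epsilon> = - 1) \<and> mv n (wmat ?bs) (E g) = sc \<epsilon> (E g :: nat \<Rightarrow> int))" for g
  have e: "(\<epsilon> g = 1 \<or> \<epsilon> g = - 1) \<and> mv n (wmat ?bs) (E g) = sc (\<epsilon> g) (E g :: nat \<Rightarrow> int)" if "g \<in> Phi T" for g
  proof -
    have "\<exists>\<epsilon>::int. (\<epsilon> = 1 \<or> \<epsilon> = - 1) \<and> mv n (wmat ?bs) (E g) = sc \<epsilon> (E g :: nat \<Rightarrow> int)"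
      using conjunct2[OF wmat_E[OF bsP that, where 'b = int]] unfolding fb[OF that] by simp
    then show ?thesis unfolding \<epsilon>_def by (rule someI_ex)
  qed
  have "(map_mat of_int (wmat ?bs) :: 'a mat) \<in> torus"
    by (rule sign_diag_torus[where \<epsilon> = \<epsilon>]) (use e aut_wmat[OF bsP] in \<open>auto simp: map_wmat\<close>)
  then have tau: "(wmat ?bs :: 'a mat) \<in> P K" using torus_P by (auto simp: map_wmat)
  have split: "wmat ?bs = w0_rep T N * (wmat (?rt ws) * (nr T N d 1 :: 'a mat))"
    by (simp add: wmat_append w0_rep_wmat wmat_Cons wmat_Nil nr_one mat_assoc)
  obtain q where q: "q \<in> P K" "q * (wmat ?bs :: 'a mat) = 1\<^sub>m n" using P_inverse[OF K(1) tau] by blast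
  have wP: "(wmat (?rt ws) :: 'a mat) \<in> P K" by (rule wmat_P[OF K])
  have nn: "nr T N d 1 * nr T N d (- 1) = (1\<^sub>m n :: 'a mat)"
    using nm_inverse[OF d, of 1 1] by (simp add: nr_one nr_neg_one)
  note c [simp] = P_carrier[OF q(1)]
  have "nr T N d (- 1) = (q * wmat ?bs) * nr T N d (- 1)" using q(2) by simp
  also have "\<dots> = q * (w0_rep T N * (wmat (?rt ws) * (nr T N d 1 * nr T N d (- 1))))"
    unfolding split by (simp add: mat_assoc)
  also have "\<dots> = q * (w0_rep T N * wmat (?rt ws))" unfolding nn by simp
  finally show thesis using that[OF q(1) wP] by blast
qed

section \<open>Conjugacy of short root elements\<close>

lemma conj_trans:
  assumes "k \<in> G" "k * x = y * k" "k' \<in> G" "k' * y = z * k'" "x \<in> carrier_mat n n" "y \<in> carrier_mat n n" "z \<in> carrier_mat n n"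
  shows "k' * k \<in> G \<and> k' * k * x = z * (k' * k)"
proof -
  note c = G_carrier[OF assms(1)] G_carrier[OF assms(3)] assms(5-7)
  have "k' * k * x = k' * (y * k)" using c by (simp add: mat_assoc assms(2))
  also have "\<dots> = (k' * y) * k" using c by (simp add: mat_assoc)
  also have "\<dots> = z * (k' * k)" unfolding assms(4) using c by (simp add: mat_assoc)
  finally show ?thesis using G_mult[OF assms(3,1)] by blast
qed

lemma conj_sym:
  assumes "k \<in> G" "k * x = y * k" "x \<in> carrier_mat n n" "y \<in> carrier_mat n n"
  obtains k' where "k' \<in> G" "k' * y = x * k'"
proof -
  obtain k' where k': "k' \<in> G" "k * k' = 1\<^sub>m n" "k' * k = 1\<^sub>m n" by (rule G_inverse[OF assms(1)])
  note c = G_carrier[OF assms(1)] G_carrier[OF k'(1)] assms(3,4)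
  have "k' * y = k' * y * (k * k')" using c k' by simp
  also have "\<dots> = k' * (y * k) * k'" using c by (simp add: mat_assoc)
  also have "\<dots> = (k' * k) * x * k'" unfolding assms(2)[symmetric] using c by (simp add: mat_assoc)
  finally show thesis using that k' c by simp
qed

text \<open>For inner product 1 the difference is a short root whose reflection exchanges the two;
  for -1 one passes through -b. Inner product 0 occurs only in F4, where the difference is a long
  root.\<close>

lemma short_reflections:
  assumes "short_root T a" "short_root T b"
  shows "a = b \<or> (\<exists>g\<in>Phi T. reflr T g a = b) \<or> (\<exists>g\<in>Phi T. \<exists>h\<in>Phi T. reflr T h (reflr T g a) = b)"
proof -
  have ab: "a \<in> Phi T" "b \<in> Phi T" "ip T a a = 2" "ip T b b = 2" using assms by (auto simp: short_root_def)
  have lg: "length a = rank T" "length b = rank T" using ab by (auto simp: Phi_length)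
  have key: "\<exists>g\<in>Phi T. reflr T g a = b" if "b \<in> Phi T" "ip T b b = 2" "ip T a b = 1" for b
  proof -
    have lb: "length b = rank T" using that by (simp add: Phi_length)
    let ?d = "vadd a (vneg b)"
    have n: "ip T ?d ?d = 2" using that ab lg lb by (simp add: ip_lin ip_sym[of b T a])
    then have d: "?d \<in> Phi T" using lg lb by (simp add: Phi_iff)
    have "cartan_int T a ?d = 1" using d n that ab lg lb by (intro cartan_int_eqI) (auto simp: ip_lin)
    then have "reflr T ?d a = b" using lg lb by (auto simp: reflr_def list_eq_iff_nth_eq)
    with d show ?thesis by blast
  qed
  have negb: "reflr T b (vneg b) = b"
    using lg cartan_neg[OF ab(2) lg(2)] cartan_self[OF ab(2)] by (auto simp: reflr_def list_eq_iff_nth_eq)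
  show ?thesis
  proof (cases "a = b \<or> a = vneg b")
    case True
    then show ?thesis using negb ab(2) by blast
  next
    case False
    then have "ip T a b \<in> {-1, 0, 1}" using ip_root_cases[OF ab(2,1)] ab by auto
    then consider "ip T a b = 1" | "ip T a b = - 1" | "ip T a b = 0" by auto
    then show ?thesis
    proof cases
      case 1 then show ?thesis using key[OF ab(2,4)] by blast
    next
      case 2
      then have "ip T a (vneg b) = 1" "ip T (vneg b) (vneg b) = 2" using lg ab by (simp_all add: ip_lin)
      with key[of "vneg b"] ab obtain g where "g \<in> Phi T" "reflr T g a = vneg b" by auto
      then show ?thesis using negb ab(2) by metis
    next
      case 3
      let ?d = "vadd a (vneg b)"
      have n: "ip T ?d ?d = 4" using 3 ab lg by (simp add: ip_lin ip_sym[of b T a])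
      show ?thesis
      proof (cases T)
        case F4
        then have d: "?d \<in> Phi T" using n lg by (simp add: Phi_iff)
        have "cartan_int T a ?d = 1" using d n 3 ab lg by (intro cartan_int_eqI) (auto simp: ip_lin)
        then have "reflr T ?d a = b" using lg by (auto simp: reflr_def list_eq_iff_nth_eq)
        with d show ?thesis by blast
      next
        case G2
        have "\<forall>a\<in>set (root_enum G2). \<forall>b\<in>set (root_enum G2). ip G2 a a = 2 \<longrightarrow> ip G2 b b = 2 \<longrightarrow> ip G2 a b \<noteq> 0"
          by (simp add: root_enum_def ip_G2)
        then show ?thesis using 3 ab G2 by (auto simp: Phi_eq)
      qed
    qed
  qed
qed

text \<open>The sign is fixed before \<open>t\<close>: \<open>short_conj\<close> has to know the
  sign of its last conjugation when it rescales the parameter in between.\<close>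

lemma short_conj_sign:
  assumes "short_root T a" "short_root T b"
  obtains \<epsilon> :: int where "\<epsilon> = 1 \<or> \<epsilon> = - 1" "\<And>t::'a::field. \<exists>k\<in>G. k * xr T N a t = xr T N b (of_int \<epsilon> * t) * k"
proof -
  have step: "\<exists>\<epsilon>::int. (\<epsilon> = 1 \<or> \<epsilon> = - 1) \<and> (\<forall>t::'a. \<exists>k\<in>G. k * xr T N c t = xr T N (reflr T g c) (of_int \<epsilon> * t) * k)"
    if c: "c \<in> Phi T" and g: "g \<in> Phi T" for c g
  proof -
    obtain \<epsilon> :: int where "\<epsilon> = 1 \<or> \<epsilon> = - 1"
      "\<And>t. nm T N g 1 1 * xm T N c t = xm T N (reflr T g c) (of_int \<epsilon> * t) * (nm T N g 1 1 :: 'a mat)"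
      by (rule nm_conj[OF g c]) blast
    then show ?thesis using nr_G[OF g, of "1::'a"] unfolding nr_one xr_eq_xm by blast
  qed
  have a: "a \<in> Phi T" using assms by (simp add: short_root_def)
  from short_reflections[OF assms] consider "a = b" | g where "g \<in> Phi T" "reflr T g a = b"
    | g h where "g \<in> Phi T" "h \<in> Phi T" "reflr T h (reflr T g a) = b" by blast
  then show thesis
  proof cases
    case 1
    show thesis by (rule that[of 1]) (use 1 in \<open>auto intro!: bexI[OF _ G_one]\<close>)
  next
    case 2
    then show thesis using step[OF a 2(1)] that by blast
  next
    case 3
    obtain \<epsilon>1 :: int where 1: "\<epsilon>1 = 1 \<or> \<epsilon>1 = - 1" "\<And>t::'a. \<exists>k\<in>G. k * xr T N a t = xr T N (reflr T g a) (of_int \<epsilon>1 * t) * k"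
      using step[OF a 3(1)] by blast
    obtain \<epsilon>2 :: int where 2: "\<epsilon>2 = 1 \<or> \<epsilon>2 = - 1" "\<And>t::'a. \<exists>k\<in>G. k * xr T N (reflr T g a) t = xr T N b (of_int \<epsilon>2 * t) * k"
      using step[OF reflr_Phi[OF 3(1) a] 3(2)] unfolding 3(3) by blast
    show thesis
    proof (rule that[of "\<epsilon>2 * \<epsilon>1"])
      show "\<epsilon>2 * \<epsilon>1 = 1 \<or> \<epsilon>2 * \<epsilon>1 = - 1" using 1(1) 2(1) by auto
      fix t :: 'a
      obtain k k' where "k \<in> G" "k * xr T N a t = xr T N (reflr T g a) (of_int \<epsilon>1 * t) * k"
        "k' \<in> G" "k' * xr T N (reflr T g a) (of_int \<epsilon>1 * t) = xr T N b (of_int \<epsilon>2 * (of_int \<epsilon>1 * t)) * k'"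
        using 1(2) 2(2) by meson
      from conj_trans[OF this] show "\<exists>k\<in>G. k * xr T N a t = xr T N b (of_int (\<epsilon>2 * \<epsilon>1) * t) * k"
        by (auto simp: mult.assoc)
    qed
  qed
qed

text \<open>With a pairing equal to 1, torus elements \<open>hr\<close> rescale the parameter by
  every nonzero scalar and not only by squares.\<close>

lemma short_scaling: "\<exists>a g. short_root T a \<and> g \<in> Phi T \<and> cartan_int T a g = 1"
proof (cases T)
  case F4
  have "short_root F4 [0,0,0,1] \<and> [0,0,1,1] \<in> Phi F4 \<and> cartan_int F4 [0,0,0,1] [0,0,1,1] = 1"
    by (simp add: short_root_def Phi_iff ip_F4 cartan_int_def)
  then show ?thesis using F4 by blast
next
  case G2
  have "short_root G2 [1,0] \<and> [3,1] \<in> Phi G2 \<and> cartan_int G2 [1,0] [3,1] = 1"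
    by (simp add: short_root_def Phi_iff ip_G2 cartan_int_def)
  then show ?thesis using G2 by blast
qed

lemma short_conj:
  assumes "short_root T a" "short_root T b" "(t::'a::field) \<noteq> 0"
  obtains k where "k \<in> G" "k * xr T N a t = xr T N b 1 * k"
proof -
  obtain c g where c: "short_root T c" "g \<in> Phi T" "cartan_int T c g = 1" using short_scaling by blast
  then have cP: "c \<in> Phi T" by (simp add: short_root_def)
  obtain \<epsilon>1 :: int where 1: "\<epsilon>1 = 1 \<or> \<epsilon>1 = - 1" "\<And>t::'a. \<exists>k\<in>G. k * xr T N a t = xr T N c (of_int \<epsilon>1 * t) * k"
    by (rule short_conj_sign[OF assms(1) c(1)]) blast
  obtain \<epsilon>2 :: int where 2: "\<epsilon>2 = 1 \<or> \<epsilon>2 = - 1" "\<And>t::'a. \<exists>k\<in>G. k * xr T N c t = xr T N b (of_int \<epsilon>2 * t) * k"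
    by (rule short_conj_sign[OF c(1) assms(2)]) blast
  let ?u = "of_int \<epsilon>1 * t" and ?v = "of_int \<epsilon>2 :: 'a"
  have nz: "?u \<noteq> 0" "?v \<noteq> 0" "?v * ?v = 1" using 1(1) 2(1) assms(3) by auto
  obtain k where k: "k \<in> G" "k * xr T N a t = xr T N c ?u * k" using 1(2) by blast
  have h: "hr T N g (?v / ?u) * xr T N c ?u = xr T N c ?v * hr T N g (?v / ?u)"
    using hr_xr_conj[OF c(2) _ cP, of "?v / ?u" ?u] nz c(3) by simp
  obtain k' where k': "k' \<in> G" "k' * xr T N c ?v = xr T N b 1 * k'" using 2(2)[of ?v] nz by auto
  from conj_trans[OF k hr_G[OF c(2)] h] have "hr T N g (?v / ?u) * k \<in> G"
    "hr T N g (?v / ?u) * k * xr T N a t = xr T N c ?v * (hr T N g (?v / ?u) * k)" by simp_all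
  from conj_trans[OF this k'] show thesis using that by auto
qed

lemma Type_memI:
  assumes "short_root T a" "short_root T b" "(t::'a::field) \<noteq> 0" "i \<in> S T"
    and y: "k \<in> G" "k * xr T N b 1 = y * k" "(y :: 'a mat) \<in> carrier_mat n n"
    and p: "p1 \<in> P (S T - {i})" "p2 \<in> P (S T - {i})" "y = p1 * (w0_rep T N * p2)"
  shows "i \<in> Type T N (xr T N a t)"
proof -
  have a: "a \<in> Phi T" using assms by (simp add: short_root_def)
  obtain l where l: "l \<in> G" "l * xr T N a t = xr T N b 1 * l" by (rule short_conj[OF assms(1-3)])
  from conj_trans[OF l y(1,2)] y(3) have "k * l \<in> G" "k * l * xr T N a t = y * (k * l)" by simp_all
  then obtain g where "g \<in> G" "g * y = xr T N a t * g" by (rule conj_sym) (use y(3) in simp_all)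
  then show ?thesis using assms(4) p Type_iff[OF xr_G[OF a]] by metis
qed

lemma Type_mem_short:
  assumes "short_root T a" "short_root T d" "(t::'a::field) \<noteq> 0" "i \<in> S T" "pos_root T d"
    and w: "set ws \<subseteq> S T - {i}"
      "\<And>g. g \<in> Phi T \<Longrightarrow> foldr (refl T) (w0_word T) (foldr (refl T) ws (reflr T d g)) = g"
  shows "i \<in> Type T N (xr T N a t)"
proof -
  let ?K = "S T - {i}"
  have d: "d \<in> Phi T" using assms by (simp add: short_root_def)
  have nd: "short_root T (vneg d)" using assms(2) by (auto simp: short_root_def ip_lin Phi_length)
  obtain p1 p2 where p: "p1 \<in> P ?K" "p2 \<in> P ?K" "nr T N d (- 1) = p1 * (w0_rep T N * (p2 :: 'a mat))"
    by (rule word_PwP[OF _ w(1) d w(2)]) auto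
  note c [simp] = P_carrier[OF p(1)] P_carrier[OF p(2)]
  have "xr T N (vneg d) 1 = (xr T N d 1 * p1) * (w0_rep T N * (p2 * xr T N d 1))"
    unfolding x_neg_eq[OF d] p(3) by (simp add: mat_assoc)
  moreover have "1\<^sub>m n * xr T N (vneg d) 1 = xr T N (vneg d) (1::'a) * 1\<^sub>m n" by simp
  ultimately show ?thesis
    by (intro Type_memI[OF assms(1) nd assms(3,4) G_one _ xr_carrier
        P_mult[OF xr_pos_P[OF assms(5)] p(1)] P_mult[OF p(2) xr_pos_P[OF assms(5)]]])
qed


section \<open>Products of long and short root elements\<close>

lemma B_zero:
  assumes "r \<in> Phi T" "r' \<in> Phi T" "vadd r r' \<notin> Phi T" "r' \<noteq> vneg r"
  shows "B (E r) (E r') = 0" "B (E r') (E r) = 0"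
proof -
  show "B (E r) (E r') = 0" by (rule B_EE0[OF assms])
  have "vadd r' r = vadd r r'" using assms(1,2) by (intro vadd_comm) (simp add: Phi_length)
  then show "B (E r') (E r) = 0" using assms by (intro B_EE0) auto
qed

lemma map_mult_mat: "A \<in> carrier_mat n n \<Longrightarrow> A' \<in> carrier_mat n n \<Longrightarrow>
    map_mat of_int (A * A') = (map_mat of_int A * map_mat of_int A' :: 'b::comm_ring_1 mat)"
  by (rule of_int_hom.mat_hom_mult)

text \<open>x_g2(1) sends e_g1 to e_g1 + c e_{-h}: there are no further terms because g1 + 2 g2 is
  not a root. The two terms commute, so the conjugate is a product of two root elements. The
  absolute value of c will be the lacing number.\<close>

lemma short_pair_conj:
  assumes "h \<in> Phi T" "g1 \<in> Phi T" "g2 \<in> Phi T" "g1 \<noteq> g2" "g1 \<noteq> vneg g2"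
    "vadd g2 g1 = vneg h" "vadd g1 (vsmul 2 g2) \<notin> Phi T" "vadd (vneg h) g1 \<notin> Phi T" "g1 \<noteq> h"
  obtains c :: int where "\<bar>c\<bar> = int (pstr T g2 g1) + 1"
    "xr T N g2 1 * xr T N g1 1 = xr T N (vneg h) (of_int c) * xr T N g1 1 * (xr T N g2 1 :: 'a::field mat)"
proof -
  have nh: "vneg h \<in> Phi T" using assms by simp
  have lg: "length g1 = rank T" "length g2 = rank T" using assms by (auto simp: Phi_length)
  obtain i m and s :: "nat \<Rightarrow> int" where im: "i \<le> m" "m \<le> (if T = F4 then 2 else 3)" "pstr T g2 g1 = i"
    "\<And>k. s k = 1 \<or> s k = - 1" "\<And>k. k \<le> m - i \<Longrightarrow> vadd g1 (vsmul (int k) g2) \<in> Phi T"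
    "\<And>k. Dd g2 k (E g1) = (if k \<le> m - i
        then sc (of_int (s k * int ((i + k) choose k))) (E (vadd g1 (vsmul (int k) g2))) else (0 :: nat \<Rightarrow> int))"
    "2 * ip T g1 g2 = (2 * int i - int m) * ip T g2 g2"
    "\<And>k. -1 \<le> k \<Longrightarrow> k \<le> 4 \<Longrightarrow> vadd g1 (vsmul (k - int i) g2) \<in> Phi T \<longleftrightarrow> 0 \<le> k \<and> k \<le> int m"
    by (rule Dd_E[OF assms(3,2,4,5), where 'b = int]) blast
  have m3: "m \<le> 3" using im(2) by (auto split: if_splits)
  have e1: "vadd g1 (vsmul 1 g2) = vneg h" using lg assms(6) by (simp add: vsmul_def vadd_comm)
  have "\<not> 2 \<le> m - i" using im(5)[of 2] assms(7) by auto
  moreover have "1 \<le> m - i" using im(8)[of "int i + 1"] nh e1 im(1) m3 by auto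
  ultimately have mi: "m - i = 1" by auto
  define c where "c = s 1 * (1 + int i)"
  have c: "\<bar>c\<bar> = int (pstr T g2 g1) + 1" using im(3) im(4)[of 1] by (auto simp: c_def abs_mult)
  have D: "Dd g2 1 (E g1) = (sc c (E (vneg h)) :: nat \<Rightarrow> int)" "Dd g2 2 (E g1) = (0 :: nat \<Rightarrow> int)" "Dd g2 3 (E g1) = (0 :: nat \<Rightarrow> int)"
    using im(6)[of 1] im(6)[of 2] im(6)[of 3] e1 by (simp_all add: mi c_def)
  note z = B_zero[OF nh assms(2) assms(8)] B_EE_self[OF nh]
  have z': "B (E (vneg h)) (E g1) = (0 :: nat \<Rightarrow> int)" "B (E g1) (E (vneg h)) = (0 :: nat \<Rightarrow> int)" using z assms(9) by auto
  have inv: "xm T N g2 1 * xm T N g2 (- 1) = (1\<^sub>m n :: int mat)" "xm T N g2 (- 1) * xm T N g2 1 = (1\<^sub>m n :: int mat)"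
    using xm_inverse[OF assms(3), of "1::int"] xm_inverse[OF assms(3), of "- 1 :: int"] by simp_all
  \<comment> \<open>\<open>conj_product\<close> with trivial second pair and trivial centre: these
    slots carry coefficient 0 and are filled with -h.\<close>
  have "xm T N g2 1 * xm T N g1 1 * xm T N g2 (- 1)
    = xm T N (vneg h) c * xm T N g1 1 * (xm T N (vneg h) 0 * xm T N (vneg h) 0) * xm T N (vneg h) (- 0 :: int)"
  proof (rule conj_product[OF aut_xm[OF assms(3)] xm_carrier inv assms(2) nh assms(2) nh nh nh])
    show "mv n (xm T N g2 1) (E g1) = sc c (E (vneg h)) + sc 1 (E g1) + (sc 0 (E (vneg h)) + sc 0 (E (vneg h)))"
      using D by (simp add: mv_xm[OF assms(3)] sum_upto4)
  qed (use z' z in \<open>auto simp: br_add_left\<close>)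
  then have "xm T N g2 1 * xm T N g1 1 * xm T N g2 (- 1) = xm T N (vneg h) c * (xm T N g1 1 :: int mat)"
    by (simp add: xm_zero[OF nh])
  then have "xm T N g2 1 * xm T N g1 1 * (xm T N g2 (- 1) * xm T N g2 1) = xm T N (vneg h) c * xm T N g1 1 * (xm T N g2 1 :: int mat)"
    by (metis mat_assoc mat_closed xm_carrier)
  then have "xm T N g2 1 * xm T N g1 1 = xm T N (vneg h) c * xm T N g1 1 * (xm T N g2 1 :: int mat)"
    by (simp add: inv)
  then have "map_mat of_int (xm T N g2 1 * xm T N g1 1) = (map_mat of_int (xm T N (vneg h) c * xm T N g1 1 * xm T N g2 1) :: 'a mat)"
    by simp
  then have "xr T N g2 1 * xr T N g1 1 = xr T N (vneg h) (of_int c) * xr T N g1 1 * (xr T N g2 1 :: 'a mat)"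
    by (simp add: map_mult_mat map_xm xr_eq_xm)
  with c that show thesis by blast
qed

text \<open>In the applications \<open>h\<close> is the highest root. The torus element of
  \<open>rho\<close> normalises the parameter at -h, and \<open>r1\<close> to \<open>r5\<close>
  carry the expansion needed to move x_h(1) past x_g1(1). The root \<open>r1\<close> is kept apart
  because it may be negative; only its reflection in \<open>h\<close> has to be positive.\<close>

lemma Type_mem_long:
  assumes a: "short_root T a" "(t::'a::field) \<noteq> 0" "i \<in> S T"
    and g: "short_root T g1" "h \<in> Phi T" "g2 \<in> Phi T" "g1 \<noteq> g2" "g1 \<noteq> vneg g2" "g1 \<noteq> h"
      "vadd g2 g1 = vneg h" "vadd g1 (vsmul 2 g2) \<notin> Phi T" "vadd (vneg h) g1 \<notin> Phi T"
    and char: "(of_nat (pstr T g2 g1 + 1) :: 'a) \<noteq> 0"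
    and rho: "\<rho> \<in> Phi T" "cartan_int T g1 \<rho> = 0" "cartan_int T h \<rho> = 1"
    and r: "r1 \<in> Phi T" "r2 \<in> Phi T" "r4 \<in> Phi T" "r5 \<in> Phi T"
    and v: "(mv n (xm T N g1 (- 1)) (E h) :: nat \<Rightarrow> int) = (sc p1 (E r1) + sc p2 (E r2)) + (sc 1 (E h) + sc p4 (E r4))"
    and com: "B (E r1) (E r2) = (0 :: nat \<Rightarrow> int)" "B (E h) (E r4) = (0 :: nat \<Rightarrow> int)"
    and cen: "\<And>r. r \<in> {r1, r2, h, r4} \<Longrightarrow> B (E r5) (E r) = (0 :: nat \<Rightarrow> int) \<and> B (E r) (E r5) = (0 :: nat \<Rightarrow> int)"
    and heis: "B (sc p1 (E r1) + sc p2 (E r2)) (sc 1 (E h) + sc p4 (E r4)) = (sc (2 * p5) (E r5) :: nat \<Rightarrow> int)"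
    and pos: "pos_root T h" "pos_root T (reflr T h g1)" "pos_root T (reflr T h r1)" "pos_root T r2" "pos_root T r4" "pos_root T r5"
    and w: "set ws \<subseteq> S T - {i}"
      "\<And>g. g \<in> Phi T \<Longrightarrow> foldr (refl T) (w0_word T) (foldr (refl T) ws (reflr T h g)) = g"
  shows "i \<in> Type T N (xr T N a t)"
proof -
  let ?K = "S T - {i}"
  have g1: "g1 \<in> Phi T" using g(1) by (simp add: short_root_def)
  have nh: "vneg h \<in> Phi T" using g by simp
  have lh: "length h = rank T" using g by (simp add: Phi_length)
  obtain c :: int where c: "\<bar>c\<bar> = int (pstr T g2 g1) + 1"
    "xr T N g2 1 * xr T N g1 1 = xr T N (vneg h) (of_int c) * xr T N g1 1 * (xr T N g2 1 :: 'a mat)"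
    by (rule short_pair_conj[OF g(2) g1 g(3,4,5,7,8,9,6)]) blast
  have c0: "(of_int c :: 'a) \<noteq> 0"
  proof -
    have "c = int (pstr T g2 g1 + 1) \<or> c = - int (pstr T g2 g1 + 1)" using c(1) by auto
    then show ?thesis using char by (metis of_int_minus of_int_of_nat_eq neg_equal_0_iff_equal)
  qed
  let ?y = "xr T N (vneg h) 1 * xr T N g1 1 :: 'a mat" and ?H = "hr T N \<rho> (of_int c) :: 'a mat"
  \<comment> \<open>The pairings 1 with h and 0 with g1 let this torus element change x_{-h}(c) into
    x_{-h}(1) without affecting x_g1(1).\<close>
  have H: "?H * xr T N (vneg h) (of_int c) = xr T N (vneg h) 1 * ?H" "?H * xr T N g1 1 = xr T N g1 1 * ?H"
    using hr_xr_conj[OF rho(1) c0 nh, of "of_int c"] hr_xr_conj[OF rho(1) c0 g1, of 1] rho c0 cartan_neg[OF rho(1) lh]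
    by (simp_all add: power_int_minus)
  have y1: "?H * (xr T N (vneg h) (of_int c) * xr T N g1 1) = ?y * ?H"
  proof -
    have "?H * (xr T N (vneg h) (of_int c) * xr T N g1 1) = (?H * xr T N (vneg h) (of_int c)) * xr T N g1 1"
      by (simp add: mat_assoc)
    also have "\<dots> = xr T N (vneg h) 1 * (?H * xr T N g1 1)" unfolding H(1) by (simp add: mat_assoc)
    also have "\<dots> = ?y * ?H" unfolding H(2) by (simp add: mat_assoc)
    finally show ?thesis .
  qed
  from conj_trans[OF xr_G[OF g(3)] c(2) hr_G[OF rho(1)] y1]
  have k: "?H * xr T N g2 1 \<in> G" "?H * xr T N g2 1 * xr T N g1 1 = ?y * (?H * xr T N g2 1)" by simp_all
  obtain q1 q2 where q: "q1 \<in> P ?K" "q2 \<in> P ?K" "nr T N h (- 1) = q1 * (w0_rep T N * (q2 :: 'a mat))"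
    by (rule word_PwP[OF _ w(1) g(2) w(2)]) auto
  have inv: "xm T N g1 (- 1) * xm T N g1 1 = (1\<^sub>m n :: int mat)" "xm T N g1 1 * xm T N g1 (- 1) = (1\<^sub>m n :: int mat)"
    using xm_inverse[OF g1, of "1::int"] xm_inverse[OF g1, of "- 1 :: int"] by simp_all
  let ?Z = "xm T N r1 p1 * xm T N r2 p2 * (xm T N h 1 * xm T N r4 p4) * xm T N r5 (- p5)"
  have "xm T N g1 (- 1) * xm T N h 1 * xm T N g1 1 = ?Z"
    by (rule conj_product[OF aut_xm[OF g1] xm_carrier inv g(2) r(1,2) g(2) r(3,4) v com cen heis])
  then have "xm T N g1 1 * ?Z = (xm T N g1 1 * xm T N g1 (- 1)) * (xm T N h 1 * xm T N g1 1)"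
    by (simp add: mat_assoc flip: \<open>xm T N g1 (- 1) * xm T N h 1 * xm T N g1 1 = ?Z\<close>)
  then have "xm T N h 1 * xm T N g1 1 = xm T N g1 1 * ?Z" by (simp add: inv)
  then have "map_mat of_int (xm T N h 1 * xm T N g1 1) = (map_mat of_int (xm T N g1 1 * ?Z) :: 'a mat)" by simp
  then have comm: "xr T N h 1 * xr T N g1 1 = xr T N g1 1 * (xr T N r1 (of_int p1) * xr T N r2 (of_int p2) *
      (xr T N h 1 * xr T N r4 (of_int p4)) * (xr T N r5 (of_int (- p5)) :: 'a mat))"
    by (simp add: map_mult_mat map_xm xr_eq_xm)
  obtain \<epsilon> :: int where e: "\<And>t. nr T N h (- 1) * xr T N g1 t = xr T N (reflr T h g1) (of_int \<epsilon> * t) * (nr T N h (- 1) :: 'a mat)"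
    by (rule nm_conj'[OF g(2) g1, where 'b = 'a]) (simp add: nr_neg_one xr_eq_xm)
  obtain \<epsilon>' :: int where e': "\<And>t. nr T N h (- 1) * xr T N r1 t = xr T N (reflr T h r1) (of_int \<epsilon>' * t) * (nr T N h (- 1) :: 'a mat)"
    by (rule nm_conj'[OF g(2) r(1), where 'b = 'a]) (simp add: nr_neg_one xr_eq_xm)
  let ?n = "nr T N h (- 1) :: 'a mat"
  \<comment> \<open>In x_h n_h x_g1 x_r1 R the factors at g1 and r1 are moved to the left through
    n_h, where the reflection makes their roots positive; R consists of positive root elements
    already.\<close>
  let ?R = "xr T N r2 (of_int p2) * ((xr T N h 1 * xr T N r4 (of_int p4)) * (xr T N r5 (of_int (- p5)) :: 'a mat))"
  let ?L = "xr T N h 1 * (xr T N (reflr T h g1) (of_int \<epsilon> * 1) * xr T N (reflr T h r1) (of_int \<epsilon>' * of_int p1)) :: 'a mat"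
  have R: "?R \<in> P ?K" by (intro P_mult xr_pos_P pos)
  have L: "?L \<in> P ?K" by (intro P_mult xr_pos_P pos)
  note cs [simp] = P_carrier[OF q(1)] P_carrier[OF q(2)]
  have "?y = xr T N h 1 * (?n * (xr T N h 1 * xr T N g1 1))"
    unfolding x_neg_eq[OF g(2)] by (simp add: mat_assoc)
  also have "\<dots> = xr T N h 1 * ((?n * xr T N g1 1) * (xr T N r1 (of_int p1) * ?R))"
    unfolding comm by (simp add: mat_assoc)
  also have "\<dots> = xr T N h 1 * (xr T N (reflr T h g1) (of_int \<epsilon> * 1) * ((?n * xr T N r1 (of_int p1)) * ?R))"
    unfolding e by (simp add: mat_assoc)
  also have "\<dots> = ?L * (?n * ?R)"
    unfolding e' by (simp add: mat_assoc)
  also have "\<dots> = (?L * q1) * (w0_rep T N * (q2 * ?R))"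
    unfolding q(3) by (simp add: mat_assoc)
  finally have y: "?y = (?L * q1) * (w0_rep T N * (q2 * ?R))" .
  show ?thesis
    by (rule Type_memI[OF a(1) g(1) a(2,3) k _ P_mult[OF L q(1)] P_mult[OF q(2) R] y]) simp
qed

end

section \<open>Explicit words and roots for the nodes in the type\<close>

lemma pos_root_code: "pos_root T v \<longleftrightarrow> v \<in> Phi T \<and> nonneg_vec v"
  by (simp add: pos_root_def nonneg_vec_def list_all_iff)

lemma foldr_w0_word_root: "v \<in> Phi T \<Longrightarrow> foldr (refl T) (w0_word T) v = vneg v"
  by (simp add: foldr_w0_word Phi_length)

lemma choose_two: "Suc (Suc 0) choose 2 = 1"
  by (simp add: numeral_2_eq_2)

text \<open>The highest short root [1,2,3,2] is orthogonal to the first three simple roots. The word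
  is the cube of a Coxeter element of their B3 subsystem, which is -1 on its span, and the
  reflection is -1 on the orthogonal line.\<close>

lemma F4_word_4:
  assumes "length g = 4"
  shows "foldr (refl F4) [1,2,3,1,2,3,1,2,3] (reflr F4 [1,2,3,2] g) = vneg g"
proof -
  obtain a b c d where g: "g = [a,b,c,d]" using assms by (rule length_4E)
  define f where "f = foldr (refl F4) [1,2,3]"
  have f1: "f [a,b,c,d] = [- a + (a - b + (2*b - c + d)), a - b + (2*b - c + d), 2*b - c + d, d]" for a b c d
    by (simp add: f_def refl_simps_F4 algebra_simps)
  have "cartan_int F4 g [1,2,3,2] = d" by (simp add: g cartan_int_def ip_F4)
  then have "reflr F4 [1,2,3,2] g = [a - d, b - 2*d, c - 3*d, d - 2*d]" by (simp add: reflr_def g)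
  moreover have "f (f (f [a - d, b - 2*d, c - 3*d, d - 2*d])) = vneg g" by (simp add: f1 g algebra_simps)
  moreover have "foldr (refl F4) [1,2,3,1,2,3,1,2,3] v = f (f (f v))" for v by (simp add: f_def)
  ultimately show ?thesis by simp
qed

text \<open>The same argument for the highest root [2,3,4,2], orthogonal to the C3 subsystem of the
  last three simple roots.\<close>

lemma F4_word_1:
  assumes "length g = 4"
  shows "foldr (refl F4) [2,3,4,2,3,4,2,3,4] (reflr F4 [2,3,4,2] g) = vneg g"
proof -
  obtain a b c d where g: "g = [a,b,c,d]" using assms by (rule length_4E)
  define f where "f = foldr (refl F4) [2,3,4]"
  have f1: "f [a,b,c,d] = [a, a - b + (2*b - c + (c - d)), 2*b - c + (c - d), c - d]" for a b c d
    by (simp add: f_def refl_simps_F4 algebra_simps)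
  have "cartan_int F4 g [2,3,4,2] = a" by (simp add: g cartan_int_def ip_F4)
  then have "reflr F4 [2,3,4,2] g = [a - 2*a, b - 3*a, c - 4*a, d - 2*a]" by (simp add: reflr_def g)
  moreover have "f (f (f [a - 2*a, b - 3*a, c - 4*a, d - 2*a])) = vneg g" by (simp add: f1 g algebra_simps)
  moreover have "foldr (refl F4) [2,3,4,2,3,4,2,3,4] v = f (f (f v))" for v by (simp add: f_def)
  ultimately show ?thesis by simp
qed

text \<open>The highest short root [2,1] is orthogonal to the long simple root, and two orthogonal
  reflections of the plane multiply to -1.\<close>

lemma G2_word_1:
  assumes "length g = 2" shows "foldr (refl G2) [2] (reflr G2 [2,1] g) = vneg g"
proof -
  obtain a b where g: "g = [a,b]" using assms by (rule length_2E)
  have "cartan_int G2 g [2,1] = a" by (simp add: g cartan_int_def ip_G2)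
  then have "reflr G2 [2,1] g = [a - 2*a, b - a]" by (simp add: reflr_def g)
  then show ?thesis by (simp add: refl_simps_G2 g)
qed

text \<open>Likewise, the highest root [3,2] is orthogonal to the short simple root.\<close>

lemma G2_word_2:
  assumes "length g = 2" shows "foldr (refl G2) [1] (reflr G2 [3,2] g) = vneg g"
proof -
  obtain a b where g: "g = [a,b]" using assms by (rule length_2E)
  have "cartan_int G2 g [3,2] = b" by (simp add: g cartan_int_def ip_G2)
  then have "reflr G2 [3,2] g = [a - 3*b, b - 2*b]" by (simp add: reflr_def g)
  then show ?thesis by (simp add: refl_simps_G2 g)
qed

context chev begin

lemma word_trivial:
  assumes "\<And>g. length g = rank T \<Longrightarrow> foldr (refl T) ws (reflr T d g) = vneg g" "g \<in> Phi T"
  shows "foldr (refl T) (w0_word T) (foldr (refl T) ws (reflr T d g)) = g"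
  using assms by (simp add: Phi_length foldr_w0_word)

lemma F4_type_4:
  assumes T: "T = F4" and a: "short_root T a" "(t::'a::field) \<noteq> 0"
  shows "4 \<in> Type T N (xr T N a t)"
proof (rule Type_mem_short[OF a(1) _ a(2)])
  show "short_root T [1,2,3,2]" "pos_root T [1,2,3,2]"
    by (simp_all add: T short_root_def pos_root_code nonneg_vec_def Phi_iff ip_F4)
  show "4 \<in> S T" "set [1,2,3,1,2,3,1,2,3] \<subseteq> S T - {4}" by (auto simp: T S_def)
  show "foldr (refl T) (w0_word T) (foldr (refl T) [1,2,3,1,2,3,1,2,3] (reflr T [1,2,3,2] g)) = g" if "g \<in> Phi T" for g
    by (rule word_trivial[OF _ that]) (simp only: T rank_simps F4_word_4)
qed

lemma G2_type_1:
  assumes T: "T = G2" and a: "short_root T a" "(t::'a::field) \<noteq> 0"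
  shows "1 \<in> Type T N (xr T N a t)"
proof (rule Type_mem_short[OF a(1) _ a(2)])
  show "short_root T [2,1]" "pos_root T [2,1]"
    by (simp_all add: T short_root_def pos_root_code nonneg_vec_def Phi_iff ip_G2)
  show "1 \<in> S T" "set [2] \<subseteq> S T - {1}" by (auto simp: T S_def)
  show "foldr (refl T) (w0_word T) (foldr (refl T) [2] (reflr T [2,1] g)) = g" if "g \<in> Phi T" for g
    by (rule word_trivial[OF _ that]) (simp only: T rank_simps G2_word_1)
qed

lemma F4_type_1:
  assumes T: "T = F4" and a: "short_root T a" "(t::'a::field) \<noteq> 0" and char: "(2::'a) \<noteq> 0"
  shows "1 \<in> Type T N (xr T N a t)"
proof -
  \<comment> \<open>\<open>g1\<close> and \<open>g2\<close> are short with sum -h, and their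
    difference is a root, which gives the structure constant +-2. The remaining members of the
    g1-string through h are \<open>r4\<close> = h + g1 and \<open>d\<close> = h + 2 g1.\<close>
  let ?h = "[2,3,4,2] :: int list" and ?g1 = "[-1,-1,-2,-1] :: int list" and ?g2 = "[-1,-2,-2,-1] :: int list"
  let ?d = "[0,1,0,0] :: int list" and ?r4 = "[1,2,2,1] :: int list" and ?rho = "[1,1,0,0] :: int list"
  have PhiI: "?h \<in> Phi T" "?g1 \<in> Phi T" "?g2 \<in> Phi T" "?d \<in> Phi T" "?r4 \<in> Phi T" "?rho \<in> Phi T"
    by (simp_all add: T Phi_iff ip_F4)
  obtain i m and s :: "nat \<Rightarrow> int" where im: "i \<le> m" "m \<le> (if T = F4 then 2 else 3)"
    "\<And>k. s k = 1 \<or> s k = - 1"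
    "\<And>k. Dd ?g1 k (E ?h) = (if k \<le> m - i
        then sc (of_int (s k * int ((i + k) choose k))) (E (vadd ?h (vsmul (int k) ?g1))) else (0 :: nat \<Rightarrow> int))"
    "2 * ip T ?h ?g1 = (2 * int i - int m) * ip T ?g1 ?g1"
    by (rule Dd_E[OF PhiI(2,1), where 'b = int]) (simp_all, blast)
  have "2 * i + 2 = m" using im(5) by (simp add: T ip_F4)
  with im(1,2) have im': "i = 0" "m = 2" by (auto simp: T)
  have D: "Dd ?g1 1 (E ?h) = (sc (s 1) (E ?r4) :: nat \<Rightarrow> int)" "Dd ?g1 2 (E ?h) = (sc (s 2) (E ?d) :: nat \<Rightarrow> int)"
    "Dd ?g1 3 (E ?h) = (0 :: nat \<Rightarrow> int)"
    using im(4)[of 1] im(4)[of 2] im(4)[of 3] by (simp_all add: im' binomial_eq_0 choose_two)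
  have ps: "pstr T ?g2 ?g1 = 1"
  proof (rule pstr_eqI)
    fix j :: nat assume "1 \<le> j" "j \<le> 1"
    then have "j = 1" by simp
    then show "vadd ?g1 (vsmul (- int j) ?g2) \<in> Phi T" by (simp add: T Phi_iff ip_F4)
  qed (simp_all add: T Phi_iff ip_F4)
  have dh: "B (E ?d) (E ?h) = (0 :: nat \<Rightarrow> int)" "B (E ?h) (E ?d) = (0 :: nat \<Rightarrow> int)"
    by (rule B_zero[OF PhiI(4,1)]; simp add: T Phi_iff ip_F4)+
  have dr: "B (E ?d) (E ?r4) = (0 :: nat \<Rightarrow> int)" "B (E ?r4) (E ?d) = (0 :: nat \<Rightarrow> int)"
    by (rule B_zero[OF PhiI(4,5)]; simp add: T Phi_iff ip_F4)+
  have hr: "B (E ?h) (E ?r4) = (0 :: nat \<Rightarrow> int)"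
    by (rule B_zero[OF PhiI(1,5)]; simp add: T Phi_iff ip_F4)
  note dd = B_EE_self[OF PhiI(4)]
  \<comment> \<open>The terms at h, r4 and d commute, so no Heisenberg correction arises; the free
    slots get \<open>d\<close> with coefficient 0.\<close>
  show ?thesis
  proof (rule Type_mem_long[OF a, where h = ?h and ?g1.0 = ?g1 and ?g2.0 = ?g2 and ?r1.0 = ?d and ?r2.0 = ?d
        and ?r4.0 = ?r4 and ?r5.0 = ?d and \<rho> = ?rho and ?p1.0 = 0 and ?p2.0 = "s 2" and ?p4.0 = "- s 1" and ?p5.0 = 0
        and ws = "[2,3,4,2,3,4,2,3,4]"])
    show "1 \<in> S T" "set [2,3,4,2,3,4,2,3,4] \<subseteq> S T - {1}" by (auto simp: T S_def)
    show "foldr (refl T) (w0_word T) (foldr (refl T) [2,3,4,2,3,4,2,3,4] (reflr T ?h g)) = g" if "g \<in> Phi T" for g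
      by (rule word_trivial[OF _ that]) (simp only: T rank_simps F4_word_1)
    show "short_root T ?g1" by (simp add: T short_root_def Phi_iff ip_F4)
    show "cartan_int T ?g1 ?rho = 0" "cartan_int T ?h ?rho = 1" by (simp_all add: T cartan_int_def ip_F4)
    show "of_nat (pstr T ?g2 ?g1 + 1) \<noteq> (0::'a)" using char by (simp add: ps)
    show "mv n (xm T N ?g1 (- 1)) (E ?h) = sc 0 (E ?d) + sc (s 2) (E ?d) + (sc 1 (E ?h) + sc (- s 1) (E ?r4))"
      using D by (simp add: mv_xm[OF PhiI(2)] sum_upto4 sc_minus add.commute add.left_commute)
    show "pos_root T (reflr T ?h ?g1)" "pos_root T (reflr T ?h ?d)" "pos_root T ?h" "pos_root T ?d" "pos_root T ?d" "pos_root T ?r4"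
      by (simp_all add: T pos_root_code nonneg_vec_def Phi_iff ip_F4 reflr_def cartan_int_def)
  qed (use PhiI dh dr hr dd in \<open>auto simp: T Phi_iff ip_F4 br_add_left br_add_right br_sc_left br_sc_right\<close>)
qed

lemma G2_type_2:
  assumes T: "T = G2" and a: "short_root T a" "(t::'a::field) \<noteq> 0" and char: "(3::'a) \<noteq> 0"
  shows "2 \<in> Type T N (xr T N a t)"
proof -
  \<comment> \<open>The roots \<open>r4\<close>, \<open>r2\<close>, \<open>r1\<close> are h + g1, h
    + 2 g1, h + 3 g1, and \<open>r5\<close> = r1 + h = r2 + r4 spans the centre of the Heisenberg
    algebra. The reflection in h sends the negative root \<open>r1\<close> to
    \<open>r5\<close>.\<close>
  let ?h = "[3,2] :: int list" and ?g1 = "[-1,-1] :: int list" and ?g2 = "[-2,-1] :: int list"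
  let ?r1 = "[0,-1] :: int list" and ?r2 = "[1,0] :: int list" and ?r4 = "[2,1] :: int list" and ?r5 = "[3,1] :: int list"
  have PhiI: "?h \<in> Phi T" "?g1 \<in> Phi T" "?g2 \<in> Phi T" "?r1 \<in> Phi T" "?r2 \<in> Phi T" "?r4 \<in> Phi T" "?r5 \<in> Phi T"
    by (simp_all add: T Phi_iff ip_G2)
  obtain i m and s :: "nat \<Rightarrow> int" where im: "i \<le> m" "m \<le> (if T = F4 then 2 else 3)"
    "\<And>k. s k = 1 \<or> s k = - 1"
    "\<And>k. Dd ?g1 k (E ?h) = (if k \<le> m - i
        then sc (of_int (s k * int ((i + k) choose k))) (E (vadd ?h (vsmul (int k) ?g1))) else (0 :: nat \<Rightarrow> int))"
    "2 * ip T ?h ?g1 = (2 * int i - int m) * ip T ?g1 ?g1"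
    by (rule Dd_E[OF PhiI(2,1), where 'b = int]) (simp_all, blast)
  have "2 * i + 3 = m" using im(5) by (simp add: T ip_G2)
  with im(1,2) have im': "i = 0" "m = 3" by (auto simp: T)
  have D: "Dd ?g1 1 (E ?h) = (sc (s 1) (E ?r4) :: nat \<Rightarrow> int)" "Dd ?g1 2 (E ?h) = (sc (s 2) (E ?r2) :: nat \<Rightarrow> int)"
    "Dd ?g1 3 (E ?h) = (sc (s 3) (E ?r1) :: nat \<Rightarrow> int)"
    using im(4)[of 1] im(4)[of 2] im(4)[of 3] by (simp_all add: im' binomial_eq_0 choose_two)
  have ps: "pstr T ?g2 ?g1 = 2"
  proof (rule pstr_eqI)
    fix j :: nat assume "1 \<le> j" "j \<le> 2"
    then have "j = 1 \<or> j = 2" by auto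
    then show "vadd ?g1 (vsmul (- int j) ?g2) \<in> Phi T" by (auto simp: T Phi_iff ip_G2)
  qed (simp_all add: T Phi_iff ip_G2)
  have "pstr T ?r1 ?h = 0"
    by (rule pstr_eqI) (simp_all add: T Phi_iff ip_G2)
  then have n1: "\<bar>N ?r1 ?h\<bar> = 1" using abs_N[OF PhiI(4,1)] by (simp add: T Phi_iff ip_G2)
  have "pstr T ?r2 ?r4 = 2"
  proof (rule pstr_eqI)
    fix j :: nat assume "1 \<le> j" "j \<le> 2"
    then have "j = 1 \<or> j = 2" by auto
    then show "vadd ?r4 (vsmul (- int j) ?r2) \<in> Phi T" by (auto simp: T Phi_iff ip_G2)
  qed (simp_all add: T Phi_iff ip_G2)
  then have n2: "\<bar>N ?r2 ?r4\<bar> = 3" using abs_N[OF PhiI(5,6)] by (simp add: T Phi_iff ip_G2)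
  \<comment> \<open>The two brackets contribute +-1 and +-3 to the coefficient of e_r5, so the total
    is even whatever the signs are.\<close>
  define p5 where "p5 = (- s 3 * N ?r1 ?h - s 2 * s 1 * N ?r2 ?r4) div 2"
  have "N ?r1 ?h = 1 \<or> N ?r1 ?h = - 1" "N ?r2 ?r4 = 3 \<or> N ?r2 ?r4 = - 3" using n1 n2 by auto
  then have "even (- s 3 * N ?r1 ?h - s 2 * s 1 * N ?r2 ?r4)"
    using im(3)[of 1] im(3)[of 2] im(3)[of 3] by auto
  then have p5: "2 * p5 = - s 3 * N ?r1 ?h - s 2 * s 1 * N ?r2 ?r4" by (simp add: p5_def)
  have z: "B (E ?r1) (E ?r2) = (0 :: nat \<Rightarrow> int)" "B (E ?h) (E ?r4) = (0 :: nat \<Rightarrow> int)"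
    "B (E ?r1) (E ?r4) = (0 :: nat \<Rightarrow> int)" "B (E ?r2) (E ?h) = (0 :: nat \<Rightarrow> int)"
    by (rule B_zero(1); simp add: T Phi_iff ip_G2)+
  have e: "B (E ?r1) (E ?h) = (sc (N ?r1 ?h) (E ?r5) :: nat \<Rightarrow> int)" "B (E ?r2) (E ?r4) = (sc (N ?r2 ?r4) (E ?r5) :: nat \<Rightarrow> int)"
    using B_EE[OF PhiI(4,1), where 'a = int] B_EE[OF PhiI(5,6), where 'a = int] by (simp_all add: T Phi_iff ip_G2)
  have z5: "B (E ?r5) (E r) = (0 :: nat \<Rightarrow> int) \<and> B (E r) (E ?r5) = (0 :: nat \<Rightarrow> int)" if "r \<in> {?r1, ?r2, ?h, ?r4}" for r
  proof -
    have "r \<in> Phi T" "vadd ?r5 r \<notin> Phi T" "r \<noteq> vneg ?r5" using that by (auto simp: T Phi_iff ip_G2)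
    then show ?thesis using B_zero[OF PhiI(7)] by blast
  qed
  show ?thesis
  proof (rule Type_mem_long[OF a, where h = ?h and ?g1.0 = ?g1 and ?g2.0 = ?g2 and ?r1.0 = ?r1 and ?r2.0 = ?r2
        and ?r4.0 = ?r4 and ?r5.0 = ?r5 and \<rho> = ?r5 and ?p1.0 = "- s 3" and ?p2.0 = "s 2" and ?p4.0 = "- s 1" and ?p5.0 = p5
        and ws = "[1]"])
    show "2 \<in> S T" "set [1] \<subseteq> S T - {2}" by (auto simp: T S_def)
    show "foldr (refl T) (w0_word T) (foldr (refl T) [1] (reflr T ?h g)) = g" if "g \<in> Phi T" for g
      by (rule word_trivial[OF _ that]) (simp only: T rank_simps G2_word_2)
    show "short_root T ?g1" by (simp add: T short_root_def Phi_iff ip_G2)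
    show "cartan_int T ?g1 ?r5 = 0" "cartan_int T ?h ?r5 = 1" by (simp_all add: T cartan_int_def ip_G2)
    show "of_nat (pstr T ?g2 ?g1 + 1) \<noteq> (0::'a)" using char by (simp add: ps)
    show "mv n (xm T N ?g1 (- 1)) (E ?h) = sc (- s 3) (E ?r1) + sc (s 2) (E ?r2) + (sc 1 (E ?h) + sc (- s 1) (E ?r4))"
      using D by (simp add: mv_xm[OF PhiI(2)] sum_upto4 sc_minus add.commute add.left_commute)
    show "B (sc (- s 3) (E ?r1) + sc (s 2) (E ?r2)) (sc 1 (E ?h) + sc (- s 1) (E ?r4)) = sc (2 * p5) (E ?r5)"
      unfolding p5 by (simp add: br_add_left br_add_right br_sc_left br_sc_right z e) (simp add: fun_eq_iff vec_apply algebra_simps)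
    show "pos_root T (reflr T ?h ?g1)" "pos_root T (reflr T ?h ?r1)" "pos_root T ?h" "pos_root T ?r2" "pos_root T ?r4" "pos_root T ?r5"
      by (simp_all add: T pos_root_code nonneg_vec_def Phi_iff ip_G2 reflr_def cartan_int_def)
    show "\<And>r. r \<in> {?r1, ?r2, ?h, ?r4} \<Longrightarrow> B (E ?r5) (E r) = (0 :: nat \<Rightarrow> int) \<and> B (E r) (E ?r5) = (0 :: nat \<Rightarrow> int)"
      by (rule z5)
  qed (use PhiI z in \<open>auto simp: T Phi_iff ip_G2\<close>)
qed

end

section \<open>Nodes not belonging to the type\<close>

context chev begin

lemma aut_G: "g \<in> G \<Longrightarrow> aut g"
  unfolding chev_group_def
proof (induction rule: gen_by.induct)
  case (step g x)
  then obtain b t where "b \<in> Phi T" "x = xr T N b t" by auto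
  then have "aut x" by (simp add: xr_eq_xm aut_xm)
  with step show ?case by (simp add: aut_mult)
qed (rule aut_one)

lemma aut_B: "aut A \<Longrightarrow> mv n A (B u v) = B (mv n A u) (mv n A v)"
  by (simp add: aut_def)

lemma mv_outside: "r \<ge> n \<Longrightarrow> mv n A v r = v r"
  by (simp add: mv_def)

lemma E_nonzero: "(E c :: nat \<Rightarrow> 'b::comm_ring_1) j \<noteq> 0 \<Longrightarrow> j = ix c"
  by (auto simp: uv_def split: if_splits)

lemma B_E_support:
  assumes "B u (E c) m \<noteq> (0::'b::comm_ring_1)" "c \<in> Phi T"
  obtains i where "i < n" "u i \<noteq> 0" "wt T m = vadd (wt T i) c"
proof -
  obtain i j where "i < n" "u i \<noteq> 0" "(E c :: nat \<Rightarrow> 'b) j \<noteq> 0" "wt T m = vadd (wt T i) (wt T j)"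
    using assms(1) by (rule br_support)
  moreover from this have "j = ix c" by (intro E_nonzero)
  ultimately show thesis using that assms(2) by simp
qed

lemma B_E_support':
  assumes "B (E c) u m \<noteq> (0::'b::comm_ring_1)" "c \<in> Phi T"
  obtains i where "i < n" "u i \<noteq> 0" "wt T m = vadd (wt T i) c"
proof -
  have "B u (E c) m \<noteq> 0" using assms(1) by (subst B_anti) (simp add: uminus_apply)
  then show thesis using assms(2) by (rule B_E_support) (rule that)
qed

text \<open>The conjugate \<open>g\<inverse> x\<^sub>\<alpha>(t) g\<close> is \<open>\<Sum>\<^sub>k t\<^sup>k A\<^sub>k\<close>, where \<open>A\<^sub>1 = ad a\<close> and the \<open>A\<^sub>k\<close> obey the
  Leibniz rule. Writing \<open>e\<^bsub>b+c\<^esub>\<close> as a bracket therefore controls \<open>A\<^sub>2\<close> and \<open>A\<^sub>3\<close> by the weights of \<open>a\<close>.\<close>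
lemma conj_entry_zero:
  assumes g: "g \<in> G" "g' \<in> G" "g' * g = 1\<^sub>m n" "g * g' = 1\<^sub>m n" and \<alpha>: "\<alpha> \<in> Phi T"
    and bc: "b \<in> Phi T" "c \<in> Phi T" "vadd b c \<in> Phi T" "pstr T b c = 0"
    and \<rho>: "\<rho> \<in> Phi T" "\<rho> \<noteq> vadd b c"
    and c1: "\<And>x. x \<in> insert (zv T) (Phi T) \<Longrightarrow> vadd x b \<noteq> \<rho> \<and> vadd x c \<noteq> \<rho> \<and> vadd x (vadd b c) \<noteq> \<rho>"
    and c2: "\<And>x x'. x \<in> insert (zv T) (Phi T) \<Longrightarrow> x' \<in> insert (zv T) (Phi T) \<Longrightarrow>
        vadd (vadd x b) (vadd x' c) = \<rho> \<Longrightarrow> x \<in> Z \<or> x' \<in> Z"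
    and c3: "\<And>x y. T = G2 \<Longrightarrow> x \<in> insert (zv T) (Phi T) \<Longrightarrow> y \<in> insert (zv T) (Phi T) \<Longrightarrow>
        vadd y (vadd x c) = \<rho> \<or> vadd (vadd x b) y = \<rho> \<Longrightarrow> x \<in> Z"
    and Z: "\<And>i. i < n \<Longrightarrow> wt T i \<in> Z \<Longrightarrow> mv n g' (E \<alpha>) i = (0::'a::field)"
  shows "mv n (g' * (xr T N \<alpha> t * g)) (E (vadd b c)) (ix \<rho>) = 0"
proof -
  define A :: "nat \<Rightarrow> (nat \<Rightarrow> 'a) \<Rightarrow> nat \<Rightarrow> 'a" where "A k v = mv n g' (Dd \<alpha> k (mv n g v))" for k v
  define a :: "nat \<Rightarrow> 'a" where "a = mv n g' (E \<alpha>)"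
  have car: "g \<in> carrier_mat n n" "g' \<in> carrier_mat n n" using g by (auto intro: G_carrier)
  have gg: "mv n g' (mv n g v) = v" "mv n g (mv n g' v) = v" for v :: "nat \<Rightarrow> 'a"
    using g(3,4) car by (simp_all flip: mv_mult)
  have A0: "A 0 v = v" for v by (simp add: A_def gg)
  have A1: "A (Suc 0) v = B a v" for v
    using Dd_1[OF \<alpha>, of "mv n g v"] by (simp add: A_def a_def aut_B[OF aut_G[OF g(2)]] gg)
  have AB: "A k (B u v) = (\<Sum>i\<le>k. B (A i u) (A (k - i) v))" for k u v
    by (simp add: A_def aut_B[OF aut_G[OF g(1)]] Dd_B[OF \<alpha>] mv_sum aut_B[OF aut_G[OF g(2)]])
  have Asc: "A k (sc s v) = sc s (A k v)" for k s v
    by (simp add: A_def mv_sc vlin_sc[OF vlin_Dd])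
  have expand: "mv n (g' * (xr T N \<alpha> t * g)) v = (\<Sum>k<4. sc (t ^ k) (A k v))" for v
    using car by (simp add: mv_mult[of _ n] xr_eq_xm mv_xm[OF \<alpha>] mv_sum mv_sc A_def)
  have \<rho>n: "ix \<rho> < n" "wt T (ix \<rho>) = \<rho>" using \<rho>(1) by simp_all
  have aZ: "wt T i \<notin> Z" if "a i \<noteq> 0" "i < n" for i using Z that unfolding a_def by blast
  have "\<bar>N b c\<bar> = 1" using abs_N[OF bc(1-3)] bc(4) by simp
  then have "N b c = 1 \<or> N b c = - 1" by auto
  \<comment> \<open>Because the structure constant is +-1, this holds in every
    characteristic.\<close>
  then have Ebc: "E (vadd b c) = sc (of_int (N b c)) (B (E b) (E c) :: nat \<Rightarrow> 'a)"
    using B_EE[OF bc(1-3), where 'a = 'a] by auto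
  have t1: "B a (E (vadd b c)) (ix \<rho>) = 0"
  proof (rule ccontr)
    assume "\<not> ?thesis"
    then obtain i where "i < n" "\<rho> = vadd (wt T i) (vadd b c)" using bc(3) \<rho>n by (metis B_E_support)
    then show False using c1[OF wt_cases[of i]] by auto
  qed
  have t2: "B u (E c) (ix \<rho>) = 0" "B (E b) u (ix \<rho>) = 0" for u :: "nat \<Rightarrow> 'a"
  proof -
    show "B u (E c) (ix \<rho>) = 0"
    proof (rule ccontr)
      assume "\<not> ?thesis"
      then obtain i where "i < n" "\<rho> = vadd (wt T i) c" using bc(2) \<rho>n by (metis B_E_support)
      then show False using c1[OF wt_cases[of i]] by auto
    qed
    show "B (E b) u (ix \<rho>) = 0"
    proof (rule ccontr)
      assume "\<not> ?thesis"
      then obtain i where "i < n" "\<rho> = vadd (wt T i) b" using bc(1) \<rho>n by (metis B_E_support')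
      then show False using c1[OF wt_cases[of i]] by auto
    qed
  qed
  have t3: "B (B a (E b)) (B a (E c)) (ix \<rho>) = 0"
  proof (rule ccontr)
    assume "\<not> ?thesis"
    then obtain i j where ij: "B a (E b) i \<noteq> 0" "B a (E c) j \<noteq> 0" "\<rho> = vadd (wt T i) (wt T j)"
      using \<rho>n by (metis br_support)
    obtain i' where i': "i' < n" "a i' \<noteq> 0" "wt T i = vadd (wt T i') b" using ij(1) bc(1) by (rule B_E_support)
    obtain j' where j': "j' < n" "a j' \<noteq> 0" "wt T j = vadd (wt T j') c" using ij(2) bc(2) by (rule B_E_support)
    show False using c2[OF wt_cases[OF i'(1)] wt_cases[OF j'(1)]] ij(3) i' j' aZ by auto
  qed
  have t4: "B u (B a (E c)) (ix \<rho>) = 0" "B (B a (E b)) u (ix \<rho>) = 0" if T: "T = G2" for u :: "nat \<Rightarrow> 'a"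
  proof -
    show "B u (B a (E c)) (ix \<rho>) = 0"
    proof (rule ccontr)
      assume "\<not> ?thesis"
      then obtain i j where ij: "i < n" "B a (E c) j \<noteq> 0" "\<rho> = vadd (wt T i) (wt T j)"
        using \<rho>n by (metis br_support)
      obtain j' where j': "j' < n" "a j' \<noteq> 0" "wt T j = vadd (wt T j') c" using ij(2) bc(2) by (rule B_E_support)
      show False using c3[OF T wt_cases[OF j'(1)] wt_cases[OF ij(1)]] ij(3) j' aZ by auto
    qed
    show "B (B a (E b)) u (ix \<rho>) = 0"
    proof (rule ccontr)
      assume "\<not> ?thesis"
      then obtain i j where ij: "j < n" "B a (E b) i \<noteq> 0" "\<rho> = vadd (wt T i) (wt T j)"
        using \<rho>n by (metis br_support)
      obtain i' where i': "i' < n" "a i' \<noteq> 0" "wt T i = vadd (wt T i') b" using ij(2) bc(1) by (rule B_E_support)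
      show False using c3[OF T wt_cases[OF i'(1)] wt_cases[OF ij(1)]] ij(3) i' aZ by auto
    qed
  qed
  have k0: "A 0 (E (vadd b c)) (ix \<rho>) = 0" using \<rho> bc(3) by (simp add: A0 uv_def ridx_inj)
  have k1: "A (Suc 0) (E (vadd b c)) (ix \<rho>) = 0" by (simp add: A1 t1)
  \<comment> \<open>The Leibniz rule gives [A_2 e_b, e_c] + [[a, e_b], [a, e_c]] + [e_b, A_2 e_c].
    The outer terms vanish by \<open>c1\<close> whatever A_2 is, and \<open>c2\<close> settles the
    middle one by the weights of a alone.\<close>
  have k2: "A 2 (E (vadd b c)) (ix \<rho>) = 0"
    by (simp add: Ebc Asc AB numeral_2_eq_2 A0 A1 t2 t3 vec_apply)
  \<comment> \<open>Here A_2 is paired with one bracket by a, so \<open>c3\<close> restricts only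
    the weight coming from a and leaves the other arbitrary.\<close>
  have k3: "A 3 (E (vadd b c)) (ix \<rho>) = 0"
  proof (cases "T = G2")
    case True
    from t4[OF this] show ?thesis by (simp add: Ebc Asc AB numeral_3_eq_3 A0 A1 t2 vec_apply)
  next
    case False
    then have "T = F4" by (cases T) auto
    then have "Dd \<alpha> 3 v = 0" for v :: "nat \<Rightarrow> 'a" by (intro Dd_zero[OF \<alpha>]) simp
    then show ?thesis by (simp add: A_def zero_fun_apply)
  qed
  show ?thesis using k0 k1 k2 k3 by (simp add: expand sum_upto4 vec_apply)
qed

section \<open>Weight sets stable under a parabolic subgroup\<close>

definition supp_in :: "int list set \<Rightarrow> (nat \<Rightarrow> 'b::comm_ring_1) \<Rightarrow> bool" where
  "supp_in W v \<longleftrightarrow> (\<forall>r. r \<notin> ix ` W \<longrightarrow> v r = 0)"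

definition vanish_on :: "int list set \<Rightarrow> (nat \<Rightarrow> 'b::comm_ring_1) \<Rightarrow> bool" where
  "vanish_on W v \<longleftrightarrow> (\<forall>w\<in>W. v (ix w) = 0)"

text \<open>Makes the span of the e_w with w in W stable under the parabolic: no divided power of a
  generating root element leaves W. Since W consists of roots, the zero weight must not be reached
  either.\<close>

definition Pclosed :: "nat set \<Rightarrow> int list set \<Rightarrow> bool" where
  "Pclosed K W \<longleftrightarrow> W \<subseteq> Phi T \<and> (\<forall>w\<in>W. \<forall>b\<in>Phi T. \<forall>k\<in>{1,2,3::nat}.
     (pos_root T b \<or> (\<exists>i\<in>K. b = vneg (sroot T (i - 1)))) \<longrightarrow>
     vadd w (vsmul (int k) b) \<in> insert (zv T) (Phi T) \<longrightarrow> vadd w (vsmul (int k) b) \<in> W)"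

lemma supp_in_expand:
  assumes "supp_in W v" "W \<subseteq> Phi T"
  shows "v = (\<Sum>w\<in>W. sc (v (ix w)) (E w))"
proof
  have fin: "finite W" using assms(2) by (rule finite_subset) (simp add: Phi_eq)
  fix r show "v r = (\<Sum>w\<in>W. sc (v (ix w)) (E w)) r"
  proof (cases "r \<in> ix ` W")
    case True
    then obtain w where w: "w \<in> W" "r = ix w" by blast
    have "(\<Sum>w'\<in>W. v (ix w') * E w' r) = (\<Sum>w'\<in>W. if w' = w then v r else 0)"
      using assms(2) w by (intro sum.cong) (auto simp: uv_def ridx_inj subset_iff)
    then show ?thesis using fin w by (simp add: sum_fun_apply vec_apply)
  next
    case False
    then have "v (ix w) * E w r = 0" if "w \<in> W" for w using that by (auto simp: uv_def)
    with False assms(1) show ?thesis by (simp add: sum_fun_apply vec_apply supp_in_def)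
  qed
qed

lemma supp_in_sum: "W \<subseteq> Phi T \<Longrightarrow> supp_in W (\<Sum>w\<in>W. sc (f w) (E w))"
  by (auto simp: supp_in_def sum_fun_apply vec_apply uv_def intro!: sum.neutral)

lemma Dd_entry_zero:
  assumes "k > 0" "b \<in> Phi T" "\<And>c. c < n \<Longrightarrow> wt T r = vadd (wt T c) (vsmul (int k) b) \<Longrightarrow> r < n \<Longrightarrow> v c = (0::'b::comm_ring_1)"
  shows "Dd b k v r = 0"
proof -
  have "v c * Dd b k (uv c) r = 0" if "c < n" for c
    using Dd_weight[OF that assms(2), of k r, where 'a = 'b] assms(3)[OF that] by (cases "Dd b k (uv c) r = (0::'b)") auto
  then show ?thesis by (simp add: nlin_expand[OF nlin_Dd[OF assms(1)], of b v])
qed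

lemma vadd_vneg_cancel:
  assumes "length u = rank T" "length v = rank T" "length w = rank T"
  shows "vadd u v = w \<longleftrightarrow> u = vadd w (vneg v)" "vadd u v = vneg w \<longleftrightarrow> vadd w v = vneg u"
  by (cases rule: length_rankE[OF assms(1)]; cases rule: length_rankE[OF assms(2)];
      cases rule: length_rankE[OF assms(3)]; auto)+

lemma xr_entry_zero:
  assumes b: "b \<in> Phi T" and v: "v r = (0::'a::field)"
    and D: "\<And>k c. k \<in> {1,2,3} \<Longrightarrow> c < n \<Longrightarrow> wt T r = vadd (wt T c) (vsmul (int k) b) \<Longrightarrow> r < n \<Longrightarrow> v c = 0"
  shows "mv n (xr T N b t) v r = 0"
proof -
  have "Dd b k v r = 0" if "k \<in> {1,2,3}" for k
    using D[OF that] that by (intro Dd_entry_zero[OF _ b]) auto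
  from this[of 1] this[of 2] this[of 3] v show ?thesis
    by (simp add: xr_eq_xm mv_xm[OF b] sum_upto4 vec_apply)
qed

lemma vneg_zv: "vneg (zv T) = zv T"
  by (simp add: vneg_def)

text \<open>The second claim is dual to the first: a step from a weight x to -w by k b is a step
  from w to -x by the same k b.\<close>

lemma P_stable:
  assumes "p \<in> P K" "Pclosed K W" "K \<subseteq> S T"
  shows "supp_in W v \<Longrightarrow> supp_in W (mv n p v :: nat \<Rightarrow> 'a::field)"
    and "vanish_on (vneg ` W) v \<Longrightarrow> vanish_on (vneg ` W) (mv n p v)"
proof -
  have W: "W \<subseteq> Phi T" using assms(2) by (simp add: Pclosed_def)
  have step': "(supp_in W v \<longrightarrow> supp_in W (mv n x v)) \<and> (vanish_on (vneg ` W) v \<longrightarrow> vanish_on (vneg ` W) (mv n x v))"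
    if "x \<in> pgens K" for x and v :: "nat \<Rightarrow> 'a"
  proof -
    have neg: "i \<in> K \<Longrightarrow> vneg (sroot T (i - 1)) \<in> Phi T" for i
      using assms(3) by (intro vneg_Phi sroot_Phi S_index) auto
    from that have "(\<exists>b t. b \<in> Phi T \<and> (pos_root T b \<or> (\<exists>i\<in>K. b = vneg (sroot T (i - 1)))) \<and> x = xr T N b t)
        \<or> (\<exists>i t. i < rank T \<and> t \<noteq> 0 \<and> x = hr T N (sroot T i) t)"
      unfolding pgens_def borel_gens_def using neg by (auto simp: pos_root_def simp del: One_nat_def)
    then consider b t where "b \<in> Phi T" "pos_root T b \<or> (\<exists>i\<in>K. b = vneg (sroot T (i - 1)))" "x = xr T N b t"
      | i t where "i < rank T" "t \<noteq> 0" "x = hr T N (sroot T i) t" by blast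
    then show ?thesis
    proof cases
      case (1 b t)
      have cl: "vadd w (vsmul (int k) b) \<in> W"
        if "w \<in> W" "k \<in> {1,2,3}" "vadd w (vsmul (int k) b) \<in> insert (zv T) (Phi T)" for w k
        using assms(2) that 1(1,2) unfolding Pclosed_def by blast
      have "mv n x v r = 0" if s: "supp_in W v" and r: "r \<notin> ix ` W" for r
        unfolding 1(3)
      proof (rule xr_entry_zero[OF 1(1)])
        show "v r = 0" using s r by (simp add: supp_in_def)
        fix k c assume kc: "k \<in> {1,2,3::nat}" "c < n" "wt T r = vadd (wt T c) (vsmul (int k) b)" "r < n"
        show "v c = 0"
        proof (rule ccontr)
          assume "v c \<noteq> 0"
          then obtain w where w: "w \<in> W" "c = ix w" using s by (auto simp: supp_in_def)
          then have "w \<in> Phi T" using W by auto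
          with kc w cl[OF w(1) kc(1)] wt_cases[OF kc(4)] have "wt T r \<in> W" by simp
          then show False using r kc(4) W wt_eq_root[of r T "wt T r"] by auto
        qed
      qed
      moreover have "mv n x v (ix (vneg w)) = 0" if s: "vanish_on (vneg ` W) v" and w: "w \<in> W" for w
        unfolding 1(3)
      proof (rule xr_entry_zero[OF 1(1)])
        show "v (ix (vneg w)) = 0" using s w by (simp add: vanish_on_def)
        fix k c assume kc: "k \<in> {1,2,3::nat}" "c < n" "wt T (ix (vneg w)) = vadd (wt T c) (vsmul (int k) b)"
        have wP: "w \<in> Phi T" using w W by auto
        then have "vneg w = vadd (wt T c) (vsmul (int k) b)" using kc(3) by simp
        then have e: "vadd w (vsmul (int k) b) = vneg (wt T c)"
          using vadd_vneg_cancel(2)[of "wt T c" "vsmul (int k) b" w] kc(2) wP 1(1) by (simp add: Phi_length)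
        have "vneg (wt T c) \<in> insert (zv T) (Phi T)" using wt_cases[OF kc(2)] vneg_Phi by (auto simp: vneg_zv)
        then have W': "vneg (wt T c) \<in> W" using cl[OF w kc(1)] e by simp
        then have "vneg (wt T c) \<in> Phi T" using W by auto
        then have "wt T c \<in> Phi T" using vneg_Phi[of "vneg (wt T c)" T] by simp
        then have "c = ix (vneg (vneg (wt T c)))" using wt_eq_root[OF kc(2) \<open>wt T c \<in> Phi T\<close>] by simp
        then show "v c = 0" using s W' unfolding vanish_on_def by (metis imageI)
      qed
      ultimately show ?thesis by (auto simp: supp_in_def vanish_on_def)
    next
      case (2 i t)
      have "mv n x v r = 0" if "v r = 0" for r
        using that hr_entry[OF sroot_Phi[OF 2(1)] 2(2), of r v] mv_outside[of r x v] 2(3) by (cases "r < n") auto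
      then show ?thesis by (auto simp: supp_in_def vanish_on_def)
    qed
  qed
  have "(supp_in W v \<longrightarrow> supp_in W (mv n p v)) \<and> (vanish_on (vneg ` W) v \<longrightarrow> vanish_on (vneg ` W) (mv n p v))"
    using assms(1) unfolding P_gen
  proof (induction rule: gen_by.induct)
    case (step g x)
    have "mv n (x * g) v = mv n x (mv n g v)"
      using step(1,2) pgens_carrier gen_by_carrier[OF pgens_carrier] by (intro mv_mult) blast+
    with step(3) step'[of x "mv n g v"] \<open>x \<in> pgens K\<close> show ?case by simp
  qed simp
  then show "supp_in W v \<Longrightarrow> supp_in W (mv n p v)" "vanish_on (vneg ` W) v \<Longrightarrow> vanish_on (vneg ` W) (mv n p v)"
    by blast+
qed

lemma w0_rep_E:
  assumes "g \<in> Phi T"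
  obtains \<epsilon> :: int where "\<epsilon> = 1 \<or> \<epsilon> = - 1"
    "mv n (w0_rep T N) (E g) = sc (of_int \<epsilon>) (E (vneg g) :: nat \<Rightarrow> 'a::field)"
proof -
  have "refl T i v = reflr T (sroot T (i - 1)) v" for i v by (simp add: refl_def reflr_def)
  then have "foldr (reflr T) (map (\<lambda>i. sroot T (i - 1)) is) v = foldr (refl T) is v" for "is" v
    by (induction "is") simp_all
  then have "foldr (reflr T) (map (\<lambda>i. sroot T (i - 1)) (w0_word T)) g = vneg g"
    using foldr_w0_word_root[OF assms] by simp
  then show thesis using wmat_E[OF w0_word_roots assms, where 'b = 'a] that by (auto simp: w0_rep_wmat)
qed

lemma vneg_inj: "vneg u = vneg v \<longleftrightarrow> u = v"
  by (metis vneg_vneg)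

text \<open>Solves p1 w0 p2 v = e_{-w} modulo vectors vanishing on -W, with v in the span of W: take
  u = p1^-1 e_{-w}, truncate it to -W, and pull the truncation back through w0 and p2. The part cut
  off is harmless because vanishing on -W is preserved by p1.\<close>

lemma opposite_row_nonzero:
  assumes p: "p1 \<in> P K" "p2 \<in> P K" and K: "K \<subseteq> S T" and W: "Pclosed K W" and w: "w \<in> W"
    and z: "\<And>w'. w' \<in> W \<Longrightarrow> mv n (p1 * (w0_rep T N * p2)) (E w') (ix (vneg w)) = (0::'a::field)"
  shows False
proof -
  have WP: "W \<subseteq> Phi T" using W by (simp add: Pclosed_def)
  have inj: "inj_on vneg W" by (auto simp: inj_on_def vneg_inj)
  have WP': "vneg ` W \<subseteq> Phi T" using WP by auto
  obtain q1 where q1: "q1 \<in> P K" "p1 * q1 = 1\<^sub>m n" using P_inverse[OF K p(1)] by metis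
  obtain q2 where q2: "q2 \<in> P K" "p2 * q2 = 1\<^sub>m n" using P_inverse[OF K p(2)] by metis
  note car = P_carrier[OF p(1)] P_carrier[OF p(2)] P_carrier[OF q1(1)] P_carrier[OF q2(1)]
  have "\<forall>w\<in>W. \<exists>e::'a. e * e = 1 \<and> mv n (w0_rep T N) (E w) = sc e (E (vneg w))"
  proof
    fix w assume "w \<in> W"
    then obtain \<epsilon> :: int where "\<epsilon> = 1 \<or> \<epsilon> = - 1" "mv n (w0_rep T N) (E w) = sc (of_int \<epsilon>) (E (vneg w) :: nat \<Rightarrow> 'a)"
      using WP by (metis w0_rep_E subsetD)
    then show "\<exists>e::'a. e * e = 1 \<and> mv n (w0_rep T N) (E w) = sc e (E (vneg w))"
      by (intro exI[of _ "of_int \<epsilon>"]) auto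
  qed
  then obtain e :: "int list \<Rightarrow> 'a" where e: "\<And>w. w \<in> W \<Longrightarrow> e w * e w = 1"
    "\<And>w. w \<in> W \<Longrightarrow> mv n (w0_rep T N) (E w) = sc (e w) (E (vneg w))" by metis
  define u :: "nat \<Rightarrow> 'a" where "u = mv n q1 (E (vneg w))"
  define u0 :: "nat \<Rightarrow> 'a" where "u0 = (\<Sum>x\<in>vneg ` W. sc (u (ix x)) (E x))"
  define v0 :: "nat \<Rightarrow> 'a" where "v0 = (\<Sum>x\<in>W. sc (u (ix (vneg x)) * e x) (E x))"
  define v where "v = mv n q2 v0"
  have p1u: "mv n p1 u = E (vneg w)" using q1 car by (simp add: u_def flip: mv_mult)
  have "u0 (ix x) = u (ix x)" if "x \<in> vneg ` W" for x
  proof -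
    have "(\<Sum>y\<in>vneg ` W. u (ix y) * E y (ix x)) = (\<Sum>y\<in>vneg ` W. if y = x then u (ix x) else 0)"
      using WP' that by (intro sum.cong) (auto simp: uv_def ridx_inj subset_iff)
    moreover have "finite (vneg ` W)" using WP' by (rule finite_subset) (simp add: Phi_eq)
    ultimately show ?thesis using that by (simp add: u0_def sum_fun_apply vec_apply)
  qed
  then have "vanish_on (vneg ` W) (u - u0)" by (auto simp: vanish_on_def vec_apply)
  then have "vanish_on (vneg ` W) (mv n p1 (u - u0))" by (rule P_stable(2)[OF p(1) W K])
  then have "mv n p1 u0 (ix (vneg w)) = 1"
    using w p1u by (auto simp: vanish_on_def vlin_diff[OF vlin_mv] vec_apply)
  moreover have "mv n (w0_rep T N) v0 = u0"
    unfolding v0_def u0_def mv_sum sum.reindex[OF inj]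
    by (intro sum.cong refl) (simp add: mv_sc e mult.assoc)
  moreover have "mv n p2 v = v0" using q2 car by (simp add: v_def flip: mv_mult)
  ultimately have one: "mv n (p1 * (w0_rep T N * p2)) v (ix (vneg w)) = 1"
    using car by (simp add: mv_mult[of _ n])
  have "supp_in W v" unfolding v_def v0_def by (rule P_stable(1)[OF q2(1) W K supp_in_sum[OF WP]])
  then have vE: "v = (\<Sum>w'\<in>W. sc (v (ix w')) (E w'))" using WP by (rule supp_in_expand)
  have "mv n (p1 * (w0_rep T N * p2)) v = (\<Sum>w'\<in>W. sc (v (ix w')) (mv n (p1 * (w0_rep T N * p2)) (E w')))"
    by (subst (1) vE) (simp only: mv_sum mv_sc)
  then have "mv n (p1 * (w0_rep T N * p2)) v (ix (vneg w)) = 0"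
    using z by (simp add: sum_fun_apply vec_apply)
  with one show False by simp
qed

end

section \<open>The short root ideal\<close>

definition lacing :: "ctype \<Rightarrow> nat" where
  "lacing T = (if T = F4 then 2 else 3)"

lemma lacing_simps [simp]: "lacing F4 = 2" "lacing G2 = 3"
  by (simp_all add: lacing_def)

lemma long_norm_lacing: "long_norm T = 2 * int (lacing T)"
  by (cases T) simp_all

text \<open>A Cartan index counts as long when its simple root is long: the coroot of a short root
  has coordinates divisible by the lacing number there, so modulo that number short coroots avoid
  these indices.\<close>

definition long_idx :: "ctype \<Rightarrow> nat \<Rightarrow> bool" where
  "long_idx T r \<longleftrightarrow> r < bdim T \<and>
     (if r < rank T then ip T (sroot T r) (sroot T r) else ip T (wt T r) (wt T r)) = long_norm T"

lemma long_idx_root: "a \<in> Phi T \<Longrightarrow> long_idx T (ridx T a) \<longleftrightarrow> ip T a a = long_norm T"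
  by (simp add: long_idx_def)

lemma root_norm_cases: "a \<in> Phi T \<Longrightarrow> ip T a a \<noteq> long_norm T \<Longrightarrow> ip T a a = 2"
  by (auto simp: Phi_iff)

lemma short_not_long: "long_norm T \<noteq> 2"
  by (cases T) auto

context chev begin

text \<open>Once the lacing number vanishes in the field, the vectors without long components form an
  ideal (spanned by the short roots).\<close>
lemma Dd_short_long:
  assumes b: "b \<in> Phi T" and r: "long_idx T r" and c: "c < n" "\<not> long_idx T c" and k: "k > 0"
  shows "int (lacing T) dvd Dd b k (uv c) r"
proof (cases "Dd b k (uv c :: nat \<Rightarrow> int) r = 0")
  case False
  then have w: "r < n" "wt T r = vadd (wt T c) (vsmul (int k) b)" using Dd_weight[OF c(1) b] by auto
  from c(1) show ?thesis
  proof (cases rule: index_cases)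
    case 1
    then have wr: "wt T r = vsmul (int k) b" using w b by (simp add: Phi_length)
    have "k = 1"
    proof (rule ccontr)
      assume "k \<noteq> 1"
      then obtain j where "k = Suc (Suc j)" using k by (metis One_nat_def gr0_implies_Suc neq0_conv)
      then have "adp b k (uv c) = 0" using adp_h(2)[OF b 1] by simp
      then have "sc (fact k) (Dd b k (uv c)) r = (0::int)" by (simp add: Dd_fact[OF b] zero_fun_apply)
      then show False using False by (simp add: vec_apply)
    qed
    then have rb: "r = ix b" using wr wt_eq_root[OF w(1) b] b by (simp add: vsmul_def)
    then have lb: "ip T b b = long_norm T" using r b by (simp add: long_idx_root)
    have "ip T (sroot T c) (sroot T c) = 2"
      using c 1 root_norm_cases[OF sroot_Phi[OF 1]] by (auto simp: long_idx_def)
    then have "cartan_int T b (sroot T c) = ip T (sroot T c) b"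
      using cartan_int_mult[OF sroot_Phi[OF 1] Phi_length[OF b]] ip_sym[of b T "sroot T c"] b by (simp add: Phi_length)
    moreover have "int (lacing T) dvd ip T (sroot T c) b"
      using long_root_dvd[OF b lb, of "sroot T c"] by (simp add: long_norm_lacing)
    moreover have "Dd b k (uv c) r = - cartan_int T b (sroot T c)"
      using \<open>k = 1\<close> Dd_1[OF b, of "uv c :: nat \<Rightarrow> int"] B_E_uv[OF 1 b, where 'a = int] rb by (simp add: vec_apply)
    ultimately show ?thesis by simp
  next
    case (2 g)
    then have g2: "ip T g g = 2" using c(2) root_norm_cases[of g T] by (auto simp: long_idx_root)
    consider "g = b" | "g = vneg b" | "g \<noteq> b" "g \<noteq> vneg b" by blast
    then show ?thesis
    proof cases
      case 1
      then have "wt T r = vsmul (int (Suc k)) b" using w 2 b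
        by (cases rule: length_rankE[OF Phi_length[OF b]]) (auto simp: algebra_simps)
      then have ip: "ip T (wt T r) (wt T r) = int (Suc k) * int (Suc k) * 2"
        using 1 g2 b by (simp add: ip_lin Phi_length)
      then have "ip T (wt T r) (wt T r) \<noteq> 0" by simp
      then have "\<not> r < rank T" using zv_notin_Phi by (auto simp: ip_def)
      then have "int (Suc k) * int (Suc k) = int (lacing T)" using r ip by (simp add: long_idx_def long_norm_lacing)
      moreover have "k \<le> 3" using Dd_zero4[OF b, of k "uv c :: nat \<Rightarrow> int"] False by (cases "k \<ge> 4") (auto simp: zero_fun_apply)
      ultimately have False using k by (cases T) (auto simp: numeral_eq_Suc le_Suc_eq)
      then show ?thesis ..
    next
      case opp: 2
      have bn: "ip T b b = 2" using g2 opp b by (simp add: ip_lin Phi_length)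
      have rb: "r \<noteq> ix b" using r bn b short_not_long[of T] by (auto simp: long_idx_root)
      have "Dd b k (E (vneg b)) = (if k \<le> 2 then (if k = 1 then Hc b else - E b) else (0 :: nat \<Rightarrow> int))"
        using Dd_slstr[OF b slstr_Hc[OF b], of 0 k] k by auto
      then have D: "Dd b k (uv c) = (if k \<le> 2 then (if k = 1 then Hc b else - E b) else (0 :: nat \<Rightarrow> int))"
        using 2 opp by simp
      then have "Dd b k (uv c) r = (Hc b r :: int)" using False rb by (auto simp: vec_apply uv_def split: if_splits)
      moreover have "int (lacing T) dvd Hc b r"
      proof (cases "r < rank T")
        case True
        then have "coroot_coef T b r * 2 = b ! r * (2 * int (lacing T))"
          using coroot_coef_mult[OF b True] r bn by (simp add: long_idx_def long_norm_lacing)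
        with True show ?thesis by (simp add: Hc_def)
      qed (simp add: Hc_def)
      ultimately show ?thesis by simp
    next
      case 3
      obtain i m and s :: "nat \<Rightarrow> int" where im: "i \<le> m" "m \<le> (if T = F4 then 2 else 3)"
        "\<And>k. k \<le> m - i \<Longrightarrow> vadd g (vsmul (int k) b) \<in> Phi T"
        "\<And>k. Dd b k (E g) = (if k \<le> m - i
          then sc (of_int (s k * int ((i + k) choose k))) (E (vadd g (vsmul (int k) b))) else (0 :: nat \<Rightarrow> int))"
        "2 * ip T g b = (2 * int i - int m) * ip T b b"
        by (rule Dd_E[OF b 2(1) 3, where 'b = int]) blast
      have km: "k \<le> m - i" using False im(4)[of k] 2 by (auto simp: zero_fun_apply split: if_splits)
      have D: "Dd b k (uv c) r = s k * int ((i + k) choose k) * uv (ix (vadd g (vsmul (int k) b))) r"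
        using im(4)[of k] 2 km by (simp add: vec_apply)
      then have rr: "r = ix (vadd g (vsmul (int k) b))" using False by (auto simp: uv_def split: if_splits)
      then have "ip T (vadd g (vsmul (int k) b)) (vadd g (vsmul (int k) b)) = long_norm T"
        using r im(3)[OF km] by (simp add: long_idx_root)
      then have nrm: "2 + 2 * int k * ip T g b + int k * int k * ip T b b = 2 * int (lacing T)"
        using g2 2 b ip_sym[of b T g] by (simp add: ip_lin Phi_length long_norm_lacing algebra_simps)
      have bb: "ip T b b = 2 \<or> ip T b b = 2 * int (lacing T)" using b by (simp add: Phi_iff long_norm_lacing)
      \<comment> \<open>If adding k b turns a short root into a long one, the norm equation leaves
        only positions of the string whose binomial coefficient is a multiple of the lacing
        number.\<close>
      have "int (lacing T) dvd int ((i + k) choose k)"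
        using im(1,2,5) km k nrm bb
        by (cases T) (auto simp: numeral_eq_Suc le_Suc_eq)
      then show ?thesis by (simp add: D)
    qed
  qed
qed simp

lemma short_ideal:
  assumes "g \<in> G" and q: "of_nat (lacing T) = (0::'a::field)" and v: "\<And>r. long_idx T r \<Longrightarrow> v r = (0::'a)"
  shows "long_idx T r \<Longrightarrow> mv n g v r = 0"
  using assms(1) unfolding chev_group_def
proof (induction arbitrary: r rule: gen_by.induct)
  case (step g x)
  then obtain b t where b: "b \<in> Phi T" "x = xr T N b t" by auto
  have "g \<in> carrier_mat n n" using step.hyps(1) G_carrier unfolding chev_group_def by blast
  then have e: "mv n (x * g) v = (\<Sum>k<4. sc (t ^ k) (Dd b k (mv n g v)))"
    using b by (simp add: mv_mult[of _ n] xr_eq_xm mv_xm)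
  have "Dd b k (mv n g v) r = 0" for k
  proof (cases "k = 0")
    case False
    have "mv n g v c * Dd b k (uv c) r = 0" if "c < n" for c
    proof (cases "long_idx T c")
      case False
      then have "int (lacing T) dvd Dd b k (uv c) r" using \<open>k \<noteq> 0\<close> that step.prems by (intro Dd_short_long b) auto
      then obtain d where "Dd b k (uv c) r = int (lacing T) * d" ..
      then have "of_int (Dd b k (uv c) r) = (0::'a)" using q by simp
      moreover have "(Dd b k (uv c) r :: 'a) = of_int (Dd b k (uv c) r)"
        using fun_cong[OF Dd_emb[of b k "uv c", where 'a = 'a], of r] by (simp add: emb_def[of "Dd b k (uv c)"])
      ultimately show ?thesis by simp
    qed (use step.IH in simp)
    then show ?thesis using False by (subst nlin_expand[OF nlin_Dd]) (auto intro!: sum.neutral)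
  qed (use step in simp)
  then show ?case by (simp add: e sum_fun_apply vec_apply)
qed (use v in simp)

end

section \<open>Excluded nodes of F4 and G2\<close>

text \<open>Weight conditions under which the entry of a conjugate of \<open>x\<^sub>\<alpha>(t)\<close> in row \<open>\<rho>\<close> and column
  \<open>b + c\<close> vanishes, provided that the conjugate of \<open>e\<^sub>\<alpha>\<close> has no components of weight in \<open>Z\<close>.\<close>
definition split_ok :: "ctype \<Rightarrow> int list set \<Rightarrow> int list \<Rightarrow> int list \<Rightarrow> int list \<Rightarrow> bool" where
  "split_ok T Z b c \<rho> \<longleftrightarrow> (let R = insert (zv T) (Phi T); \<sigma> = vadd \<rho> (vneg (vadd b c)) in
     b \<in> Phi T \<and> c \<in> Phi T \<and> vadd b c \<in> Phi T \<and> vadd c (vneg b) \<notin> Phi T \<and> \<rho> \<in> Phi T \<and> \<rho> \<noteq> vadd b c \<and>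
     \<sigma> \<notin> R \<and> vadd \<rho> (vneg b) \<notin> R \<and> vadd \<rho> (vneg c) \<notin> R \<and>
     list_all (\<lambda>x. vadd \<sigma> (vneg x) \<in> R \<longrightarrow> x \<in> Z \<or> vadd \<sigma> (vneg x) \<in> Z) (zv T # root_enum T) \<and>
     (T = G2 \<longrightarrow> list_all (\<lambda>x. vadd (vadd \<rho> (vneg b)) (vneg x) \<in> R \<or> vadd (vadd \<rho> (vneg c)) (vneg x) \<in> R
        \<longrightarrow> x \<in> Z) (zv T # root_enum T)))"

lemma S_F4: "S F4 = {1, 2, 3, 4}" and S_G2: "S G2 = {1, 2}"
  by (auto simp: S_def)

lemma replicate_small: "replicate 4 x = [x, x, x, x]" "replicate 2 x = [x, x]"
  by (simp_all add: numeral_eq_Suc)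

lemma vadd_solve:
  assumes "length x = rank T" "length y = rank T" "length b = rank T" "length c = rank T"
  shows "vadd x b = \<rho> \<Longrightarrow> x = vadd \<rho> (vneg b)"
    "vadd (vadd x b) (vadd y c) = \<rho> \<Longrightarrow> y = vadd (vadd \<rho> (vneg (vadd b c))) (vneg x)"
    "vadd y (vadd x c) = \<rho> \<Longrightarrow> y = vadd (vadd \<rho> (vneg c)) (vneg x)"
    "vadd (vadd x c) y = \<rho> \<Longrightarrow> y = vadd (vadd \<rho> (vneg c)) (vneg x)"
  by (cases rule: length_rankE[OF assms(1)]; cases rule: length_rankE[OF assms(2)];
      cases rule: length_rankE[OF assms(3)]; cases rule: length_rankE[OF assms(4)]; auto)+

context chev begin

lemma split_entry_zero:
  assumes g: "g \<in> G" "g' \<in> G" "g' * g = 1\<^sub>m n" "g * g' = 1\<^sub>m n" and \<alpha>: "\<alpha> \<in> Phi T"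
    and ok: "split_ok T Z b c \<rho>"
    and Z: "\<And>i. i < n \<Longrightarrow> wt T i \<in> Z \<Longrightarrow> mv n g' (E \<alpha>) i = (0::'a::field)"
  shows "mv n (g' * (xr T N \<alpha> t * g)) (E (vadd b c)) (ix \<rho>) = 0"
proof (rule conj_entry_zero[OF g \<alpha>, where Z = Z])
  define R where "R = insert (zv T) (Phi T)"
  have len: "length x = rank T" if "x \<in> R" for x using that by (auto simp: R_def Phi_length)
  have R: "set (zv T # root_enum T) = R" by (simp add: R_def Phi_eq)
  note o = ok[unfolded split_ok_def Let_def, folded R_def, unfolded list_all_iff R]
  show bc: "b \<in> Phi T" "c \<in> Phi T" "vadd b c \<in> Phi T" "\<rho> \<in> Phi T" "\<rho> \<noteq> vadd b c" using o by blast+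
  have "vadd c (vsmul (- int (Suc 0)) b) = vadd c (vneg b)" by (simp add: vsmul_def vneg_def)
  then show "pstr T b c = 0" using o by (intro pstr_eqI) auto
  note l = bc(1-3)[THEN Phi_length]
  show "vadd x b \<noteq> \<rho> \<and> vadd x c \<noteq> \<rho> \<and> vadd x (vadd b c) \<noteq> \<rho>" if "x \<in> insert (zv T) (Phi T)" for x
    using o that[folded R_def] vadd_solve(1)[OF len len l(1) l(1), of x x \<rho>] vadd_solve(1)[OF len len l(2) l(2), of x x \<rho>]
      vadd_solve(1)[OF len len l(3) l(3), of x x \<rho>] by auto
  show "x \<in> Z \<or> x' \<in> Z" if "x \<in> insert (zv T) (Phi T)" "x' \<in> insert (zv T) (Phi T)" "vadd (vadd x b) (vadd x' c) = \<rho>" for x x'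
  proof -
    have xx: "x \<in> R" "x' \<in> R" using that by (simp_all add: R_def)
    have "x' = vadd (vadd \<rho> (vneg (vadd b c))) (vneg x)"
      by (rule vadd_solve(2)[OF len len l(1) l(2) that(3)]) (rule xx)+
    then show ?thesis using o xx by metis
  qed
  show "x \<in> Z" if "T = G2" "x \<in> insert (zv T) (Phi T)" "y \<in> insert (zv T) (Phi T)"
    "vadd y (vadd x c) = \<rho> \<or> vadd (vadd x b) y = \<rho>" for x y
  proof -
    have xy: "x \<in> R" "y \<in> R" using that by (simp_all add: R_def)
    have "vadd (vadd \<rho> (vneg b)) (vneg x) \<in> R \<or> vadd (vadd \<rho> (vneg c)) (vneg x) \<in> R"
      using that(4) vadd_solve(3)[OF len len l(1) l(2), of x y \<rho>] vadd_solve(4)[OF len len l(1) l(1), of x y \<rho>] xy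
      by metis
    then show ?thesis using o that(1) xy(1) by blast
  qed
qed (rule Z)

lemma PclosedI:
  assumes "W \<subseteq> Phi T"
    and "\<forall>w\<in>W. list_all (\<lambda>b. nonneg_vec b \<or> b \<in> (\<lambda>i. vneg (sroot T (i - 1))) ` K \<longrightarrow>
      list_all (\<lambda>k. vadd w (vsmul k b) \<in> insert (zv T) (Phi T) \<longrightarrow> vadd w (vsmul k b) \<in> W) [1,2,3]) (root_enum T)"
  shows "Pclosed K W"
  unfolding Pclosed_def
proof (intro conjI ballI impI assms(1))
  fix w b and k :: nat assume "w \<in> W" "b \<in> Phi T" "k \<in> {1,2,3}" "pos_root T b \<or> (\<exists>i\<in>K. b = vneg (sroot T (i - 1)))"
    "vadd w (vsmul (int k) b) \<in> insert (zv T) (Phi T)"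
  then show "vadd w (vsmul (int k) b) \<in> W"
    using assms(2) unfolding pos_root_code list_all_iff Phi_eq[symmetric] by fastforce
qed

text \<open>The hypothesis \<open>main\<close> leaves three choices that may depend on g: a
  replacement of g by g x with x in the parabolic, the row -w, and the set \<open>Z\<close> of
  missing weights. Each column in W then needs its own splitting b + c.\<close>

lemma Type_notinI:
  assumes \<alpha>: "\<alpha> \<in> Phi T" and W: "Pclosed (S T - {i}) W"
    and main: "\<And>g g' :: 'a::field mat. g \<in> G \<Longrightarrow> g' \<in> G \<Longrightarrow> g' * g = 1\<^sub>m n \<Longrightarrow> g * g' = 1\<^sub>m n \<Longrightarrow>
      \<exists>x\<in>P (S T - {i}). \<exists>x'\<in>P (S T - {i}). x * x' = 1\<^sub>m n \<and> x' * x = 1\<^sub>m n \<and>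
        (\<exists>w\<in>W. \<exists>Z. (\<forall>w'\<in>W. \<exists>b c. w' = vadd b c \<and> split_ok T Z b c (vneg w)) \<and>
          (\<forall>j<n. wt T j \<in> Z \<longrightarrow> mv n (x' * g') (E \<alpha>) j = 0))"
  shows "i \<notin> Type T N (xr T N \<alpha> (t::'a))"
proof
  assume "i \<in> Type T N (xr T N \<alpha> t)"
  then obtain g p1 p2 where g: "g \<in> G" and p: "p1 \<in> P (S T - {i})" "p2 \<in> P (S T - {i})"
    "xr T N \<alpha> t * g = g * (p1 * (w0_rep T N * p2))" using Type_iff[OF xr_G[OF \<alpha>]] by blast
  obtain g' where g': "g' \<in> G" "g * g' = 1\<^sub>m n" "g' * g = 1\<^sub>m n" using G_inverse[OF g] .
  obtain x x' w Z where x: "x \<in> P (S T - {i})" "x' \<in> P (S T - {i})" "x * x' = 1\<^sub>m n" "x' * x = 1\<^sub>m n" and w: "w \<in> W"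
    and ok: "\<And>w'. w' \<in> W \<Longrightarrow> \<exists>b c. w' = vadd b c \<and> split_ok T Z b c (vneg w)"
    and Z: "\<And>j. j < n \<Longrightarrow> wt T j \<in> Z \<Longrightarrow> mv n (x' * g') (E \<alpha>) j = 0"
    using main[OF g g'(1,3,2)] by blast
  have K: "S T - {i} \<subseteq> S T" by blast
  have xG: "x \<in> G" "x' \<in> G" using P_G[OF K] x by blast+
  note car = G_carrier[OF g] G_carrier[OF g'(1)] P_carrier[OF p(1)] P_carrier[OF p(2)] P_carrier[OF x(1)] P_carrier[OF x(2)]
    w0_rep_carrier xr_carrier[of \<alpha> t]
  have "(x' * g') * (g * x) = x' * ((g' * g) * x)" using car by (simp add: mat_assoc)
  then have i1: "(x' * g') * (g * x) = 1\<^sub>m n" using car g' x by simp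
  have "(g * x) * (x' * g') = g * ((x * x') * g')" using car by (simp add: mat_assoc)
  then have i2: "(g * x) * (x' * g') = 1\<^sub>m n" using car g' x by simp
  have "(x' * g') * (xr T N \<alpha> t * (g * x)) = x' * (g' * ((xr T N \<alpha> t * g) * x))" using car by (simp add: mat_assoc)
  also have "\<dots> = x' * ((g' * g) * (p1 * (w0_rep T N * p2) * x))" using car by (simp add: p(3) mat_assoc)
  also have "\<dots> = (x' * p1) * (w0_rep T N * (p2 * x))" using car g'(3) by (simp add: mat_assoc)
  finally have e: "(x' * g') * (xr T N \<alpha> t * (g * x)) = (x' * p1) * (w0_rep T N * (p2 * x))" .
  show False
  proof (rule opposite_row_nonzero[OF P_mult[OF x(2) p(1)] P_mult[OF p(2) x(1)] K W w])
    fix w' assume "w' \<in> W"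
    then obtain b c where bc: "w' = vadd b c" "split_ok T Z b c (vneg w)" using ok by blast
    show "mv n ((x' * p1) * (w0_rep T N * (p2 * x))) (E w') (ix (vneg w)) = 0"
      unfolding e[symmetric] bc(1)
      by (rule split_entry_zero[OF G_mult[OF g xG(1)] G_mult[OF xG(2) g'(1)] i1 i2 \<alpha> bc(2) Z])
  qed
qed

lemma mv_short_long_zero:
  assumes "g \<in> G" "short_root T \<alpha>" "of_nat (lacing T) = (0::'a::field)" "long_idx T j"
  shows "mv n g (E \<alpha>) j = (0::'a)"
proof (rule short_ideal[OF assms(1,3) _ assms(4)])
  fix r assume "long_idx T r"
  then show "(E \<alpha> :: nat \<Rightarrow> 'a) r = 0"
    using assms(2) short_not_long[of T] by (auto simp: uv_def short_root_def long_idx_root)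
qed

lemma P_one_inverse: "\<exists>x\<in>P K. \<exists>x'\<in>P K. x * x' = 1\<^sub>m n \<and> x' * x = 1\<^sub>m n \<and> Q (x' * g')"
  if "Q g'" "g' \<in> carrier_mat n n" for g' :: "'a::field mat"
  using that P_one[of K] by (intro bexI[of _ "1\<^sub>m n"]) auto

lemma F4_not_type_1:
  assumes T: "T = F4" and \<alpha>: "short_root T \<alpha>" and char: "(2::'a::field) = 0"
  shows "1 \<notin> Type T N (xr T N \<alpha> (t::'a))"
proof (rule Type_notinI)
  show "\<alpha> \<in> Phi T" using \<alpha> by (simp add: short_root_def)
  show "Pclosed (S T - {1}) {[2,3,4,2]}"
    by (rule PclosedI) (simp_all add: T S_F4 root_enum_def nonneg_vec_def Phi_iff ip_F4 replicate_small)
  fix g g' :: "'a mat" assume g: "g \<in> G" "g' \<in> G" "g' * g = 1\<^sub>m n" "g * g' = 1\<^sub>m n"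
  have lac: "of_nat (lacing T) = (0::'a)" using char by (simp add: T)
  \<comment> \<open>Row -h and column h differ by the weight -2h, whose only decomposition into two
    weights is (-h) + (-h); so it suffices that a has no component at -h.\<close>
  let ?Z = "{[-2,-3,-4,-2]} :: int list set"
  have ok: "split_ok T ?Z [1,0,0,0] [1,3,4,2] [-2,-3,-4,-2]"
    unfolding split_ok_def Let_def T root_enum_def by (simp add: Phi_iff ip_F4 replicate_small)
  have "long_idx T j" if "j < n" "wt T j \<in> ?Z" for j
    using that by (auto simp: long_idx_def T ip_F4 replicate_small)
  then have "\<forall>j<n. wt T j \<in> ?Z \<longrightarrow> mv n g' (E \<alpha>) j = 0"
    using mv_short_long_zero[OF g(2) \<alpha> lac] by blast
  with ok have "\<exists>w\<in>{[2,3,4,2]}. \<exists>Z. (\<forall>w'\<in>{[2,3,4,2]}. \<exists>b c. w' = vadd b c \<and> split_ok T Z b c (vneg w)) \<and>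
          (\<forall>j<n. wt T j \<in> Z \<longrightarrow> mv n g' (E \<alpha>) j = 0)"
    by (intro bexI[of _ "[2,3,4,2]"] exI[of _ ?Z] conjI ballI exI[of _ "[1,0,0,0]"] exI[of _ "[1,3,4,2]"]) auto
  then show "\<exists>x\<in>P (S T - {1}). \<exists>x'\<in>P (S T - {1}). x * x' = 1\<^sub>m n \<and> x' * x = 1\<^sub>m n \<and>
        (\<exists>w\<in>{[2,3,4,2]}. \<exists>Z. (\<forall>w'\<in>{[2,3,4,2]}. \<exists>b c. w' = vadd b c \<and> split_ok T Z b c (vneg w)) \<and>
          (\<forall>j<n. wt T j \<in> Z \<longrightarrow> mv n (x' * g') (E \<alpha>) j = 0))"
    by (rule P_one_inverse) (rule G_carrier[OF g(2)])
qed

lemma G2_not_type_2: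
  assumes T: "T = G2" and \<alpha>: "short_root T \<alpha>" and char: "(3::'a::field) = 0"
  shows "2 \<notin> Type T N (xr T N \<alpha> (t::'a))"
proof (rule Type_notinI)
  show "\<alpha> \<in> Phi T" using \<alpha> by (simp add: short_root_def)
  show "Pclosed (S T - {2}) {[3,2]}"
    by (rule PclosedI) (simp_all add: T S_G2 insert_Diff_if root_enum_def nonneg_vec_def Phi_iff ip_G2 replicate_small)
  fix g g' :: "'a mat" assume g: "g \<in> G" "g' \<in> G" "g' * g = 1\<^sub>m n" "g * g' = 1\<^sub>m n"
  have lac: "of_nat (lacing T) = (0::'a)" using char by (simp add: T)
  \<comment> \<open>For G2 the cubic term involves further weights of a; these are long as well, so
    \<open>Z\<close> collects all long roots.\<close>
  let ?Z = "{x \<in> Phi T. ip T x x = long_norm T}"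
  have ok: "split_ok T ?Z [0,1] [3,1] [-3,-2]"
    unfolding split_ok_def Let_def T root_enum_def by (simp add: Phi_iff ip_G2 replicate_small)
  have "long_idx T j" if "j < n" "wt T j \<in> ?Z" for j
    using that wt_eq_root[OF that(1), of "wt T j"] by (auto simp: long_idx_def)
  then have "\<forall>j<n. wt T j \<in> ?Z \<longrightarrow> mv n g' (E \<alpha>) j = 0"
    using mv_short_long_zero[OF g(2) \<alpha> lac] by blast
  with ok have "\<exists>w\<in>{[3,2]}. \<exists>Z. (\<forall>w'\<in>{[3,2]}. \<exists>b c. w' = vadd b c \<and> split_ok T Z b c (vneg w)) \<and>
          (\<forall>j<n. wt T j \<in> Z \<longrightarrow> mv n g' (E \<alpha>) j = 0)"
    by (intro bexI[of _ "[3,2]"] exI[of _ ?Z] conjI ballI exI[of _ "[0,1]"] exI[of _ "[3,1]"]) auto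
  then show "\<exists>x\<in>P (S T - {2}). \<exists>x'\<in>P (S T - {2}). x * x' = 1\<^sub>m n \<and> x' * x = 1\<^sub>m n \<and>
        (\<exists>w\<in>{[3,2]}. \<exists>Z. (\<forall>w'\<in>{[3,2]}. \<exists>b c. w' = vadd b c \<and> split_ok T Z b c (vneg w)) \<and>
          (\<forall>j<n. wt T j \<in> Z \<longrightarrow> mv n (x' * g') (E \<alpha>) j = 0))"
    by (rule P_one_inverse) (rule G_carrier[OF g(2)])
qed

text \<open>Let a = g^-1 e_alpha. Either its component at -h is zero, or x_d(s) with d = alpha_1
  moves a multiple of that component to the weight -h + alpha_1 and can cancel the component there.
  As i differs from 1, both h and h - alpha_1 lie in W, so either weight may serve as the
  row.\<close>

lemma F4_not_type_middle:
  assumes T: "T = F4" and \<alpha>: "\<alpha> \<in> Phi T"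
    and W: "Pclosed (S T - {i}) W" "W \<subseteq> {[2,3,4,2], [1,3,4,2], [1,2,4,2]}" "[2,3,4,2] \<in> W" "[1,3,4,2] \<in> W" and i: "1 \<in> S T - {i}"
  shows "i \<notin> Type T N (xr T N \<alpha> (t::'a::field))"
proof (rule Type_notinI[OF \<alpha> W(1)])
  fix g g' :: "'a mat" assume g: "g \<in> G" "g' \<in> G"
  let ?d = "[1,0,0,0] :: int list" and ?u1 = "[-2,-3,-4,-2] :: int list" and ?u2 = "[-1,-3,-4,-2] :: int list"
  have PhiI: "?d \<in> Phi T" "?u1 \<in> Phi T" "?u2 \<in> Phi T" by (simp_all add: T Phi_iff ip_F4)
  define a where "a = mv n g' (E \<alpha> :: nat \<Rightarrow> 'a)"
  have "\<exists>s. mv n (xr T N ?d s) a (ix ?u1) = 0 \<or> mv n (xr T N ?d s) a (ix ?u2) = 0"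
  proof (cases "a (ix ?u1) = 0")
    case True
    then show ?thesis by (intro exI[of _ 0]) (simp add: xr_eq_xm xm_zero[OF PhiI(1)])
  next
    case False
    have wtc: "c = ix ?u1" if c: "c < n" "?u2 = vadd (wt T c) (vsmul 1 ?d)" for c
    proof -
      obtain p q r s where "wt T c = [p,q,r,s]" by (rule length_4E[of "wt T c"]) (use c(1) in \<open>simp add: T\<close>)
      with c(2) have "wt T c = ?u1" by simp
      then show ?thesis using wt_eq_root[OF c(1) PhiI(2)] by simp
    qed
    have Dk: "Dd ?d k a (ix ?u2) = 0" if k: "k \<in> {2,3}" for k
    proof (rule Dd_entry_zero[OF _ PhiI(1)])
      show "k > 0" using k by auto
      fix c assume c: "c < n" "wt T (ix ?u2) = vadd (wt T c) (vsmul (int k) ?d)"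
      obtain p q r s where "wt T c = [p,q,r,s]" by (rule length_4E[of "wt T c"]) (use c(1) in \<open>simp add: T\<close>)
      with c k PhiI(3) have "wt T c = [-3,-3,-4,-2] \<or> wt T c = [-4,-3,-4,-2]" by auto
      with wt_cases[OF c(1)] have False by (auto simp: T Phi_iff ip_F4 replicate_small)
      then show "a c = 0" ..
    qed
    have D0: "Dd ?d (Suc 0) (uv c :: nat \<Rightarrow> 'a) (ix ?u2) = 0" if "c < n" "c \<noteq> ix ?u1" for c
      using Dd_weight[OF that(1) PhiI(1), of "Suc 0" "ix ?u2", where 'a = 'a] wtc[OF that(1)] that(2) PhiI(3) by auto
    have "Dd ?d (Suc 0) a (ix ?u2) = (\<Sum>c<n. a c * Dd ?d (Suc 0) (uv c) (ix ?u2))"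
      by (rule nlin_expand[OF nlin_Dd]) simp
    also have "\<dots> = (\<Sum>c<n. if c = ix ?u1 then a c * Dd ?d (Suc 0) (uv c) (ix ?u2) else 0)"
      using D0 by (intro sum.cong) auto
    also have "\<dots> = a (ix ?u1) * Dd ?d (Suc 0) (E ?u1) (ix ?u2)" using PhiI(2) by simp
    also have "Dd ?d (Suc 0) (E ?u1) = sc (of_int (N ?d ?u1)) (E ?u2 :: nat \<Rightarrow> 'a)"
      using Dd_1[OF PhiI(1), of "E ?u1 :: nat \<Rightarrow> 'a"] B_EE[OF PhiI(1,2), where 'a = 'a] PhiI(3) by simp
    finally have D1: "Dd ?d (Suc 0) a (ix ?u2) = a (ix ?u1) * of_int (N ?d ?u1)" by (simp add: vec_apply)
    have "pstr T ?d ?u1 = 0" by (rule pstr_eqI) (simp_all add: T Phi_iff ip_F4)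
    then have "\<bar>N ?d ?u1\<bar> = 1" using abs_N[OF PhiI(1,2)] PhiI(3) by simp
    then have "N ?d ?u1 = 1 \<or> N ?d ?u1 = - 1" by auto
    then have N0: "(of_int (N ?d ?u1) :: 'a) \<noteq> 0" by auto
    \<comment> \<open>Higher divided powers do not reach the weight -h + alpha_1, so the component
      there is affine in s, with slope +- the nonzero component at -h.\<close>
    define s where "s = - a (ix ?u2) / (a (ix ?u1) * of_int (N ?d ?u1))"
    have "mv n (xr T N ?d s) a (ix ?u2) = 0"
      using False N0 Dk[of 2] Dk[of 3] by (simp add: xr_eq_xm mv_xm[OF PhiI(1)] sum_upto4 vec_apply D1 s_def)
    then show ?thesis by blast
  qed
  then obtain s where s: "mv n (xr T N ?d s) a (ix ?u1) = 0 \<or> mv n (xr T N ?d s) a (ix ?u2) = 0" ..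
  have xP: "xr T N ?d r \<in> P (S T - {i})" for r :: 'a
    by (rule xr_pos_P) (simp add: T pos_root_def Phi_iff ip_F4)
  \<comment> \<open>The summands may be negative roots: only the weight conditions and a structure
    constant +-1 matter.\<close>
  have ok1: "split_ok T {?u1} [1,0,0,0] [1,3,4,2] ?u1" "split_ok T {?u1} [0,1,0,0] [1,2,4,2] ?u1"
      "split_ok T {?u1} [0,-1,0,0] [1,3,4,2] ?u1"
    and ok2: "split_ok T {?u2} [1,1,0,0] [1,2,4,2] ?u2" "split_ok T {?u2} [-1,0,0,0] [2,3,4,2] ?u2"
      "split_ok T {?u2} [-1,-1,0,0] [2,3,4,2] ?u2"
    unfolding split_ok_def Let_def T root_enum_def by (simp_all add: Phi_iff ip_F4 replicate_small)
  have vn: "vneg [2,3,4,2] = ?u1" "vneg [1,3,4,2] = ?u2" by simp_all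
  have W1: "\<exists>b c. w' = vadd b c \<and> split_ok T {?u1} b c (vneg [2,3,4,2])" if "w' \<in> W" for w'
  proof -
    have "w' \<in> {[2,3,4,2], [1,3,4,2], [1,2,4,2]}" using that W(2) by blast
    then consider "w' = vadd [1,0,0,0] [1,3,4,2]" | "w' = vadd [0,1,0,0] [1,2,4,2]" | "w' = vadd [0,-1,0,0] [1,3,4,2]" by auto
    then show ?thesis unfolding vn using ok1 by cases blast+
  qed
  have W2: "\<exists>b c. w' = vadd b c \<and> split_ok T {?u2} b c (vneg [1,3,4,2])" if "w' \<in> W" for w'
  proof -
    have "w' \<in> {[2,3,4,2], [1,3,4,2], [1,2,4,2]}" using that W(2) by blast
    then consider "w' = vadd [1,1,0,0] [1,2,4,2]" | "w' = vadd [-1,0,0,0] [2,3,4,2]" | "w' = vadd [-1,-1,0,0] [2,3,4,2]" by auto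
    then show ?thesis unfolding vn using ok2 by cases blast+
  qed
  have a': "mv n (xr T N ?d s * g') (E \<alpha>) = mv n (xr T N ?d s) a"
    unfolding a_def by (rule mv_mult) (simp_all add: G_carrier[OF g(2)])
  have "\<exists>w\<in>W. \<exists>Z. (\<forall>w'\<in>W. \<exists>b c. w' = vadd b c \<and> split_ok T Z b c (vneg w)) \<and>
          (\<forall>j<n. wt T j \<in> Z \<longrightarrow> mv n (xr T N ?d s * g') (E \<alpha>) j = 0)"
    using s
  proof
    assume z: "mv n (xr T N ?d s) a (ix ?u1) = 0"
    show ?thesis
      by (intro bexI[OF _ W(3)] exI[of _ "{?u1}"] conjI ballI W1) (use z PhiI(2) in \<open>auto simp: a' wt_eq_root\<close>)
  next
    assume z: "mv n (xr T N ?d s) a (ix ?u2) = 0"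
    show ?thesis
      by (intro bexI[OF _ W(4)] exI[of _ "{?u2}"] conjI ballI W2) (use z PhiI(3) in \<open>auto simp: a' wt_eq_root\<close>)
  qed
  then show "\<exists>x\<in>P (S T - {i}). \<exists>x'\<in>P (S T - {i}). x * x' = 1\<^sub>m n \<and> x' * x = 1\<^sub>m n \<and>
        (\<exists>w\<in>W. \<exists>Z. (\<forall>w'\<in>W. \<exists>b c. w' = vadd b c \<and> split_ok T Z b c (vneg w)) \<and>
          (\<forall>j<n. wt T j \<in> Z \<longrightarrow> mv n (x' * g') (E \<alpha>) j = 0))"
    by (intro bexI[OF _ xP[of "- s"]] bexI[OF _ xP[of s]] conjI xr_inverse PhiI(1)) assumption
qed

lemma F4_not_type_2_3:
  assumes T: "T = F4" and \<alpha>: "\<alpha> \<in> Phi T"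
  shows "2 \<notin> Type T N (xr T N \<alpha> (t::'a::field))" "3 \<notin> Type T N (xr T N \<alpha> t)"
proof -
  \<comment> \<open>W is the orbit of h under the Levi part of the parabolic, of which only alpha_1,
    or alpha_1 and alpha_2, move h.\<close>
  have "Pclosed (S T - {2}) {[2,3,4,2], [1,3,4,2]}" "Pclosed (S T - {3}) {[2,3,4,2], [1,3,4,2], [1,2,4,2]}"
    by (rule PclosedI; simp add: T S_F4 insert_Diff_if root_enum_def nonneg_vec_def Phi_iff ip_F4 replicate_small)+
  from this[THEN F4_not_type_middle[OF T \<alpha>]]
  show "2 \<notin> Type T N (xr T N \<alpha> t)" "3 \<notin> Type T N (xr T N \<alpha> t)" by (auto simp: T S_F4)
qed

end

section \<open>Types of short root elements\<close>

lemma CHAR_eq_prime_iff: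
  assumes "prime p" shows "CHAR('a::field) = p \<longleftrightarrow> of_nat p = (0::'a)"
proof
  assume "of_nat p = (0::'a)"
  then have "CHAR('a) dvd p" by (simp add: of_nat_eq_0_iff_char_dvd)
  then have "CHAR('a) = 1 \<or> CHAR('a) = p" using assms by (auto simp: prime_nat_iff)
  then show "CHAR('a) = p" using of_nat_CHAR[where 'a = 'a] by auto
qed (metis of_nat_CHAR)

lemma root_element_F4:
  fixes \<theta> :: "'a::field mat"
  assumes "chev_constants F4 N" "short_root F4 \<alpha>" "\<theta> \<in> root_subgroup F4 N \<alpha>" "\<theta> \<noteq> 1\<^sub>m (bdim F4)"
  shows "type_preserving F4 N \<theta> \<and> Type F4 N \<theta> = (if CHAR('a) \<noteq> 2 then {1, 4} else {4})"
proof -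
  interpret chev F4 N by standard (rule assms(1))
  obtain t where t: "\<theta> = xr F4 N \<alpha> t" using assms(3) by (auto simp: root_subgroup_def)
  have \<alpha>: "\<alpha> \<in> Phi F4" using assms(2) by (simp add: short_root_def)
  have t0: "t \<noteq> 0" using assms(4) by (auto simp: t xr_eq_xm xm_zero[OF \<alpha>])
  have \<theta>G: "\<theta> \<in> G" unfolding t by (rule xr_G[OF \<alpha>])
  have sub: "Type F4 N \<theta> \<subseteq> {1, 2, 3, 4}" using Type_iff[OF \<theta>G] S_F4 by blast
  have no: "2 \<notin> Type F4 N \<theta>" "3 \<notin> Type F4 N \<theta>" unfolding t by (rule F4_not_type_2_3[OF refl \<alpha>])+
  have four: "4 \<in> Type F4 N \<theta>" unfolding t by (rule F4_type_4[OF refl assms(2) t0])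
  have one: "1 \<in> Type F4 N \<theta> \<longleftrightarrow> (2::'a) \<noteq> 0"
    unfolding t using F4_type_1[OF refl assms(2) t0] F4_not_type_1[OF refl assms(2)] by blast
  have "CHAR('a) = 2 \<longleftrightarrow> (2::'a) = 0" using CHAR_eq_prime_iff[of 2, where 'a = 'a] by simp
  then have "Type F4 N \<theta> = (if CHAR('a) \<noteq> 2 then {1, 4} else {4})"
    using sub no four one by (cases "CHAR('a) = 2") auto
  with type_preservingI[OF \<theta>G] show ?thesis ..
qed

lemma root_element_G2:
  fixes \<theta> :: "'a::field mat"
  assumes "chev_constants G2 N" "short_root G2 \<alpha>" "\<theta> \<in> root_subgroup G2 N \<alpha>" "\<theta> \<noteq> 1\<^sub>m (bdim G2)"
  shows "Type G2 N \<theta> = (if CHAR('a) \<noteq> 3 then S G2 else {1})"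
proof -
  interpret chev G2 N by standard (rule assms(1))
  obtain t where t: "\<theta> = xr G2 N \<alpha> t" using assms(3) by (auto simp: root_subgroup_def)
  have \<alpha>: "\<alpha> \<in> Phi G2" using assms(2) by (simp add: short_root_def)
  have t0: "t \<noteq> 0" using assms(4) by (auto simp: t xr_eq_xm xm_zero[OF \<alpha>])
  have \<theta>G: "\<theta> \<in> G" unfolding t by (rule xr_G[OF \<alpha>])
  have sub: "Type G2 N \<theta> \<subseteq> {1, 2}" using Type_iff[OF \<theta>G] S_G2 by blast
  have one: "1 \<in> Type G2 N \<theta>" unfolding t by (rule G2_type_1[OF refl assms(2) t0])
  have two: "2 \<in> Type G2 N \<theta> \<longleftrightarrow> (3::'a) \<noteq> 0"
    unfolding t using G2_type_2[OF refl assms(2) t0] G2_not_type_2[OF refl assms(2)] by blast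
  have "CHAR('a) = 3 \<longleftrightarrow> (3::'a) = 0" using CHAR_eq_prime_iff[of 3, where 'a = 'a] by simp
  then show ?thesis using sub one two S_G2 by (cases "CHAR('a) = 3") auto
qed

theorem theorem2p9:
  fixes N4 N2 :: "int list \<Rightarrow> int list \<Rightarrow> int"
    and \<theta>4 \<theta>2 :: "'a::field mat"
  shows
   "(chev_constants F4 N4 \<longrightarrow>
      (\<forall>\<alpha>. short_root F4 \<alpha> \<and> \<theta>4 \<in> root_subgroup F4 N4 \<alpha> \<and> \<theta>4 \<noteq> 1\<^sub>m (bdim F4) \<longrightarrow>
         type_preserving F4 N4 \<theta>4 \<and>
         Type F4 N4 \<theta>4 = (if CHAR('a) \<noteq> 2 then {1, 4} else {4})))
    \<and>
    (chev_constants G2 N2 \<longrightarrow>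
      (\<forall>\<alpha>. short_root G2 \<alpha> \<and> \<theta>2 \<in> root_subgroup G2 N2 \<alpha> \<and> \<theta>2 \<noteq> 1\<^sub>m (bdim G2) \<longrightarrow>
         Type G2 N2 \<theta>2 = (if CHAR('a) \<noteq> 3 then S G2 else {1})))"
  using root_element_F4[of N4 _ \<theta>4] root_element_G2[of N2 _ \<theta>2] by blast

end
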